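(* Let $p\in\mathbb{R}^d$, and let $k(x,y)=e^{(x-p)^\top(y-p)}$ or $k(x,y)=e^{-\|x-y\|^2/2\sigma^2}$ (with $\sigma>0$) on $\mathbb{R}^d$, with RKHS $H$. Let $f:\mathbb{R}^d\to\mathbb{R}^d$ be a $C^\infty$ map with $f(p)=p$ and $V_p\subset D(C_f)$. Let $x_1,x_2,\dots$ be i.i.d. random variables whose distribution has a compactly supported density $\rho$ (with respect to Lebesgue measure) such that $\operatorname{ess\,inf}_{x\in U}\rho(x)>0$ for some nonempty open set $U\subset\mathbb{R}^d$, and let $y_i=f(x_i)$. Then for every integer $m\ge0$ there exist $b_m>0$ and $R>0$, independent of $n$, such that for every integer $n\ge m$, almost surely, $$\lim_{N\to\infty}\big\|\widehat{\mathbf{C}}_{m,n,N}-\mathbf{C}_{f,m}^\star\big\|\le \big\|C_f|_{V_{p,m}}\big\|_{\rm op}\cdot b_m n^m\cdot\frac{R^n}{\sqrt{n!}} .$$ In particular the left-hand side tends to $0$ almost surely as $n\to\infty$. Here $0^0=1$.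
   Context: The RKHS $H$ of $k$ satisfies $k_x:=k(x,\cdot)\in H$, $\langle h,k_x\rangle_H=h(x)$. $C_fh:=h\circ f$ with domain $D(C_f)=\{h\in H:h\circ f\in H\}$; $C_f^*$ is its adjoint. $V_{p,n}:=\mathrm{span}\{\partial_x^\alpha k(x,\cdot)|_{x=p}:|\alpha|\le n\}\subset H$, $V_p:=\bigcup_n V_{p,n}$, $r_n:=\dim V_{p,n}$. Since $f(p)=p$ and $C_f$ is densely defined ($V_p$ is dense in $H$), $C_f^*$ maps $V_{p,m}$ into itself. $\|C_f|_{V_{p,m}}\|_{\rm op}$ is the operator norm of $C_f:V_{p,m}\to H$. Fix an orthonormal basis $\{v_i\}_{i\ge1}$ of $V_p$ (orthonormal in $H$) such that $\{v_1,\dots,v_{r_n}\}$ is a basis of $V_{p,n}$ for every $n$. Put $\mathbf{v}_n(x):=(\overline{v_i(x)})_{i=1}^{r_n}\in\mathbb{C}^{r_n}$ and, for $X=(x_1,\dots,x_N)$, $\mathbf{V}_n^X:=(\mathbf{v}_n(x_1),\dots,\mathbf{v}_n(x_N))\in\mathbb{C}^{r_n\times N}$; similarly $\mathbf{V}_n^Y$ with $Y=(y_1,\dots,y_N)$. $\widehat{\mathbf{C}}_{m,n,N}\in\mathbb{C}^{r_m\times r_m}$ is the leading principal submatrix of order $r_m$ of $\mathbf{V}_n^Y(\mathbf{V}_n^X)^\dagger$, where $\dagger$ is the Moore–Penrose pseudo-inverse. $\mathbf{C}_{f,m}^\star$ is the matrix of $C_f^*|_{V_{p,m}}$ with respect to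 $\{v_1,\dots,v_{r_m}\}$. $\|\cdot\|$ on matrices is the Frobenius norm. *)

theory Defs
  imports
    "HOL-Probability.Probability"
    "HOL-Library.Function_Algebras"
    "Jordan_Normal_Form.Schur_Decomposition"
    "Jordan_Normal_Form.DL_Submatrix"
begin

definition fscale :: "complex \<Rightarrow> ('a \<Rightarrow> complex) \<Rightarrow> 'a \<Rightarrow> complex" where
  "fscale c g = (\<lambda>x. c * g x)"

global_interpretation cfun: vector_space "fscale :: complex \<Rightarrow> ('a \<Rightarrow> complex) \<Rightarrow> 'a \<Rightarrow> complex"
  by unfold_locales (auto simp: fscale_def fun_eq_iff algebra_simps)

definition hnorm :: "(('a \<Rightarrow> complex) \<Rightarrow> ('a \<Rightarrow> complex) \<Rightarrow> complex) \<Rightarrow> ('a \<Rightarrow> complex) \<Rightarrow> real" where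
  "hnorm ip h = sqrt (Re (ip h h))"

text \<open>The inner product \<open>ip\<close> is linear in its first argument and its values outside \<open>H\<close> are
  irrelevant. By the Moore--Aronszajn theorem a positive definite kernel \<open>k\<close> determines \<open>H\<close>,
  and \<open>ip\<close> on \<open>H\<close>, uniquely.\<close>

locale hilbert_function_space =
  fixes H :: "('a \<Rightarrow> complex) set"
    and ip :: "('a \<Rightarrow> complex) \<Rightarrow> ('a \<Rightarrow> complex) \<Rightarrow> complex"
  assumes subspace: "cfun.subspace H"
    and ip_add_left: "\<lbrakk>g \<in> H; h \<in> H; u \<in> H\<rbrakk> \<Longrightarrow> ip (g + h) u = ip g u + ip h u"
    and ip_scale_left: "\<lbrakk>g \<in> H; u \<in> H\<rbrakk> \<Longrightarrow> ip (fscale c g) u = c * ip g u"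
    and ip_cnj: "\<lbrakk>g \<in> H; h \<in> H\<rbrakk> \<Longrightarrow> ip h g = cnj (ip g h)"
    and ip_pos: "\<lbrakk>h \<in> H; h \<noteq> 0\<rbrakk> \<Longrightarrow> 0 < Re (ip h h)"
    and complete: "\<lbrakk>\<And>i. s i \<in> H; \<And>e. e > 0 \<Longrightarrow> \<exists>N. \<forall>i\<ge>N. \<forall>j\<ge>N. hnorm ip (s i - s j) < e\<rbrakk>
      \<Longrightarrow> \<exists>h\<in>H. (\<lambda>i. hnorm ip (s i - h)) \<longlonglongrightarrow> 0"

locale rkhs = hilbert_function_space H ip
  for k :: "'a \<Rightarrow> 'a \<Rightarrow> complex"
    and H :: "('a \<Rightarrow> complex) set"
    and ip :: "('a \<Rightarrow> complex) \<Rightarrow> ('a \<Rightarrow> complex) \<Rightarrow> complex" +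
  assumes kernel_section_in: "k x \<in> H"
    and reproducing: "h \<in> H \<Longrightarrow> ip h (k x) = h x"

definition exp_kernel :: "real ^ 'd \<Rightarrow> real ^ 'd \<Rightarrow> real ^ 'd \<Rightarrow> complex" where
  "exp_kernel p x y = complex_of_real (exp (inner (x - p) (y - p)))"

definition gauss_kernel :: "real \<Rightarrow> real ^ 'd \<Rightarrow> real ^ 'd \<Rightarrow> complex" where
  "gauss_kernel \<sigma> x y = complex_of_real (exp (- (norm (x - y))\<^sup>2 / (2 * \<sigma>\<^sup>2)))"

definition partial_deriv :: "'d \<Rightarrow> (real ^ 'd \<Rightarrow> complex) \<Rightarrow> real ^ 'd \<Rightarrow> complex" where
  "partial_deriv i g x = vector_derivative (\<lambda>t. g (x + t *\<^sub>R axis i 1)) (at 0)"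

text \<open>Here \<open>\<alpha>\<close> is a multi-index. Partial derivatives are taken in some fixed order, which is
  immaterial for the smooth functions this is applied to.\<close>

definition mixed_deriv :: "('d::finite \<Rightarrow> nat) \<Rightarrow> (real ^ 'd \<Rightarrow> complex) \<Rightarrow> real ^ 'd \<Rightarrow> complex" where
  "mixed_deriv \<alpha> g = foldr partial_deriv (SOME is. \<forall>i. count_list is i = \<alpha> i) g"

primrec Ck_map :: "nat \<Rightarrow> ('a::real_normed_vector \<Rightarrow> 'b::real_normed_vector) \<Rightarrow> bool" where
  "Ck_map 0 f \<longleftrightarrow> continuous_on UNIV f"
| "Ck_map (Suc n) f \<longleftrightarrow>
     (\<forall>x. f differentiable (at x)) \<and> (\<forall>v. Ck_map n (\<lambda>x. frechet_derivative f (at x) v))"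

definition smooth_map :: "('a::real_normed_vector \<Rightarrow> 'b::real_normed_vector) \<Rightarrow> bool" where
  "smooth_map f \<longleftrightarrow> (\<forall>n. Ck_map n f)"

definition jet_space_upto ::
    "(real ^ 'd \<Rightarrow> real ^ 'd \<Rightarrow> complex) \<Rightarrow> real ^ 'd::finite \<Rightarrow> nat \<Rightarrow> (real ^ 'd \<Rightarrow> complex) set" where
  "jet_space_upto k p n = cfun.span {\<lambda>y. mixed_deriv \<alpha> (\<lambda>x. k x y) p | \<alpha>. sum \<alpha> UNIV \<le> n}"

definition jet_space ::
    "(real ^ 'd \<Rightarrow> real ^ 'd \<Rightarrow> complex) \<Rightarrow> real ^ 'd::finite \<Rightarrow> (real ^ 'd \<Rightarrow> complex) set" where
  "jet_space k p = (\<Union>n. jet_space_upto k p n)"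

abbreviation jet_dim :: "(real ^ 'd \<Rightarrow> real ^ 'd \<Rightarrow> complex) \<Rightarrow> real ^ 'd::finite \<Rightarrow> nat \<Rightarrow> nat" where
  "jet_dim k p n \<equiv> cfun.dim (jet_space_upto k p n)"

text \<open>Basis vectors are indexed from \<open>0\<close>.\<close>

definition adapted_onb ::
    "(real ^ 'd \<Rightarrow> real ^ 'd \<Rightarrow> complex) \<Rightarrow> ((real ^ 'd \<Rightarrow> complex) \<Rightarrow> (real ^ 'd \<Rightarrow> complex) \<Rightarrow> complex)
      \<Rightarrow> real ^ 'd::finite \<Rightarrow> (nat \<Rightarrow> real ^ 'd \<Rightarrow> complex) \<Rightarrow> bool" where
  "adapted_onb k ip p v \<longleftrightarrow>
     (\<forall>i j. ip (v i) (v j) = (if i = j then 1 else 0)) \<and>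
     cfun.span (range v) = jet_space k p \<and>
     (\<forall>n. cfun.independent (v ` {..<jet_dim k p n}) \<and>
          cfun.span (v ` {..<jet_dim k p n}) = jet_space_upto k p n)"

definition comp_op :: "('a \<Rightarrow> 'a) \<Rightarrow> ('a \<Rightarrow> complex) \<Rightarrow> 'a \<Rightarrow> complex" where
  "comp_op f h = h \<circ> f"

definition comp_op_dom :: "('a \<Rightarrow> complex) set \<Rightarrow> ('a \<Rightarrow> 'a) \<Rightarrow> ('a \<Rightarrow> complex) set" where
  "comp_op_dom H f = {h \<in> H. h \<circ> f \<in> H}"

text \<open>The adjoint of an operator \<open>T\<close> with dense domain \<open>D \<subseteq> H\<close>. The value at \<open>g\<close> is unspecified
  if \<open>g\<close> is not in the domain of the adjoint.\<close>

definition adjoint_op ::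
    "('a \<Rightarrow> complex) set \<Rightarrow> (('a \<Rightarrow> complex) \<Rightarrow> ('a \<Rightarrow> complex) \<Rightarrow> complex) \<Rightarrow> ('a \<Rightarrow> complex) set
      \<Rightarrow> (('a \<Rightarrow> complex) \<Rightarrow> 'a \<Rightarrow> complex) \<Rightarrow> ('a \<Rightarrow> complex) \<Rightarrow> 'a \<Rightarrow> complex" where
  "adjoint_op H ip D T g = (THE u. u \<in> H \<and> (\<forall>h\<in>D. ip (T h) g = ip h u))"

definition op_norm_on ::
    "(('a \<Rightarrow> complex) \<Rightarrow> ('a \<Rightarrow> complex) \<Rightarrow> complex) \<Rightarrow> ('a \<Rightarrow> complex) set
      \<Rightarrow> (('a \<Rightarrow> complex) \<Rightarrow> 'a \<Rightarrow> complex) \<Rightarrow> real" where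
  "op_norm_on ip V T = (SUP h\<in>{h \<in> V. hnorm ip h \<le> 1}. hnorm ip (T h))"

text \<open>The matrix, with respect to the basis \<open>v 0, \<dots>, v (r - 1)\<close>, of an operator that maps the
  span of this basis into itself.\<close>

definition matrix_wrt ::
    "(nat \<Rightarrow> 'a \<Rightarrow> complex) \<Rightarrow> nat \<Rightarrow> (('a \<Rightarrow> complex) \<Rightarrow> 'a \<Rightarrow> complex) \<Rightarrow> complex mat" where
  "matrix_wrt v r T =
     (THE A. A \<in> carrier_mat r r \<and> (\<forall>j<r. T (v j) = (\<Sum>i<r. fscale (A $$ (i, j)) (v i))))"

definition pseudo_inverse :: "complex mat \<Rightarrow> complex mat" where
  "pseudo_inverse A =
     (THE B. B \<in> carrier_mat (dim_col A) (dim_row A) \<and>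
        A * B * A = A \<and> B * A * B = B \<and> mat_adjoint (A * B) = A * B \<and> mat_adjoint (B * A) = B * A)"

definition frob_norm :: "complex mat \<Rightarrow> real" where
  "frob_norm A = sqrt (\<Sum>i<dim_row A. \<Sum>j<dim_col A. (cmod (A $$ (i, j)))\<^sup>2)"

definition feature_mat :: "(nat \<Rightarrow> 'a \<Rightarrow> complex) \<Rightarrow> nat \<Rightarrow> nat \<Rightarrow> (nat \<Rightarrow> 'a) \<Rightarrow> complex mat" where
  "feature_mat v r N x = Matrix.mat r N (\<lambda>(i, j). cnj (v i (x j)))"

definition C_hat ::
    "(real ^ 'd \<Rightarrow> real ^ 'd \<Rightarrow> complex) \<Rightarrow> real ^ 'd::finite \<Rightarrow> (nat \<Rightarrow> real ^ 'd \<Rightarrow> complex)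
      \<Rightarrow> nat \<Rightarrow> nat \<Rightarrow> nat \<Rightarrow> (nat \<Rightarrow> real ^ 'd) \<Rightarrow> (nat \<Rightarrow> real ^ 'd) \<Rightarrow> complex mat" where
  "C_hat k p v m n N x y =
     submatrix
       (feature_mat v (jet_dim k p n) N y * pseudo_inverse (feature_mat v (jet_dim k p n) N x))
       {..<jet_dim k p m} {..<jet_dim k p m}"

definition C_star ::
    "(real ^ 'd \<Rightarrow> real ^ 'd \<Rightarrow> complex) \<Rightarrow> (real ^ 'd \<Rightarrow> complex) set
      \<Rightarrow> ((real ^ 'd \<Rightarrow> complex) \<Rightarrow> (real ^ 'd \<Rightarrow> complex) \<Rightarrow> complex)
      \<Rightarrow> (real ^ 'd \<Rightarrow> real ^ 'd) \<Rightarrow> real ^ 'd::finite \<Rightarrow> (nat \<Rightarrow> real ^ 'd \<Rightarrow> complex)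
      \<Rightarrow> nat \<Rightarrow> complex mat" where
  "C_star k H ip f p v m =
     matrix_wrt v (jet_dim k p m) (adjoint_op H ip (comp_op_dom H f) (comp_op f))"

definition essinf :: "'a measure \<Rightarrow> ('a \<Rightarrow> ereal) \<Rightarrow> ereal" where
  "essinf M g = - esssup M (\<lambda>x. - g x)"

end

theory Submission
  imports Defs
begin

text \<open>Both kernels have the form \<open>g x * g y * exp (inner (x - p) (y - p) / s)\<close> with a Gaussian weight
  \<open>g\<close>, so the jets of order at most \<open>n\<close> at \<open>p\<close> are \<open>g\<close> times the polynomials of degree at most \<open>n\<close>,
  and the inner product of \<open>h\<close> with a jet is a Taylor coefficient of \<open>h / g\<close> at \<open>p\<close>. Elements of \<open>H\<close>
  orthogonal to the jets of order \<open>n\<close> are the ones vanishing to order \<open>n + 1\<close> at \<open>p\<close>; composition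
  with \<open>f\<close> preserves them, which makes the adjoint block triangular with explicit entries. On
  compact sets they are bounded by their norm times \<open>a ^ n / sqrt (fact n)\<close>.

  By the law of large numbers the empirical matrix converges to the matrix of least squares
  coefficients, in \<open>L\<^sup>2\<close> of the sampling distribution, of the functions \<open>v i \<circ> f\<close>. Its difference to the
  coefficients in \<open>H\<close> consists of the coefficients of the \<open>L\<^sup>2\<close>-projection \<open>q\<close> of such a residual. The low
  order coefficients of \<open>q\<close> are at most exponentially (in \<open>n\<close>) larger than its \<open>L\<^sup>1\<close>-norm: the Taylor
  truncation of \<open>q\<close> at \<open>p\<close> is a combination of dilates of \<open>q\<close>, with Lagrange interpolation weights
  of exponential size.\<close>

section \<open>Pseudo-inverses and limits of regression matrices\<close>

text \<open>The bound asks for decay like R^n / sqrt (n!), so a constant that grows only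
  exponentially in n is harmless; the obstacle is to lose no more than that. Inverting the Gram
  matrix quantitatively would require a lower bound for its smallest eigenvalue while its order
  grows with n. This is avoided because only the coefficients with index below \<open>r m\<close>
  have to be controlled, and m stays fixed. The ball on which the density is bounded below need not
  contain p, so Taylor coefficients at p are extrapolated from values away from p. The dilation
  factors lie in [1, 1 + \<epsilon>]: a smaller ball is then mapped into the original one, and the
  Jacobian is at least 1, so Lebesgue integrals do not grow. The factor 1 / sqrt (n!) has a single
  source, the norm of the Taylor remainder of a normalized kernel section, whose square is a
  remainder of the exponential series. C_f may be unbounded and is accessible only through its
  domain, so its adjoint is found by testing against that domain; it is unique because nothing but 0
  is orthogonal to all jets.\<close>

lemma dim_mat_adjoint [simp]:
  "dim_row (mat_adjoint A) = dim_col A" "dim_col (mat_adjoint A) = dim_row A"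
  by (auto simp: mat_adjoint_def)

lemma mat_adjoint_carrier [simp]:
  "A \<in> carrier_mat r c \<Longrightarrow> mat_adjoint A \<in> carrier_mat c r"
  by (intro carrier_matI) auto

lemma mat_adjoint_index [simp]:
  "i < dim_col A \<Longrightarrow> j < dim_row A \<Longrightarrow> mat_adjoint A $$ (i, j) = cnj (A $$ (j, i))"
  by (auto simp: mat_adjoint_def mat_of_rows_def)

lemma mat_adjoint_mult:
  fixes A B :: "complex mat"
  assumes A: "A \<in> carrier_mat r c" and B: "B \<in> carrier_mat c d"
  shows "mat_adjoint (A * B) = mat_adjoint B * mat_adjoint A"
  using A B by (intro eq_matI) (auto simp: scalar_prod_def mult.commute intro!: sum.cong)

lemma mat_adjoint_twice [simp]: "mat_adjoint (mat_adjoint A) = (A :: complex mat)"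
  by (intro eq_matI) auto

lemma mat_adjoint_one [simp]: "mat_adjoint (1\<^sub>m n :: complex mat) = 1\<^sub>m n"
  by (intro eq_matI) auto

text \<open>Taking adjoints of \<open>A * B = (A * C) * (A * B)\<close> swaps the two Hermitian
  factors, and the product collapses to \<open>A * C\<close>. Likewise \<open>B * A = C * A\<close>,
  and then B = BAB = CAC = C. This is what gives the \<open>THE\<close> in
  \<open>pseudo_inverse\<close> a value.\<close>

lemma moore_penrose_unique:
  fixes A B C :: "complex mat"
  assumes A: "A \<in> carrier_mat r c" and B: "B \<in> carrier_mat c r" and C: "C \<in> carrier_mat c r"
    and B1: "A * B * A = A" and B2: "B * A * B = B"
    and B3: "mat_adjoint (A * B) = A * B" and B4: "mat_adjoint (B * A) = B * A"
    and C1: "A * C * A = A" and C2: "C * A * C = C"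
    and C3: "mat_adjoint (A * C) = A * C" and C4: "mat_adjoint (C * A) = C * A"
  shows "B = C"
proof -
  note car = A B C
  have AB: "A * B \<in> carrier_mat r r" and AC: "A * C \<in> carrier_mat r r"
    and BA: "B * A \<in> carrier_mat c c" and CA: "C * A \<in> carrier_mat c c" using car by auto
  have "A * B = (A * C * A) * B" using C1 by simp
  also have "\<dots> = (A * C) * (A * B)" by (rule assoc_mult_mat[OF AC A B])
  also have "\<dots> = mat_adjoint ((A * B) * (A * C))"
    using mat_adjoint_mult[OF AB AC] B3 C3 by simp
  also have "(A * B) * (A * C) = (A * B * A) * C" by (rule assoc_mult_mat[OF AB A C, symmetric])
  also have "\<dots> = A * C" using B1 by simp
  finally have 1: "A * B = A * C" using C3 by simp
  have "B * A = B * (A * C * A)" using C1 by simp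
  also have "\<dots> = B * (A * (C * A))" using assoc_mult_mat[OF A C A] by simp
  also have "\<dots> = (B * A) * (C * A)" by (rule assoc_mult_mat[OF B A CA, symmetric])
  also have "\<dots> = mat_adjoint ((C * A) * (B * A))"
    using mat_adjoint_mult[OF CA BA] B4 C4 by simp
  also have "(C * A) * (B * A) = C * (A * (B * A))" by (rule assoc_mult_mat[OF C A BA])
  also have "A * (B * A) = A" using B1 assoc_mult_mat[OF A B A] by simp
  finally have 2: "B * A = C * A" using C4 by simp
  have "B = B * A * B" using B2 by simp
  also have "\<dots> = C * A * B" using 2 by simp
  also have "\<dots> = C * (A * B)" by (rule assoc_mult_mat[OF C A B])
  also have "\<dots> = C * (A * C)" using 1 by simp
  also have "\<dots> = C * A * C" by (rule assoc_mult_mat[OF C A C, symmetric])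
  finally show ?thesis using C2 by simp
qed

text \<open>For invertible \<open>A * mat_adjoint A\<close> the candidate is a right inverse of
  \<open>A\<close>, which settles three Penrose equations at once; the fourth needs \<open>W\<close>
  to be Hermitian.\<close>

lemma pseudo_inverse_full_row_rank:
  assumes A: "A \<in> carrier_mat r c" and W: "W \<in> carrier_mat r r"
    and inv1: "(A * mat_adjoint A) * W = 1\<^sub>m r" and inv2: "W * (A * mat_adjoint A) = 1\<^sub>m r"
  shows "pseudo_inverse A = mat_adjoint A * W"
proof -
  let ?S = "mat_adjoint A"
  have S: "?S \<in> carrier_mat c r" using A by simp
  have AS: "A * ?S \<in> carrier_mat r r" using A S by simp
  have B: "?S * W \<in> carrier_mat c r" using S W by simp
  have WA: "W * A \<in> carrier_mat r c" using W A by simp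
  have W': "mat_adjoint W \<in> carrier_mat r r" using W by simp
  have AB: "A * (?S * W) = 1\<^sub>m r" using assoc_mult_mat[OF A S W] inv1 by simp
  have selfadj: "mat_adjoint (A * ?S) = A * ?S"
    using mat_adjoint_mult[OF A S] mat_adjoint_twice by simp
  \<comment> \<open>\<open>W\<close> is Hermitian because it inverts the Hermitian matrix
    \<open>A * ?S\<close>.\<close>
  have "mat_adjoint W = mat_adjoint W * ((A * ?S) * W)" using inv1 right_mult_one_mat[OF W'] by simp
  also have "\<dots> = (mat_adjoint W * (A * ?S)) * W" by (rule assoc_mult_mat[OF W' AS W, symmetric])
  also have "mat_adjoint W * (A * ?S) = mat_adjoint ((A * ?S) * W)"
    using mat_adjoint_mult[OF AS W] selfadj by simp
  also have "\<dots> = 1\<^sub>m r" using inv1 mat_adjoint_one by simp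
  finally have Wadj: "mat_adjoint W = W" using W by simp
  have BA: "?S * W * A = ?S * (W * A)" by (rule assoc_mult_mat[OF S W A])
  have "mat_adjoint (?S * W * A) = ?S * mat_adjoint (?S * W)" by (rule mat_adjoint_mult[OF B A])
  also have "mat_adjoint (?S * W) = W * A"
    unfolding mat_adjoint_mult[OF S W] mat_adjoint_twice Wadj ..
  finally have 4: "mat_adjoint (?S * W * A) = ?S * W * A" unfolding BA .
  have 1: "A * (?S * W) * A = A" unfolding AB using A by (rule left_mult_one_mat)
  have "?S * W * A * (?S * W) = ?S * W * (A * (?S * W))" by (rule assoc_mult_mat[OF B A B])
  also have "\<dots> = ?S * W" unfolding AB using B by (rule right_mult_one_mat)
  finally have 2: "?S * W * A * (?S * W) = ?S * W" .
  have 3: "mat_adjoint (A * (?S * W)) = A * (?S * W)" unfolding AB by (rule mat_adjoint_one)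
  show ?thesis
    unfolding pseudo_inverse_def
  proof (rule the_equality)
    show "?S * W \<in> carrier_mat (dim_col A) (dim_row A) \<and> A * (?S * W) * A = A \<and>
      (?S * W) * A * (?S * W) = ?S * W \<and> mat_adjoint (A * (?S * W)) = A * (?S * W) \<and>
      mat_adjoint ((?S * W) * A) = (?S * W) * A"
      using B 1 2 3 4 by (simp only: carrier_matD[OF A] simp_thms)
    fix C
    assume C: "C \<in> carrier_mat (dim_col A) (dim_row A) \<and> A * C * A = A \<and>
      C * A * C = C \<and> mat_adjoint (A * C) = A * C \<and> mat_adjoint (C * A) = C * A"
    hence C0: "C \<in> carrier_mat c r" and C1: "A * C * A = A" and C2: "C * A * C = C"
      and C3: "mat_adjoint (A * C) = A * C" and C4: "mat_adjoint (C * A) = C * A"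
      unfolding carrier_matD[OF A] by (simp_all only: simp_thms)
    show "C = ?S * W"
      by (rule moore_penrose_unique[OF A C0 B C1 C2 C3 C4 1 2 3 4])
  qed
qed

section \<open>Entrywise limits of determinants, adjugates and regression matrices\<close>

lemma tendsto_det:
  fixes A :: "nat \<Rightarrow> complex mat"
  assumes "\<And>N. A N \<in> carrier_mat r r" "B \<in> carrier_mat r r"
    and "\<And>i j. i < r \<Longrightarrow> j < r \<Longrightarrow> (\<lambda>N. A N $$ (i, j)) \<longlonglongrightarrow> B $$ (i, j)"
  shows "(\<lambda>N. Determinant.det (A N)) \<longlonglongrightarrow> Determinant.det B"
proof -
  have dims: "dim_row (A N) = r" "dim_col (A N) = r" "dim_row B = r" "dim_col B = r" for N
    using assms(1)[of N] assms(2) by auto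
  show ?thesis
    unfolding Determinant.det_def dims
    by (auto intro!: tendsto_sum tendsto_mult tendsto_prod assms(3) dest: permutes_in_image)
qed

lemma tendsto_adj_mat:
  fixes A :: "nat \<Rightarrow> complex mat"
  assumes "\<And>N. A N \<in> carrier_mat r r" "B \<in> carrier_mat r r"
    and "\<And>i j. i < r \<Longrightarrow> j < r \<Longrightarrow> (\<lambda>N. A N $$ (i, j)) \<longlonglongrightarrow> B $$ (i, j)"
    and ij: "i < r" "j < r"
  shows "(\<lambda>N. adj_mat (A N) $$ (i, j)) \<longlonglongrightarrow> adj_mat B $$ (i, j)"
proof -
  have dims: "dim_row (A N) = r" "dim_col (A N) = r" "dim_row B = r" "dim_col B = r" for N
    using assms(1)[of N] assms(2) by auto
  have "(\<lambda>N. Determinant.det (mat_delete (A N) j i)) \<longlonglongrightarrow> Determinant.det (mat_delete B j i)"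
    by (rule tendsto_det[of _ "r - 1"]) (use ij in \<open>auto simp: mat_delete_def dims intro!: assms(3)\<close>)
  thus ?thesis
    using ij by (auto simp: adj_mat_def dims cofactor_def intro!: tendsto_intros)
qed

lemma tendsto_mat_mult_index:
  fixes A B :: "nat \<Rightarrow> complex mat"
  assumes "\<And>N. A N \<in> carrier_mat r s" "A' \<in> carrier_mat r s"
    and "\<And>N. B N \<in> carrier_mat s t" "B' \<in> carrier_mat s t"
    and A: "\<And>i j. i < r \<Longrightarrow> j < s \<Longrightarrow> (\<lambda>N. A N $$ (i, j)) \<longlonglongrightarrow> A' $$ (i, j)"
    and B: "\<And>i j. i < s \<Longrightarrow> j < t \<Longrightarrow> (\<lambda>N. B N $$ (i, j)) \<longlonglongrightarrow> B' $$ (i, j)"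
    and ij: "i < r" "j < t"
  shows "(\<lambda>N. (A N * B N) $$ (i, j)) \<longlonglongrightarrow> (A' * B') $$ (i, j)"
proof -
  have dims: "dim_row (A N) = r" "dim_col (A N) = s" "dim_row A' = r" "dim_col A' = s"
    "dim_row (B N) = s" "dim_col (B N) = t" "dim_row B' = s" "dim_col B' = t" for N
    using assms(1)[of N] assms(2) assms(3)[of N] assms(4) by auto
  show ?thesis
    using ij by (auto simp: dims scalar_prod_def intro!: tendsto_sum tendsto_mult A B)
qed

text \<open>Gram matrices divided by N converge to an invertible limit, so they are eventually
  invertible themselves; there the full-rank formula applies and the factors 1/N cancel. The limit
  is described by its normal equation \<open>A * G = M\<close>. The dimensions are asserted only
  eventually, since for singular Gram matrices the pseudo-inverse is not computed.\<close>

lemma tendsto_pseudo_inverse_regression: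
  fixes V Y :: "nat \<Rightarrow> complex mat"
  assumes V: "\<And>N. V N \<in> carrier_mat r N" and Y: "\<And>N. Y N \<in> carrier_mat r N"
    and G: "G \<in> carrier_mat r r" and M: "M \<in> carrier_mat r r" and det: "Determinant.det G \<noteq> 0"
    and limG: "\<And>i j. i < r \<Longrightarrow> j < r \<Longrightarrow> (\<lambda>N. (V N * mat_adjoint (V N)) $$ (i, j) / of_nat N) \<longlonglongrightarrow> G $$ (i, j)"
    and limM: "\<And>i j. i < r \<Longrightarrow> j < r \<Longrightarrow> (\<lambda>N. (Y N * mat_adjoint (V N)) $$ (i, j) / of_nat N) \<longlonglongrightarrow> M $$ (i, j)"
  obtains A where "A \<in> carrier_mat r r" "A * G = M"
    "\<And>i j. i < r \<Longrightarrow> j < r \<Longrightarrow> (\<lambda>N. (Y N * pseudo_inverse (V N)) $$ (i, j)) \<longlonglongrightarrow> A $$ (i, j)"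
    "\<forall>\<^sub>F N in sequentially. Y N * pseudo_inverse (V N) \<in> carrier_mat r r"
proof
  define S where "S N = V N * mat_adjoint (V N)" for N
  define T where "T N = Y N * mat_adjoint (V N)" for N
  define G' where "G' N = (1 / of_nat N) \<cdot>\<^sub>m S N" for N
  define M' where "M' N = (1 / of_nat N) \<cdot>\<^sub>m T N" for N
  \<comment> \<open>Cramer's formula makes the inverse a continuous function of the entries wherever
    the determinant is nonzero.\<close>
  define minv where "minv B = (1 / Determinant.det B) \<cdot>\<^sub>m adj_mat B" for B :: "complex mat"
  have S: "S N \<in> carrier_mat r r" and T: "T N \<in> carrier_mat r r" for N
    using V[of N] Y[of N] mat_adjoint_carrier[OF V[of N]] unfolding S_def T_def by auto
  have G': "G' N \<in> carrier_mat r r" and M': "M' N \<in> carrier_mat r r" for N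
    using S[of N] T[of N] by (auto simp: G'_def M'_def)
  have limG': "(\<lambda>N. G' N $$ (i, j)) \<longlonglongrightarrow> G $$ (i, j)" if "i < r" "j < r" for i j
  proof -
    have "G' N $$ (i, j) = S N $$ (i, j) / of_nat N" for N
      unfolding G'_def using carrier_matD[OF S[of N]] that by simp
    thus ?thesis using limG[OF that] by (simp add: S_def)
  qed
  have limM': "(\<lambda>N. M' N $$ (i, j)) \<longlonglongrightarrow> M $$ (i, j)" if "i < r" "j < r" for i j
  proof -
    have "M' N $$ (i, j) = T N $$ (i, j) / of_nat N" for N
      unfolding M'_def using carrier_matD[OF T[of N]] that by simp
    thus ?thesis using limM[OF that] by (simp add: T_def)
  qed
  have limdet: "(\<lambda>N. Determinant.det (G' N)) \<longlonglongrightarrow> Determinant.det G"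
    by (rule tendsto_det[OF G' G limG'])
  have minv: "minv B \<in> carrier_mat r r" if "B \<in> carrier_mat r r" for B
    using adj_mat(1)[OF that] by (simp add: minv_def)
  have inv_right: "B * minv B = 1\<^sub>m r" and inv_left: "minv B * B = 1\<^sub>m r"
    if "B \<in> carrier_mat r r" "Determinant.det B \<noteq> 0" for B
  proof -
    note adj = adj_mat[OF that(1)]
    have "B * minv B = (1 / Determinant.det B) \<cdot>\<^sub>m (B * adj_mat B)"
      unfolding minv_def by (rule mult_smult_distrib[OF that(1) adj(1)])
    also have "\<dots> = 1\<^sub>m r" unfolding adj(2) using that(2) by (intro eq_matI) auto
    finally show "B * minv B = 1\<^sub>m r" .
    have "minv B * B = (1 / Determinant.det B) \<cdot>\<^sub>m (adj_mat B * B)"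
      unfolding minv_def by (rule mult_smult_assoc_mat[OF adj(1) that(1)])
    also have "\<dots> = 1\<^sub>m r" unfolding adj(3) using that(2) by (intro eq_matI) auto
    finally show "minv B * B = 1\<^sub>m r" .
  qed
  have liminv: "(\<lambda>N. minv (G' N) $$ (i, j)) \<longlonglongrightarrow> minv G $$ (i, j)" if ij: "i < r" "j < r" for i j
  proof -
    have e: "minv B $$ (i, j) = 1 / Determinant.det B * adj_mat B $$ (i, j)"
      if B: "B \<in> carrier_mat r r" for B
      using adj_mat(1)[OF B] ij by (simp add: minv_def)
    show ?thesis unfolding e[OF G] e[OF G']
      by (intro tendsto_intros limdet det tendsto_adj_mat[OF G' G limG'] ij)
  qed
  show "M * minv G \<in> carrier_mat r r" using M minv[OF G] by simp
  show "M * minv G * G = M"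
    using assoc_mult_mat[OF M minv[OF G] G] inv_left[OF G det] M by simp
  have "\<forall>\<^sub>F N in sequentially. Determinant.det (G' N) \<noteq> 0"
    using limdet det by (rule tendsto_imp_eventually_ne)
  hence ev: "\<forall>\<^sub>F N in sequentially. M' N * minv (G' N) = Y N * pseudo_inverse (V N)"
    using eventually_gt_at_top[of 0]
  proof eventually_elim
    case (elim N)
    \<comment> \<open>\<open>G' N\<close> is \<open>S N\<close> divided by N, so dividing its
      inverse by N gives the inverse of \<open>S N\<close>.\<close>
    let ?W = "(1 / of_nat N :: complex) \<cdot>\<^sub>m minv (G' N)"
    note iG = minv[OF G'[of N]]
    have W: "?W \<in> carrier_mat r r" using iG by simp
    have "S N * ?W = (1 / of_nat N) \<cdot>\<^sub>m (S N * minv (G' N))"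
      by (rule mult_smult_distrib[OF S iG])
    also have "\<dots> = G' N * minv (G' N)"
      unfolding G'_def[of N] by (rule mult_smult_assoc_mat[OF S, symmetric]) (use iG in \<open>simp add: G'_def\<close>)
    finally have 1: "S N * ?W = 1\<^sub>m r" using inv_right[OF G' elim(1)] by simp
    have "?W * S N = (1 / of_nat N) \<cdot>\<^sub>m (minv (G' N) * S N)"
      by (rule mult_smult_assoc_mat[OF iG S])
    also have "\<dots> = minv (G' N) * G' N"
      unfolding G'_def by (rule mult_smult_distrib[symmetric, OF _ S]) (use iG in \<open>simp add: G'_def\<close>)
    finally have 2: "?W * S N = 1\<^sub>m r" using inv_left[OF G' elim(1)] by simp
    have p: "pseudo_inverse (V N) = mat_adjoint (V N) * ?W"
      by (rule pseudo_inverse_full_row_rank[OF V W]) (use 1 2 in \<open>auto simp: S_def\<close>)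
    have "Y N * pseudo_inverse (V N) = T N * ?W"
      unfolding p T_def by (rule assoc_mult_mat[OF Y mat_adjoint_carrier[OF V] W, symmetric])
    also have "\<dots> = (1 / of_nat N) \<cdot>\<^sub>m (T N * minv (G' N))"
      by (rule mult_smult_distrib[OF T iG])
    also have "\<dots> = M' N * minv (G' N)"
      unfolding M'_def by (rule mult_smult_assoc_mat[OF T iG, symmetric])
    finally show ?case by simp
  qed
  show "\<forall>\<^sub>F N in sequentially. Y N * pseudo_inverse (V N) \<in> carrier_mat r r"
    using ev by eventually_elim (metis M' minv[OF G'] mult_carrier_mat)
  fix i j assume ij: "i < r" "j < r"
  have "(\<lambda>N. (M' N * minv (G' N)) $$ (i, j)) \<longlonglongrightarrow> (M * minv G) $$ (i, j)"
    by (rule tendsto_mat_mult_index[OF M' M minv[OF G'] minv[OF G] limM' liminv ij])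
  thus "(\<lambda>N. (Y N * pseudo_inverse (V N)) $$ (i, j)) \<longlonglongrightarrow> (M * minv G) $$ (i, j)"
    by (rule Lim_transform_eventually) (use ev in \<open>auto elim!: eventually_mono\<close>)
qed

section \<open>Polynomial coefficients as weighted values\<close>

text \<open>Multiplication by a linear factor turns each coefficient into a combination of two
  neighbouring ones, so a uniform bound grows at most by the sum of the norms of the two
  entries.\<close>

lemma norm_coeff_prod_linear_le:
  fixes a b :: "'i \<Rightarrow> 'a::real_normed_field"
  assumes "finite J"
  shows "norm (coeff (\<Prod>j\<in>J. [:a j, b j:]) l) \<le> (\<Prod>j\<in>J. norm (a j) + norm (b j))"
  using assms
proof (induction J arbitrary: l rule: finite_induct)
  case empty
  show ?case by (cases l) auto
next
  case (insert x J)
  let ?Q = "\<Prod>j\<in>J. [:a j, b j:]" and ?B = "\<Prod>j\<in>J. norm (a j) + norm (b j)"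
  have "coeff ([:a x, b x:] * ?Q) l = a x * coeff ?Q l + b x * (case l of 0 \<Rightarrow> 0 | Suc k \<Rightarrow> coeff ?Q k)"
    by (cases l) auto
  also have "norm \<dots> \<le> norm (a x) * ?B + norm (b x) * ?B"
    using insert.IH prod_nonneg[of J "\<lambda>j. norm (a j) + norm (b j)"]
    by (intro norm_triangle_mono) (auto simp: norm_mult split: nat.split intro!: mult_left_mono)
  finally show ?case using insert by (simp add: algebra_simps)
qed

text \<open>The difference of the two sides has degree at most n and n + 1 distinct roots. The basis
  polynomials are written as products of explicit linear factors so that their coefficients can be
  estimated factor by factor.\<close>

lemma lagrange_interpolation:
  fixes t :: "nat \<Rightarrow> 'a::field"
  assumes inj: "inj_on t {..n}" and deg: "degree P \<le> n"
  shows "P = (\<Sum>i\<le>n. Polynomial.smult (poly P (t i)) (\<Prod>j\<in>{..n} - {i}. [:- t j / (t i - t j), 1 / (t i - t j):]))"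
    (is "P = (\<Sum>i\<le>n. Polynomial.smult _ (?L i))")
proof -
  let ?S = "\<Sum>i\<le>n. Polynomial.smult (poly P (t i)) (?L i)"
  have degL: "degree (?L i) \<le> n" if "i \<le> n" for i
  proof -
    have "degree (?L i) \<le> (\<Sum>j\<in>{..n} - {i}. degree [:- t j / (t i - t j), 1 / (t i - t j):])"
      by (rule order_trans[OF degree_prod_sum_le]) (auto simp: o_def)
    also have "\<dots> \<le> (\<Sum>j\<in>{..n} - {i}. 1)" by (intro sum_mono) auto
    also have "\<dots> \<le> n" using that by simp
    finally show ?thesis .
  qed
  have degS: "degree (P - ?S) \<le> n"
    by (intro degree_diff_le deg degree_sum_le order_trans[OF degree_smult_le degL]) auto
  have ev: "poly (?L i) (t k) = (if i = k then 1 else 0)" if "i \<le> n" "k \<le> n" for i k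
  proof (cases "i = k")
    case True
    have "poly (?L i) (t k) = (\<Prod>j\<in>{..n} - {i}. 1)"
      unfolding poly_prod
    proof (rule prod.cong)
      fix j assume j: "j \<in> {..n} - {i}"
      hence "t i - t j \<noteq> 0" using inj that by (auto simp: inj_on_def)
      thus "poly [:- t j / (t i - t j), 1 / (t i - t j):] (t k) = 1"
        using True by (simp add: diff_divide_distrib[symmetric])
    qed simp
    thus ?thesis using True by simp
  next
    case False
    have "poly [:- t k / (t i - t k), 1 / (t i - t k):] (t k) = 0"
      by simp
    hence "poly (?L i) (t k) = 0" unfolding poly_prod using False that
      by (intro prod_zero) (auto intro!: bexI[of _ k])
    thus ?thesis using False by simp
  qed
  have "P - ?S = 0"
  proof (rule ccontr)
    assume nz: "P - ?S \<noteq> 0"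
    have "poly (P - ?S) (t k) = 0" if "k \<le> n" for k
      proof -
      have "(\<Sum>i\<le>n. poly P (t i) * poly (?L i) (t k)) = (\<Sum>i\<le>n. if i = k then poly P (t i) else 0)"
        using that by (intro sum.cong refl) (simp only: ev atMost_iff, simp)
      also have "\<dots> = poly P (t k)" using that by simp
      finally show ?thesis by (simp only: poly_diff poly_sum poly_smult diff_self)
    qed
    hence sub: "t ` {..n} \<subseteq> {x. poly (P - ?S) x = 0}" by blast
    have "card (t ` {..n}) = Suc n" using inj by (simp add: card_image)
    moreover have "card (t ` {..n}) \<le> card {x. poly (P - ?S) x = 0}"
      by (rule card_mono[OF poly_roots_finite[OF nz] sub])
    moreover have "card {x. poly (P - ?S) x = 0} \<le> degree (P - ?S)"
      by (rule card_poly_roots_bound[OF nz])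
    ultimately show False using degS by linarith
  qed
  thus ?thesis by (rule eq_iff_diff_eq_0[THEN iffD2])
qed

text \<open>These are the denominators of the Lagrange basis at equidistant nodes, up to the
  spacing; dividing \<open>fact n\<close> by them gives binomial coefficients.\<close>

lemma prod_abs_diff_nat:
  assumes "i \<le> n"
  shows "(\<Prod>j\<in>{..n} - {i}. \<bar>real i - real j\<bar>) = fact i * fact (n - i)"
proof -
  have "{..n} - {i} = {..<i} \<union> {i<..n}" using assms by auto
  hence "(\<Prod>j\<in>{..n} - {i}. \<bar>real i - real j\<bar>) =
      (\<Prod>j\<in>{..<i}. \<bar>real i - real j\<bar>) * (\<Prod>j\<in>{i<..n}. \<bar>real i - real j\<bar>)"
    by (simp add: prod.union_disjoint disjoint_iff)
  also have "(\<Prod>j\<in>{..<i}. \<bar>real i - real j\<bar>) = (\<Prod>j=1..i. real j)"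
    by (rule prod.reindex_bij_witness[of _ "\<lambda>j. i - j" "\<lambda>j. i - j"]) auto
  also have "(\<Prod>j\<in>{i<..n}. \<bar>real i - real j\<bar>) = (\<Prod>j=1..n-i. real j)"
    by (rule prod.reindex_bij_witness[of _ "\<lambda>j. i + j" "\<lambda>j. j - i"]) auto
  finally show ?thesis by (simp add: fact_prod)
qed

text \<open>One term of the exponential series at n + 1. It absorbs the n-th power of the inverse
  node spacing.\<close>

lemma power_le_exp_fact: "(real n + 1) ^ n \<le> exp (real n + 1) * fact n"
proof -
  have "(real n + 1) ^ n / fact n \<le> exp (real n + 1)"
  proof -
    have "(\<Sum>k\<in>{n}. (real n + 1) ^ k /\<^sub>R fact k) \<le> (\<Sum>k. (real n + 1) ^ k /\<^sub>R fact k)"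
      by (rule sum_le_suminf[OF summable_exp_generic]) auto
    thus ?thesis unfolding exp_def by (simp add: divide_inverse mult.commute)
  qed
  thus ?thesis by (simp add: field_simps)
qed

text \<open>Extrapolation to 0 from n + 1 equidistant nodes in [1, 1 + \<epsilon>]; each weight sums
  the low coefficients of a Lagrange basis polynomial. The growth stays exponential because the
  powers (n + 1)^n from the spacing are matched by the factorials in the denominators.\<close>

lemma coeff_sum_eq_weighted_values:
  fixes \<epsilon> :: real and m n :: nat
  assumes \<epsilon>: "0 < \<epsilon>" "\<epsilon> \<le> 1"
  obtains w :: "nat \<Rightarrow> complex" where
    "\<And>P. degree P \<le> n \<Longrightarrow>
      (\<Sum>l\<le>m. coeff P l) = (\<Sum>i\<le>n. w i * poly P (of_real (1 + \<epsilon> * real i / (real n + 1))))"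
    "(\<Sum>i\<le>n. norm (w i)) \<le> (real m + 1) * exp 1 * (6 * exp 1 / \<epsilon>) ^ n"
proof
  define t where "t i = (of_real (1 + \<epsilon> * real i / (real n + 1)) :: complex)" for i
  define L where "L i = (\<Prod>j\<in>{..n} - {i}. [:- t j / (t i - t j), 1 / (t i - t j):])" for i
  define w where "w i = (\<Sum>l\<le>m. coeff (L i) l)" for i
  have tdiff: "norm (t i - t j) = \<epsilon> / (real n + 1) * \<bar>real i - real j\<bar>" for i j
  proof -
    have "t i - t j = of_real (\<epsilon> / (real n + 1) * (real i - real j))"
      by (simp add: t_def algebra_simps add_divide_distrib diff_divide_distrib)
    thus ?thesis using \<epsilon> by (simp only: norm_of_real) (simp add: abs_mult)
  qed
  have inj: "inj_on t {..n}"
  proof (rule inj_onI)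
    fix i j assume "t i = t j"
    hence "norm (t i - t j) = 0" by simp
    thus "i = j" unfolding tdiff using \<epsilon> by auto
  qed
  have tnorm: "norm (t j) \<le> 2" if "j \<le> n" for j
  proof -
    have "\<epsilon> * (real j / (real n + 1)) \<le> 1 * 1" using \<epsilon> that by (intro mult_mono) auto
    thus ?thesis using \<epsilon> unfolding t_def norm_of_real by simp
  qed
  show "(\<Sum>l\<le>m. coeff P l) = (\<Sum>i\<le>n. w i * poly P (of_real (1 + \<epsilon> * real i / (real n + 1))))"
    if "degree P \<le> n" for P
  proof -
    have P: "P = (\<Sum>i\<le>n. Polynomial.smult (poly P (t i)) (L i))"
      unfolding L_def by (rule lagrange_interpolation[OF inj that])
    have "(\<Sum>l\<le>m. coeff P l) = (\<Sum>l\<le>m. \<Sum>i\<le>n. poly P (t i) * coeff (L i) l)"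
      by (subst (1) P) (simp add: coeff_sum)
    also have "\<dots> = (\<Sum>i\<le>n. w i * poly P (t i))"
      unfolding w_def by (subst sum.swap) (simp add: sum_distrib_left sum_distrib_right mult.commute)
    finally show ?thesis by (simp add: t_def)
  qed
  \<comment> \<open>The nodes have norm at most 2, so 3 bounds \<open>norm (t j) + 1\<close>;
    division by the spacing \<epsilon> / (n + 1) gives \<open>D\<close>.\<close>
  define D where "D = 3 * (real n + 1) / \<epsilon>"
  have coeffL: "norm (coeff (L i) l) \<le> exp 1 * (3 * exp 1 / \<epsilon>) ^ n * real (n choose i)" if i: "i \<le> n" for i l
  proof -
    have "norm (coeff (L i) l) \<le> (\<Prod>j\<in>{..n} - {i}. norm (- t j / (t i - t j)) + norm (1 / (t i - t j)))"
      unfolding L_def by (rule norm_coeff_prod_linear_le) simp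
    also have "\<dots> \<le> (\<Prod>j\<in>{..n} - {i}. D / \<bar>real i - real j\<bar>)"
    proof (rule prod_mono)
      fix j assume j: "j \<in> {..n} - {i}"
      have "norm (- t j / (t i - t j)) + norm (1 / (t i - t j)) = (norm (t j) + 1) / norm (t i - t j)"
        by (simp add: norm_divide add_divide_distrib)
      also have "\<dots> \<le> 3 / norm (t i - t j)" using tnorm[of j] j by (intro divide_right_mono) auto
      also have "\<dots> = D / \<bar>real i - real j\<bar>" unfolding tdiff D_def using \<epsilon> by (simp add: field_simps)
      finally show "0 \<le> norm (- t j / (t i - t j)) + norm (1 / (t i - t j)) \<and>
        norm (- t j / (t i - t j)) + norm (1 / (t i - t j)) \<le> D / \<bar>real i - real j\<bar>" by simp
    qed
    also have "\<dots> = D ^ n / (fact i * fact (n - i))"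
      using i by (simp add: prod_dividef prod_abs_diff_nat)
    also have "\<dots> = (3 / \<epsilon>) ^ n * ((real n + 1) ^ n / (fact i * fact (n - i)))"
      unfolding D_def times_divide_eq_right times_divide_eq_left[symmetric] power_mult_distrib[symmetric] by simp
    also have "\<dots> \<le> (3 / \<epsilon>) ^ n * (exp (real n + 1) * fact n / (fact i * fact (n - i)))"
      using \<epsilon> by (intro mult_left_mono divide_right_mono power_le_exp_fact) auto
    also have "\<dots> = (3 / \<epsilon>) ^ n * exp 1 * exp 1 ^ n * real (n choose i)"
      using i by (simp add: binomial_fact exp_add exp_of_nat_mult[of n 1, simplified])
    finally show ?thesis by (simp add: power_mult_distrib power_divide mult_ac)
  qed
  have "(\<Sum>i\<le>n. norm (w i)) \<le> (\<Sum>i\<le>n. (real m + 1) * (exp 1 * (3 * exp 1 / \<epsilon>) ^ n * real (n choose i)))"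
  proof (rule sum_mono)
    fix i assume "i \<in> {..n}"
    hence "norm (w i) \<le> (\<Sum>l\<le>m. exp 1 * (3 * exp 1 / \<epsilon>) ^ n * real (n choose i))"
      unfolding w_def by (intro sum_norm_le coeffL) auto
    thus "norm (w i) \<le> (real m + 1) * (exp 1 * (3 * exp 1 / \<epsilon>) ^ n * real (n choose i))"
      by (simp add: algebra_simps)
  qed
  also have "\<dots> = (real m + 1) * exp 1 * (3 * exp 1 / \<epsilon>) ^ n * real (\<Sum>i\<le>n. n choose i)"
    by (simp add: sum_distrib_left sum_distrib_right mult_ac)
  \<comment> \<open>The binomial coefficients sum to 2^n, which turns the base 3 into 6.\<close>
  also have "\<dots> = (real m + 1) * exp 1 * (6 * exp 1 / \<epsilon>) ^ n"
    by (simp only: choose_row_sum) (simp add: power_mult_distrib[symmetric] mult_ac)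
  finally show "(\<Sum>i\<le>n. norm (w i)) \<le> (real m + 1) * exp 1 * (6 * exp 1 / \<epsilon>) ^ n" .
qed

section \<open>Law of large numbers and Gram matrices\<close>

text \<open>Hoeffding's inequality makes the probability of a deviation by \<epsilon> decay
  geometrically in N. Borel-Cantelli then gives almost sure control for each \<epsilon>, and
  countably many \<epsilon> suffice.\<close>

lemma (in prob_space) slln_bounded_real:
  fixes Y :: "nat \<Rightarrow> 'a \<Rightarrow> real"
  assumes indep: "indep_vars (\<lambda>_. borel) Y UNIV"
    and bound: "\<And>i. AE x in M. \<bar>Y i x\<bar> \<le> b"
    and mean: "\<And>i. expectation (Y i) = \<mu>"
  shows "AE x in M. (\<lambda>N. (\<Sum>i<N. Y i x) / real N) \<longlonglongrightarrow> \<mu>"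
proof -
  \<comment> \<open>Positive even when \<open>b\<close> is 0, so that the Hoeffding exponent has a
    nonzero denominator.\<close>
  define B where "B = \<bar>b\<bar> + 1"
  have B: "B > 0" unfolding B_def by linarith
  have meas [measurable]: "random_variable borel (Y i)" for i
    using indep unfolding indep_vars_def by blast
  have bnd: "AE x in M. Y i x \<in> {-B..B}" for i
    using bound[of i] by eventually_elim (auto simp: B_def)
  have conv: "AE x in M. \<forall>\<^sub>F N in sequentially. \<bar>(\<Sum>i<N. Y i x) / real N - \<mu>\<bar> < \<epsilon>" if \<epsilon>: "\<epsilon> > 0" for \<epsilon> :: real
  proof -
    define A where "A N = {x \<in> space M. \<bar>(\<Sum>i<N. Y i x) - real N * \<mu>\<bar> \<ge> \<epsilon> * real N}" for N
    \<comment> \<open>The exponent for deviation \<epsilon> N and N intervals of length 2 B is -2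
      (\<epsilon> N)^2 / (4 B^2 N), which is linear in N.\<close>
    define q where "q = exp (- (\<epsilon>\<^sup>2 / (2 * B\<^sup>2)))"
    have A_sets: "A N \<in> sets M" for N unfolding A_def by measurable
    have prob_A: "prob (A N) \<le> 2 * q ^ N" for N
    proof (cases "N = 0")
      case True
      then show ?thesis using order_trans[OF prob_le_1[of "A N"], of 2] by simp
    next
      case False
      interpret H: Hoeffding_ineq M "{..<N}" Y "\<lambda>_. - B" "\<lambda>_. B" "\<Sum>i<N. expectation (Y i)"
        by unfold_locales (use bnd indep_vars_subset[OF indep] in auto)
      have "prob (A N) \<le> 2 * exp (- 2 * (\<epsilon> * real N)\<^sup>2 / (\<Sum>i<N. (B - - B)\<^sup>2))"
        using H.Hoeffding_ineq_abs_ge[of "\<epsilon> * real N"] \<epsilon> B False by (simp add: A_def mean)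
      also have "- 2 * (\<epsilon> * real N)\<^sup>2 / (\<Sum>i<N. (B - - B)\<^sup>2) = real N * - (\<epsilon>\<^sup>2 / (2 * B\<^sup>2))"
        using False B by (simp add: field_simps power2_eq_square)
      finally show ?thesis unfolding q_def by (simp only: exp_of_nat_mult)
    qed
    have "summable (\<lambda>N. 2 * q ^ N)"
      using \<epsilon> B by (intro summable_mult summable_geometric) (simp add: q_def)
    hence "summable (\<lambda>N. prob (A N))"
      by (rule summable_comparison_test') (use prob_A in auto)
    hence "AE x in M. \<forall>\<^sub>F N in sequentially. x \<in> space M - A N"
      by (intro borel_cantelli_AE1 A_sets) (auto simp: emeasure_eq_measure)
    thus ?thesis
    proof eventually_elim
      case (elim x)
      show ?case using elim eventually_gt_at_top[of 0]
      proof eventually_elim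
        case (elim N)
        hence "\<bar>(\<Sum>i<N. Y i x) - real N * \<mu>\<bar> < \<epsilon> * real N" by (auto simp: A_def)
        moreover have "(\<Sum>i<N. Y i x) / real N - \<mu> = ((\<Sum>i<N. Y i x) - real N * \<mu>) / real N"
          using elim(2) by (simp add: diff_divide_distrib)
        ultimately show ?case using elim(2) by (simp only: abs_divide abs_of_nat) (simp add: divide_less_eq)
      qed
    qed
  qed
  have "AE x in M. \<forall>m::nat. \<forall>\<^sub>F N in sequentially. \<bar>(\<Sum>i<N. Y i x) / real N - \<mu>\<bar> < 1 / real (Suc m)"
    by (subst AE_all_countable) (auto intro!: conv)
  thus ?thesis
  proof eventually_elim
    case (elim x)
    show ?case
    proof (rule tendstoI)
      fix e :: real assume "e > 0"
      then obtain m where m: "1 / real (Suc m) < e" using nat_approx_posE by blast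
      show "\<forall>\<^sub>F N in sequentially. dist ((\<Sum>i<N. Y i x) / real N) \<mu> < e"
        using elim[rule_format, of m] by eventually_elim (use m in \<open>auto simp: dist_real_def\<close>)
    qed
  qed
qed

text \<open>Real and imaginary parts are treated separately. An almost everywhere bound is the form
  available for continuous functions when the distribution is carried by a compact set.\<close>

lemma (in prob_space) slln_bounded_complex:
  fixes X :: "nat \<Rightarrow> 'a \<Rightarrow> 'b::topological_space" and h :: "'b \<Rightarrow> complex"
  assumes indep: "indep_vars (\<lambda>_. borel) X UNIV"
    and distr: "\<And>i. distr M borel (X i) = D"
    and h [measurable]: "h \<in> borel_measurable borel"
    and bound: "AE x in D. norm (h x) \<le> b"
  shows "AE \<omega> in M. (\<lambda>N. (\<Sum>i<N. h (X i \<omega>)) / of_nat N) \<longlonglongrightarrow> (LINT x|D. h x)"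
proof -
  have [measurable]: "random_variable borel (X i)" for i
    using indep unfolding indep_vars_def by blast
  have bnd: "AE \<omega> in M. norm (h (X i \<omega>)) \<le> b" for i
    using bound unfolding distr[of i, symmetric] by (subst (asm) AE_distr_iff) auto
  have bnd_Re: "AE \<omega> in M. \<bar>Re (h (X i \<omega>))\<bar> \<le> b" for i
    using bnd[of i] by eventually_elim (meson abs_Re_le_cmod order_trans)
  have bnd_Im: "AE \<omega> in M. \<bar>Im (h (X i \<omega>))\<bar> \<le> b" for i
    using bnd[of i] by eventually_elim (meson abs_Im_le_cmod order_trans)
  have int: "integrable M (\<lambda>\<omega>. h (X i \<omega>))" for i
    by (rule integrable_const_bound[OF bnd]) measurable
  have expectation: "expectation (\<lambda>\<omega>. h (X i \<omega>)) = (LINT x|D. h x)" for i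
    unfolding distr[of i, symmetric] by (rule integral_distr[symmetric]) measurable
  have "AE \<omega> in M. (\<lambda>N. (\<Sum>i<N. Re (h (X i \<omega>))) / real N) \<longlonglongrightarrow> Re (LINT x|D. h x)"
  proof (rule slln_bounded_real[OF _ bnd_Re])
    show "indep_vars (\<lambda>_. borel) (\<lambda>i \<omega>. Re (h (X i \<omega>))) UNIV"
      by (rule indep_vars_compose2[OF indep]) measurable
    show "expectation (\<lambda>\<omega>. Re (h (X i \<omega>))) = Re (LINT x|D. h x)" for i
      using integral_Re[OF int[of i]] expectation[of i] by simp
  qed
  moreover have "AE \<omega> in M. (\<lambda>N. (\<Sum>i<N. Im (h (X i \<omega>))) / real N) \<longlonglongrightarrow> Im (LINT x|D. h x)"
  proof (rule slln_bounded_real[OF _ bnd_Im])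
    show "indep_vars (\<lambda>_. borel) (\<lambda>i \<omega>. Im (h (X i \<omega>))) UNIV"
      by (rule indep_vars_compose2[OF indep]) measurable
    show "expectation (\<lambda>\<omega>. Im (h (X i \<omega>))) = Im (LINT x|D. h x)" for i
      using integral_Im[OF int[of i]] expectation[of i] by simp
  qed
  ultimately show ?thesis
    by eventually_elim (simp add: tendsto_complex_iff)
qed

section \<open>Gram matrices and dual functions\<close>

lemma integral_double_sum:
  fixes F :: "'i \<Rightarrow> 'j \<Rightarrow> 'a \<Rightarrow> complex"
  assumes int: "\<And>i j. i \<in> I \<Longrightarrow> j \<in> J \<Longrightarrow> integrable M (F i j)"
  shows "(LINT x|M. (\<Sum>i\<in>I. \<Sum>j\<in>J. a i j * (b i j * F i j x))) =
    (\<Sum>i\<in>I. \<Sum>j\<in>J. a i j * (b i j * (LINT x|M. F i j x)))"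
proof -
  have "(LINT x|M. (\<Sum>i\<in>I. \<Sum>j\<in>J. a i j * (b i j * F i j x))) =
      (\<Sum>i\<in>I. LINT x|M. (\<Sum>j\<in>J. a i j * (b i j * F i j x)))"
    by (intro Bochner_Integration.integral_sum Bochner_Integration.integrable_sum
        integrable_mult_right int)
  also have "\<dots> = (\<Sum>i\<in>I. \<Sum>j\<in>J. LINT x|M. a i j * (b i j * F i j x))"
    by (intro sum.cong refl Bochner_Integration.integral_sum integrable_mult_right int)
  finally show ?thesis by simp
qed

text \<open>A vector in the kernel of the Gram matrix is the coefficient vector of a combination
  with vanishing L2-norm.\<close>

lemma gram_det_nonzero:
  fixes u :: "nat \<Rightarrow> 'a \<Rightarrow> complex"
  assumes int: "\<And>i j. i < r \<Longrightarrow> j < r \<Longrightarrow> integrable M (\<lambda>x. cnj (u i x) * u j x)"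
    and indep: "\<And>c. (AE x in M. (\<Sum>j<r. c j * u j x) = 0) \<Longrightarrow> \<forall>j<r. c j = 0"
  shows "Determinant.det (Matrix.mat r r (\<lambda>(i, j). LINT x|M. cnj (u i x) * u j x)) \<noteq> 0"
proof
  let ?G = "Matrix.mat r r (\<lambda>(i, j). LINT x|M. cnj (u i x) * u j x)"
  assume "Determinant.det ?G = 0"
  then obtain w where w: "w \<in> carrier_vec r" "w \<noteq> 0\<^sub>v r" "?G *\<^sub>v w = 0\<^sub>v r"
    using det_0_iff_vec_prod_zero_field[of ?G r] by auto
  define c where "c j = vec_index w j" for j
  let ?q = "\<lambda>x. \<Sum>j<r::nat. c j * u j x"
  have row: "(\<Sum>j<r. (LINT x|M. cnj (u i x) * u j x) * c j) = 0" if "i < r" for i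
  proof -
    have "vec_index (?G *\<^sub>v w) i = 0" using w(3) that by simp
    thus ?thesis using that w(1) by (simp add: scalar_prod_def c_def atLeast0LessThan)
  qed
  have sq: "complex_of_real ((norm (?q x))\<^sup>2) = (\<Sum>i<r. \<Sum>j<r. cnj (c i) * (c j * (cnj (u i x) * u j x)))" for x
    unfolding complex_norm_square
    by (simp add: sum_distrib_left sum_distrib_right mult_ac)
  have int_sq: "integrable M (\<lambda>x. complex_of_real ((norm (?q x))\<^sup>2))"
    unfolding sq by (intro Bochner_Integration.integrable_sum integrable_mult_right int) auto
  have "(LINT x|M. complex_of_real ((norm (?q x))\<^sup>2)) =
      (\<Sum>i<r. \<Sum>j<r. cnj (c i) * (c j * (LINT x|M. cnj (u i x) * u j x)))"
    unfolding sq by (rule integral_double_sum) (simp add: int)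
  also have "\<dots> = (\<Sum>i<r. cnj (c i) * (\<Sum>j<r. (LINT x|M. cnj (u i x) * u j x) * c j))"
    by (simp add: sum_distrib_left mult_ac)
  also have "\<dots> = 0" by (intro sum.neutral) (simp add: row)
  finally have "complex_of_real (LINT x|M. (norm (?q x))\<^sup>2) = 0"
    by (simp only: integral_complex_of_real)
  hence "(LINT x|M. (norm (?q x))\<^sup>2) = 0" by (simp only: of_real_eq_0_iff)
  moreover have "integrable M (\<lambda>x. (norm (?q x))\<^sup>2)"
    using integrable_Re[OF int_sq] by simp
  ultimately have "AE x in M. (norm (?q x))\<^sup>2 = 0"
    by (subst (asm) integral_nonneg_eq_0_iff_AE) auto
  hence "AE x in M. ?q x = 0" by eventually_elim simp
  hence "\<forall>j<r. c j = 0" by (rule indep)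
  hence "w = 0\<^sub>v r" using w(1) by (intro eq_vecI) (auto simp: c_def)
  thus False using w(2) by simp
qed

text \<open>The rows of the inverse Gram matrix, in adjugate form, yield functions biorthogonal to
  the \<open>u l\<close>. Integration against them reads off coefficients, so bounded dual functions
  turn an L1-estimate into a coefficient estimate.\<close>

lemma dual_functions:
  fixes u :: "nat \<Rightarrow> 'a \<Rightarrow> complex"
  assumes int: "\<And>i j. i < r \<Longrightarrow> j < r \<Longrightarrow> integrable M (\<lambda>x. cnj (u i x) * u j x)"
    and indep: "\<And>c. (AE x in M. (\<Sum>j<r. c j * u j x) = 0) \<Longrightarrow> \<forall>j<r. c j = 0"
  obtains D :: "nat \<Rightarrow> nat \<Rightarrow> complex" where
    "\<And>c j. j < r \<Longrightarrow> (LINT x|M. (\<Sum>i<r. D j i * cnj (u i x)) * (\<Sum>l<r. c l * u l x)) = c j"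
proof
  let ?G = "Matrix.mat r r (\<lambda>(i, j). LINT x|M. cnj (u i x) * u j x)"
  have G: "?G \<in> carrier_mat r r" by simp
  note nz = gram_det_nonzero[OF int indep]
  define D where "D j i = adj_mat ?G $$ (j, i) / Determinant.det ?G" for j i
  fix c :: "nat \<Rightarrow> complex" and j assume j: "j < r"
  have adj: "(\<Sum>i<r. adj_mat ?G $$ (j, i) * (LINT x|M. cnj (u i x) * u l x)) =
      Determinant.det ?G * (if j = l then 1 else 0)" if "l < r" for l
  proof -
    have "(adj_mat ?G * ?G) $$ (j, l) = (Determinant.det ?G \<cdot>\<^sub>m 1\<^sub>m r) $$ (j, l)"
      using adj_mat(3)[OF G] by simp
    thus ?thesis using j that adj_mat(1)[OF G]
      by (simp add: scalar_prod_def atLeast0LessThan)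
  qed
  have "(LINT x|M. (\<Sum>i<r. D j i * cnj (u i x)) * (\<Sum>l<r. c l * u l x)) =
      (LINT x|M. (\<Sum>l<r. \<Sum>i<r. D j i * (c l * (cnj (u i x) * u l x))))"
    by (intro Bochner_Integration.integral_cong refl, subst sum.swap)
      (simp add: sum_distrib_left sum_distrib_right mult_ac)
  also have "\<dots> = (\<Sum>l<r. \<Sum>i<r. D j i * (c l * (LINT x|M. cnj (u i x) * u l x)))"
    by (rule integral_double_sum) (simp add: int)
  also have "\<dots> = (\<Sum>l<r. c l / Determinant.det ?G * (\<Sum>i<r. adj_mat ?G $$ (j, i) * (LINT x|M. cnj (u i x) * u l x)))"
    by (simp add: D_def sum_distrib_left mult_ac)
  also have "\<dots> = (\<Sum>l<r. if j = l then c l else 0)"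
    by (intro sum.cong refl) (use nz in \<open>simp add: adj\<close>)
  finally show "(LINT x|M. (\<Sum>i<r. D j i * cnj (u i x)) * (\<Sum>l<r. c l * u l x)) = c j"
    using j by simp
qed

section \<open>Spaces of functions with an inner product\<close>

lemma sum_fun_apply: "(\<Sum>i\<in>I. F i) x = (\<Sum>i\<in>I. F i x)"
  by (induction I rule: infinite_finite_induct) auto

lemma fscale_apply [simp]: "fscale c h x = c * h x"
  by (simp add: fscale_def)

context hilbert_function_space
begin

lemma H_zero [simp]: "0 \<in> H"
  and H_add [intro]: "g \<in> H \<Longrightarrow> h \<in> H \<Longrightarrow> g + h \<in> H"
  and H_scale [intro]: "h \<in> H \<Longrightarrow> fscale c h \<in> H"
  and H_diff [intro]: "g \<in> H \<Longrightarrow> h \<in> H \<Longrightarrow> g - h \<in> H"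
  using cfun.subspace_0[OF subspace] cfun.subspace_add[OF subspace]
    cfun.subspace_scale[OF subspace] cfun.subspace_diff[OF subspace] by auto

lemma H_sum [intro]: "(\<And>i. i \<in> I \<Longrightarrow> F i \<in> H) \<Longrightarrow> (\<Sum>i\<in>I. F i) \<in> H"
  by (rule cfun.subspace_sum[OF subspace])

lemma ip_zero_left [simp]: "u \<in> H \<Longrightarrow> ip 0 u = 0"
  using ip_add_left[of 0 0 u] by simp

lemma ip_diff_left: "g \<in> H \<Longrightarrow> h \<in> H \<Longrightarrow> u \<in> H \<Longrightarrow> ip (g - h) u = ip g u - ip h u"
  using ip_add_left[of "g - h" h u] H_diff[of g h] by simp

lemma ip_sum_left: "(\<And>i. i \<in> I \<Longrightarrow> F i \<in> H) \<Longrightarrow> u \<in> H \<Longrightarrow> ip (\<Sum>i\<in>I. F i) u = (\<Sum>i\<in>I. ip (F i) u)"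
  by (induction I rule: infinite_finite_induct) (auto simp: ip_add_left H_sum)

lemma ip_zero_right [simp]: "u \<in> H \<Longrightarrow> ip u 0 = 0"
  using ip_cnj[of 0 u] by simp

lemma ip_add_right: "g \<in> H \<Longrightarrow> h \<in> H \<Longrightarrow> u \<in> H \<Longrightarrow> ip u (g + h) = ip u g + ip u h"
  by (metis H_add complex_cnj_add ip_add_left ip_cnj)

lemma ip_scale_right: "h \<in> H \<Longrightarrow> u \<in> H \<Longrightarrow> ip u (fscale c h) = cnj c * ip u h"
  by (metis H_scale complex_cnj_mult ip_scale_left ip_cnj)

lemma ip_diff_right: "g \<in> H \<Longrightarrow> h \<in> H \<Longrightarrow> u \<in> H \<Longrightarrow> ip u (g - h) = ip u g - ip u h"
  by (metis H_diff complex_cnj_diff ip_diff_left ip_cnj)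

lemma ip_sum_right: "(\<And>i. i \<in> I \<Longrightarrow> F i \<in> H) \<Longrightarrow> u \<in> H \<Longrightarrow> ip u (\<Sum>i\<in>I. F i) = (\<Sum>i\<in>I. ip u (F i))"
  by (induction I rule: infinite_finite_induct) (auto simp: ip_add_right H_sum)

lemma Re_ip_nonneg: "h \<in> H \<Longrightarrow> 0 \<le> Re (ip h h)"
  using ip_pos[of h] by (cases "h = 0") auto

lemma hnorm_nonneg [simp]: "h \<in> H \<Longrightarrow> 0 \<le> hnorm ip h"
  by (simp add: hnorm_def Re_ip_nonneg)

lemma ip_self: "h \<in> H \<Longrightarrow> ip h h = of_real ((hnorm ip h)\<^sup>2)"
  using ip_cnj[of h h] Re_ip_nonneg[of h] by (auto simp: hnorm_def complex_eq_iff)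

lemma hnorm_eq_0_iff: "h \<in> H \<Longrightarrow> hnorm ip h = 0 \<longleftrightarrow> h = 0"
  using ip_pos[of h] by (cases "h = 0") (auto simp: hnorm_def)

lemma hnorm_zero [simp]: "hnorm ip 0 = 0"
  by (simp add: hnorm_def)

lemma hnorm_scale:
  assumes h: "h \<in> H"
  shows "hnorm ip (fscale c h) = cmod c * hnorm ip h"
proof -
  have "ip (fscale c h) (fscale c h) = (c * cnj c) * ip h h"
    using h by (simp add: ip_scale_left ip_scale_right H_scale mult_ac)
  also have "\<dots> = of_real ((cmod c * hnorm ip h)\<^sup>2)"
    unfolding ip_self[OF h] complex_norm_square[symmetric] by (simp add: power_mult_distrib)
  finally show ?thesis using h by (simp add: hnorm_def[of ip "fscale c h"] del: of_real_power)
qed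

lemma cauchy_schwarz:
  assumes g: "g \<in> H" and h: "h \<in> H"
  shows "cmod (ip g h) \<le> hnorm ip g * hnorm ip h"
proof (cases "h = 0")
  case True
  then show ?thesis using g by simp
next
  case False
  define b where "b = (hnorm ip h)\<^sup>2"
  have b: "b > 0" using hnorm_eq_0_iff[OF h] False by (simp add: b_def)
  define c where "c = ip g h / of_real b"
  have bb: "ip h h = of_real b" using ip_self[OF h] by (simp add: b_def)
  have ch: "fscale c h \<in> H" using h by blast
  have "ip (g - fscale c h) (g - fscale c h) = ip g g - cnj c * ip g h - (c * cnj (ip g h) - c * cnj c * ip h h)"
    using g h ch by (simp add: ip_diff_left ip_diff_right ip_scale_left ip_scale_right H_diff
        ip_cnj[of g h] algebra_simps)
  also have "\<dots> = ip g g - c * cnj (ip g h)"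
    using b by (simp add: c_def bb)
  also have "c * cnj (ip g h) = of_real ((cmod (ip g h))\<^sup>2 / b)"
    by (simp add: c_def complex_norm_square[symmetric] del: of_real_power)
  also have "ip g g = of_real ((hnorm ip g)\<^sup>2)" by (rule ip_self[OF g])
  also have "complex_of_real ((hnorm ip g)\<^sup>2) - of_real ((cmod (ip g h))\<^sup>2 / b) =
      of_real ((hnorm ip g)\<^sup>2 - (cmod (ip g h))\<^sup>2 / b)"
    by (simp only: of_real_diff)
  finally have "0 \<le> (hnorm ip g)\<^sup>2 - (cmod (ip g h))\<^sup>2 / b"
    using Re_ip_nonneg[OF H_diff[OF g ch]] by (simp only: Re_complex_of_real)
  hence "(cmod (ip g h))\<^sup>2 \<le> (hnorm ip g * hnorm ip h)\<^sup>2"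
    using b by (simp add: field_simps b_def[symmetric] power_mult_distrib)
  thus ?thesis using g h by (rule_tac power2_le_imp_le) auto
qed

lemma hnorm_triangle:
  assumes g: "g \<in> H" and h: "h \<in> H"
  shows "hnorm ip (g + h) \<le> hnorm ip g + hnorm ip h"
proof -
  have gh: "g + h \<in> H" using g h by blast
  have "of_real ((hnorm ip (g + h))\<^sup>2) = ip g g + ip h h + (ip g h + cnj (ip g h))"
    using g h gh by (simp add: ip_self[symmetric] ip_add_left ip_add_right ip_cnj[of g h] del: of_real_power)
  hence "(hnorm ip (g + h))\<^sup>2 = (hnorm ip g)\<^sup>2 + (hnorm ip h)\<^sup>2 + 2 * Re (ip g h)"
    using g h by (auto simp: ip_self complex_eq_iff)
  also have "\<dots> \<le> (hnorm ip g)\<^sup>2 + (hnorm ip h)\<^sup>2 + 2 * (hnorm ip g * hnorm ip h)"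
    using cauchy_schwarz[OF g h] complex_Re_le_cmod[of "ip g h"] by linarith
  also have "\<dots> = (hnorm ip g + hnorm ip h)\<^sup>2" by (simp add: power2_sum)
  finally show ?thesis using g h by (rule_tac power2_le_imp_le) auto
qed

lemma hnorm_sum_le: "(\<And>i. i \<in> I \<Longrightarrow> F i \<in> H) \<Longrightarrow> hnorm ip (\<Sum>i\<in>I. F i) \<le> (\<Sum>i\<in>I. hnorm ip (F i))"
proof (induction I rule: infinite_finite_induct)
  case (insert x I)
  have "hnorm ip (F x + (\<Sum>i\<in>I. F i)) \<le> hnorm ip (F x) + hnorm ip (\<Sum>i\<in>I. F i)"
    using insert.prems by (intro hnorm_triangle H_sum) auto
  also have "\<dots> \<le> hnorm ip (F x) + (\<Sum>i\<in>I. hnorm ip (F i))"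
    using insert by simp
  finally show ?case using insert.hyps by (simp only: sum.insert not_False_eq_True)
qed auto

lemma tendsto_ip_left:
  assumes S: "\<And>n. S n \<in> H" and h: "h \<in> H" and lim: "(\<lambda>n. hnorm ip (S n - h)) \<longlonglongrightarrow> 0" and u: "u \<in> H"
  shows "(\<lambda>n. ip (S n) u) \<longlonglongrightarrow> ip h u"
proof (rule LIM_zero_cancel, rule tendsto_norm_zero_cancel, rule tendsto_sandwich[of "\<lambda>_. 0"])
  show "(\<lambda>n. hnorm ip (S n - h) * hnorm ip u) \<longlonglongrightarrow> 0"
    using tendsto_mult[OF lim tendsto_const, of "hnorm ip u"] by simp
  show "\<forall>\<^sub>F n in sequentially. cmod (ip (S n) u - ip h u) \<le> hnorm ip (S n - h) * hnorm ip u"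
    using cauchy_schwarz[OF H_diff[OF S h] u] S h u by (simp add: ip_diff_left)
qed auto

lemma orthonormal_sum:
  assumes v: "\<And>i. v i \<in> H" and on: "\<And>i j. ip (v i) (v j) = (if i = j then 1 else 0)"
    and I: "finite I" "j \<in> I"
  shows "ip (\<Sum>i\<in>I. fscale (c i) (v i)) (v j) = c j"
proof -
  have "ip (\<Sum>i\<in>I. fscale (c i) (v i)) (v j) = (\<Sum>i\<in>I. c i * (if i = j then 1 else 0))"
    using v by (subst ip_sum_left) (auto simp: ip_scale_left on)
  also have "\<dots> = (\<Sum>i\<in>I. if i = j then c i else 0)" by (intro sum.cong) auto
  finally show ?thesis using I by simp
qed

text \<open>Pythagoras: removing the projection lowers the squared norm by the sum of the squared
  coefficients.\<close>

lemma hnorm_residual_le: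
  assumes v: "\<And>i. v i \<in> H" and on: "\<And>i j. ip (v i) (v j) = (if i = j then 1 else 0)"
    and I: "finite I" and h: "h \<in> H"
  shows "hnorm ip (h - (\<Sum>i\<in>I. fscale (ip h (v i)) (v i))) \<le> hnorm ip h"
proof -
  let ?q = "\<Sum>i\<in>I. fscale (ip h (v i)) (v i)"
  have q: "?q \<in> H" using v by blast
  have hq: "ip ?q h = of_real (\<Sum>i\<in>I. (cmod (ip h (v i)))\<^sup>2)"
    using v h by (subst ip_sum_left) (auto simp: ip_scale_left ip_cnj[of h] complex_norm_square[symmetric])
  have qq: "ip ?q ?q = of_real (\<Sum>i\<in>I. (cmod (ip h (v i)))\<^sup>2)"
    using v h q by (subst ip_sum_right)
      (auto simp: ip_scale_right orthonormal_sum[OF v on I] complex_norm_square[symmetric] mult.commute[of "cnj _"])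
  have "ip (h - ?q) (h - ?q) = ip h h - of_real (\<Sum>i\<in>I. (cmod (ip h (v i)))\<^sup>2)"
    using h q by (simp add: ip_diff_left ip_diff_right H_diff hq qq ip_cnj[OF q h])
  hence "Re (ip (h - ?q) (h - ?q)) \<le> Re (ip h h)"
    by (simp add: sum_nonneg)
  thus ?thesis unfolding hnorm_def by simp
qed

end

context rkhs
begin

text \<open>Point evaluation is the inner product with a kernel section, hence continuous in norm.
  This is how abstract limits in \<open>H\<close> are identified as concrete functions.\<close>

lemma tendsto_pointwise:
  assumes S: "\<And>n. S n \<in> H" and h: "h \<in> H" and lim: "(\<lambda>n. hnorm ip (S n - h)) \<longlonglongrightarrow> 0"
  shows "(\<lambda>n. S n x) \<longlonglongrightarrow> h x"
  using tendsto_ip_left[OF S h lim kernel_section_in[of x]] by (simp add: reproducing S h)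

end

section \<open>Jets of the kernels\<close>

definition gauss_weight :: "real \<Rightarrow> real ^ 'd \<Rightarrow> real ^ 'd \<Rightarrow> real" where
  "gauss_weight \<kappa> p x = exp (- \<kappa> * (norm (x - p))\<^sup>2)"

definition weighted_exp_kernel :: "real \<Rightarrow> real \<Rightarrow> real ^ 'd \<Rightarrow> real ^ 'd \<Rightarrow> real ^ 'd \<Rightarrow> complex" where
  "weighted_exp_kernel \<kappa> s p x y =
     complex_of_real (gauss_weight \<kappa> p x * gauss_weight \<kappa> p y * exp (inner (x - p) (y - p) / s))"

definition weighted_monom :: "real \<Rightarrow> real ^ 'd \<Rightarrow> ('d::finite \<Rightarrow> nat) \<Rightarrow> real ^ 'd \<Rightarrow> complex" where
  "weighted_monom \<kappa> p \<alpha> y = complex_of_real (gauss_weight \<kappa> p y * (\<Prod>i\<in>UNIV. ((y - p) $ i) ^ \<alpha> i))"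

text \<open>The strict inequality makes index 0 the zero space, so that "lower order terms" of a jet
  of order 0 need no separate treatment; jets of order at most n correspond to index
  \<open>Suc n\<close>.\<close>

definition weighted_polys :: "real \<Rightarrow> real ^ 'd::finite \<Rightarrow> nat \<Rightarrow> (real ^ 'd \<Rightarrow> complex) set" where
  "weighted_polys \<kappa> p n = cfun.span {weighted_monom \<kappa> p \<alpha> | \<alpha>. sum \<alpha> UNIV < n}"

lemma gauss_weight_pos [simp]: "0 < gauss_weight \<kappa> p x"
  and gauss_weight_nonzero [simp]: "gauss_weight \<kappa> p x \<noteq> 0"
  and gauss_weight_center [simp]: "gauss_weight \<kappa> p p = 1"
  by (simp_all add: gauss_weight_def)

lemma exp_kernel_eq: "exp_kernel p = weighted_exp_kernel 0 1 p"
  by (auto simp: fun_eq_iff exp_kernel_def weighted_exp_kernel_def gauss_weight_def)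

text \<open>Expanding |x - y|^2 about \<open>p\<close> puts the two squares into the weights and the
  mixed term into the exponent. The centre \<open>p\<close> is free here and will be the fixed point
  of \<open>f\<close>.\<close>

lemma gauss_kernel_eq:
  fixes p :: "real ^ 'd"
  assumes "\<sigma> > 0"
  shows "gauss_kernel \<sigma> = weighted_exp_kernel (1 / (2 * \<sigma>\<^sup>2)) (\<sigma>\<^sup>2) p"
proof (intro ext)
  fix x y
  have "(norm (x - y))\<^sup>2 = (norm (x - p))\<^sup>2 + (norm (y - p))\<^sup>2 - 2 * inner (x - p) (y - p)"
    by (simp add: power2_norm_eq_inner inner_diff_left inner_diff_right inner_commute)
  hence "- (norm (x - y))\<^sup>2 / (2 * \<sigma>\<^sup>2) = - (1 / (2 * \<sigma>\<^sup>2)) * (norm (x - p))\<^sup>2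
      + - (1 / (2 * \<sigma>\<^sup>2)) * (norm (y - p))\<^sup>2 + inner (x - p) (y - p) / \<sigma>\<^sup>2"
    using assms by (simp add: field_simps)
  thus "gauss_kernel \<sigma> x y = weighted_exp_kernel (1 / (2 * \<sigma>\<^sup>2)) (\<sigma>\<^sup>2) p x y"
    unfolding gauss_kernel_def weighted_exp_kernel_def gauss_weight_def by (simp only: exp_add)
qed

text \<open>Real polynomials in \<open>(\<xi>, \<eta>)\<close> of degree less than \<open>n\<close> in \<open>\<eta>\<close>.\<close>

inductive bipoly :: "nat \<Rightarrow> (real ^ 'd \<Rightarrow> real ^ 'd \<Rightarrow> real) \<Rightarrow> bool" where
  zero: "bipoly n (\<lambda>\<xi> \<eta>. 0)"
| const: "bipoly (Suc n) (\<lambda>\<xi> \<eta>. a)"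
| left: "bipoly n Q \<Longrightarrow> bipoly n (\<lambda>\<xi> \<eta>. \<xi> $ i * Q \<xi> \<eta>)"
| right: "bipoly n Q \<Longrightarrow> bipoly (Suc n) (\<lambda>\<xi> \<eta>. \<eta> $ i * Q \<xi> \<eta>)"
| scale: "bipoly n Q \<Longrightarrow> bipoly n (\<lambda>\<xi> \<eta>. a * Q \<xi> \<eta>)"
| add: "bipoly n Q \<Longrightarrow> bipoly n R \<Longrightarrow> bipoly n (\<lambda>\<xi> \<eta>. Q \<xi> \<eta> + R \<xi> \<eta>)"
| Suc: "bipoly n Q \<Longrightarrow> bipoly (Suc n) Q"

text \<open>Only the degree in the second argument is tracked, and differentiating in the first
  argument does not raise it.\<close>

lemma bipoly_left_derivative:
  assumes "bipoly n Q"
  shows "\<exists>Q'. bipoly n Q' \<and>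
    (\<forall>\<xi> \<eta>. ((\<lambda>t. Q (\<xi> + t *\<^sub>R axis i 1) \<eta>) has_real_derivative Q' \<xi> \<eta>) (at 0))"
  using assms
proof induction
  case (zero n)
  show ?case by (intro exI[of _ "\<lambda>_ _. 0"]) (auto intro: bipoly.intros)
next
  case (const n a)
  show ?case by (intro exI[of _ "\<lambda>_ _. 0"]) (auto intro: bipoly.intros)
next
  case (left n Q j)
  then obtain Q' where Q': "bipoly n Q'"
    "\<And>\<xi> \<eta>. ((\<lambda>t. Q (\<xi> + t *\<^sub>R axis i 1) \<eta>) has_real_derivative Q' \<xi> \<eta>) (at 0)" by blast
  define \<delta> :: real where "\<delta> = axis i 1 $ j"
  have "((\<lambda>t. (\<xi> + t *\<^sub>R axis i 1) $ j * Q (\<xi> + t *\<^sub>R axis i 1) \<eta>) has_real_derivative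
      (\<delta> * Q \<xi> \<eta> + \<xi> $ j * Q' \<xi> \<eta>)) (at 0)" for \<xi> \<eta>
    unfolding vector_add_component vector_scaleR_component
    by (auto intro!: derivative_eq_intros Q'(2) simp: \<delta>_def)
  moreover have "bipoly n (\<lambda>\<xi> \<eta>. \<delta> * Q \<xi> \<eta> + \<xi> $ j * Q' \<xi> \<eta>)"
    by (intro bipoly.intros left Q'(1))
  ultimately show ?case by blast
next
  case (right n Q j)
  then obtain Q' where Q': "bipoly n Q'"
    "\<And>\<xi> \<eta>. ((\<lambda>t. Q (\<xi> + t *\<^sub>R axis i 1) \<eta>) has_real_derivative Q' \<xi> \<eta>) (at 0)" by blast
  have "((\<lambda>t. \<eta> $ j * Q (\<xi> + t *\<^sub>R axis i 1) \<eta>) has_real_derivative \<eta> $ j * Q' \<xi> \<eta>) (at 0)" for \<xi> \<eta>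
    by (intro DERIV_cmult Q'(2))
  moreover have "bipoly (Suc n) (\<lambda>\<xi> \<eta>. \<eta> $ j * Q' \<xi> \<eta>)" by (intro bipoly.intros Q'(1))
  ultimately show ?case by blast
next
  case (scale n Q a)
  then obtain Q' where Q': "bipoly n Q'"
    "\<And>\<xi> \<eta>. ((\<lambda>t. Q (\<xi> + t *\<^sub>R axis i 1) \<eta>) has_real_derivative Q' \<xi> \<eta>) (at 0)" by blast
  have "((\<lambda>t. a * Q (\<xi> + t *\<^sub>R axis i 1) \<eta>) has_real_derivative a * Q' \<xi> \<eta>) (at 0)" for \<xi> \<eta>
    by (intro DERIV_cmult Q'(2))
  moreover have "bipoly n (\<lambda>\<xi> \<eta>. a * Q' \<xi> \<eta>)" by (intro bipoly.intros Q'(1))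
  ultimately show ?case by blast
next
  case (add n Q R)
  then obtain Q' R' where Q': "bipoly n Q'" "bipoly n R'"
    "\<And>\<xi> \<eta>. ((\<lambda>t. Q (\<xi> + t *\<^sub>R axis i 1) \<eta>) has_real_derivative Q' \<xi> \<eta>) (at 0)"
    "\<And>\<xi> \<eta>. ((\<lambda>t. R (\<xi> + t *\<^sub>R axis i 1) \<eta>) has_real_derivative R' \<xi> \<eta>) (at 0)" by blast
  have "((\<lambda>t. Q (\<xi> + t *\<^sub>R axis i 1) \<eta> + R (\<xi> + t *\<^sub>R axis i 1) \<eta>) has_real_derivative
      Q' \<xi> \<eta> + R' \<xi> \<eta>) (at 0)" for \<xi> \<eta>
    by (intro DERIV_add Q')
  moreover have "bipoly n (\<lambda>\<xi> \<eta>. Q' \<xi> \<eta> + R' \<xi> \<eta>)" by (intro bipoly.intros Q')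
  ultimately show ?case by blast
next
  case (Suc n Q)
  then show ?case by (blast intro: bipoly.Suc)
qed

lemma bipoly_prod_list: "bipoly (Suc (length is)) (\<lambda>\<xi> \<eta>. \<Prod>i\<leftarrow>is. \<eta> $ i / s)"
proof (induction "is")
  case Nil
  show ?case by (simp add: bipoly.const)
next
  case (Cons i "is")
  have "bipoly (Suc (Suc (length is))) (\<lambda>\<xi> \<eta>. (1 / s) * (\<eta> $ i * (\<Prod>i\<leftarrow>is. \<eta> $ i / s)))"
    by (intro bipoly.scale bipoly.right Cons.IH)
  thus ?case by simp
qed

lemma partial_deriv_of_real:
  assumes "((\<lambda>t. F (x + t *\<^sub>R axis i 1)) has_real_derivative F') (at 0)"
  shows "partial_deriv i (\<lambda>x. complex_of_real (F x)) x = complex_of_real F'"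
proof -
  have "((\<lambda>t. complex_of_real (F (x + t *\<^sub>R axis i 1))) has_vector_derivative complex_of_real F') (at 0)"
    using assms by (rule has_vector_derivative_of_real)
  thus ?thesis unfolding partial_deriv_def by (rule vector_derivative_at)
qed

text \<open>A derivative may hit the weight, the exponential or the polynomial; only the exponential
  raises the degree in \<open>y - p\<close>, by the factor \<open>(y - p) $ i / s\<close>. Choosing
  it every time gives the leading product, and everything else has smaller degree in
  \<open>y - p\<close>.\<close>

lemma iterated_partial_deriv_kernel:
  fixes p :: "real ^ 'd"
  shows "\<exists>Q. bipoly (length is) Q \<and> (\<forall>x y.
    foldr partial_deriv is (\<lambda>x. weighted_exp_kernel \<kappa> s p x y) x =
    of_real (gauss_weight \<kappa> p x * gauss_weight \<kappa> p y * exp (inner (x - p) (y - p) / s) *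
      ((\<Prod>i\<leftarrow>is. (y - p) $ i / s) + Q (x - p) (y - p))))"
proof (induction "is")
  case Nil
  show ?case
    by (intro exI[of _ "\<lambda>_ _. 0"]) (auto simp: weighted_exp_kernel_def intro: bipoly.zero)
next
  case (Cons i "is")
  let ?m = "\<lambda>\<eta>::real^'d. \<Prod>i\<leftarrow>is. \<eta> $ i / s"
  let ?E = "\<lambda>x y. gauss_weight \<kappa> p x * gauss_weight \<kappa> p y * exp (inner (x - p) (y - p) / s)"
  obtain Q where Q: "bipoly (length is) Q"
    and eq: "\<And>x y. foldr partial_deriv is (\<lambda>x. weighted_exp_kernel \<kappa> s p x y) x =
      of_real (?E x y * (?m (y - p) + Q (x - p) (y - p)))"
    using Cons.IH by blast
  obtain Q' where Q': "bipoly (length is) Q'"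
    and der: "\<And>\<xi> \<eta>. ((\<lambda>t. Q (\<xi> + t *\<^sub>R axis i 1) \<eta>) has_real_derivative Q' \<xi> \<eta>) (at 0)"
    using bipoly_left_derivative[OF Q] by blast
  \<comment> \<open>The contributions besides the new leading product: the weight acting on the old
    product and on \<open>Q\<close>, the exponential acting on \<open>Q\<close>, and the derivative
    of \<open>Q\<close>.\<close>
  define R where "R = (\<lambda>\<xi> \<eta>. (- 2 * \<kappa>) * (\<xi> $ i * ?m \<eta>) + ((- 2 * \<kappa>) * (\<xi> $ i * Q \<xi> \<eta>) +
    ((1 / s) * (\<eta> $ i * Q \<xi> \<eta>) + Q' \<xi> \<eta>)))"
  have R: "bipoly (length (i # is)) R"
    unfolding R_def list.size(4) add_Suc_right add_0_right
    by (intro bipoly.add bipoly.scale[OF bipoly.left[OF bipoly_prod_list]]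
        bipoly.scale[OF bipoly.left[OF bipoly.Suc[OF Q]]] bipoly.scale[OF bipoly.right[OF Q]] bipoly.Suc[OF Q'])
  have "foldr partial_deriv (i # is) (\<lambda>x. weighted_exp_kernel \<kappa> s p x y) x =
      of_real (?E x y * ((\<Prod>j\<leftarrow>i # is. (y - p) $ j / s) + R (x - p) (y - p)))" for x y
  proof -
    have sh: "x + t *\<^sub>R axis i 1 - p = (x - p) + t *\<^sub>R axis i 1" for t
      by simp
    have nm: "(norm ((x - p) + t *\<^sub>R axis i 1))\<^sup>2 = (norm (x - p))\<^sup>2 + 2 * t * (x - p) $ i + t\<^sup>2" for t
      unfolding power2_norm_eq_inner
      by (simp add: inner_add_left inner_add_right inner_axis inner_axis' inner_commute power2_eq_square algebra_simps)
    have ip: "inner ((x - p) + t *\<^sub>R axis i 1) (y - p) = inner (x - p) (y - p) + t * (y - p) $ i" for t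
      by (simp add: inner_add_left inner_axis')
    have "((\<lambda>t. ?E (x + t *\<^sub>R axis i 1) y *
        (?m (y - p) + Q (x + t *\<^sub>R axis i 1 - p) (y - p))) has_real_derivative
        ?E x y * ((- 2 * \<kappa> * (x - p) $ i + (y - p) $ i / s) * (?m (y - p) + Q (x - p) (y - p)) + Q' (x - p) (y - p))) (at 0)"
    proof -
      have d1: "((\<lambda>t. exp (- \<kappa> * ((norm (x - p))\<^sup>2 + 2 * t * (x - p) $ i + t\<^sup>2))) has_real_derivative
          exp (- \<kappa> * (norm (x - p))\<^sup>2) * (- 2 * \<kappa> * (x - p) $ i)) (at 0)"
        by (auto intro!: derivative_eq_intros)
      have d2: "((\<lambda>t. exp ((inner (x - p) (y - p) + t * (y - p) $ i) / s)) has_real_derivative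
          exp (inner (x - p) (y - p) / s) * ((y - p) $ i / s)) (at 0)"
        unfolding divide_inverse by (auto intro!: derivative_eq_intros)
      show ?thesis
        unfolding sh gauss_weight_def nm ip
        by (rule DERIV_cong[OF DERIV_mult[OF DERIV_mult[OF DERIV_mult[OF d1 DERIV_const] d2] DERIV_add[OF DERIV_const der]]])
          (simp add: algebra_simps add_divide_distrib diff_divide_distrib)
    qed
    hence "partial_deriv i (\<lambda>x. complex_of_real (?E x y * (?m (y - p) + Q (x - p) (y - p)))) x =
        of_real (?E x y * ((- 2 * \<kappa> * (x - p) $ i + (y - p) $ i / s) * (?m (y - p) + Q (x - p) (y - p)) + Q' (x - p) (y - p)))"
      by (rule partial_deriv_of_real)
    moreover have "foldr partial_deriv is (\<lambda>x. weighted_exp_kernel \<kappa> s p x y) =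
        (\<lambda>x. complex_of_real (?E x y * (?m (y - p) + Q (x - p) (y - p))))"
      using eq by (intro ext)
    moreover have "(- 2 * \<kappa> * (x - p) $ i + (y - p) $ i / s) * (?m (y - p) + Q (x - p) (y - p)) + Q' (x - p) (y - p) =
        (\<Prod>j\<leftarrow>i # is. (y - p) $ j / s) + R (x - p) (y - p)"
      unfolding R_def by (simp add: algebra_simps add_divide_distrib diff_divide_distrib)
    ultimately show ?thesis by (simp only: foldr.simps(2) comp_apply)
  qed
  thus ?case using R by blast
qed

section \<open>Identification of the jet spaces with weighted polynomials\<close>

lemma weighted_polys_mono: "m \<le> n \<Longrightarrow> weighted_polys \<kappa> p m \<subseteq> weighted_polys \<kappa> p n"
  unfolding weighted_polys_def by (rule cfun.span_mono) auto

lemma subspace_weighted_polys: "cfun.subspace (weighted_polys \<kappa> p n)"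
  unfolding weighted_polys_def by (rule cfun.subspace_span)

lemma weighted_monom_in: "sum \<alpha> UNIV < n \<Longrightarrow> weighted_monom \<kappa> p \<alpha> \<in> weighted_polys \<kappa> p n"
  unfolding weighted_polys_def by (rule cfun.span_base) auto

lemma weighted_polys_mult_coord:
  assumes "q \<in> weighted_polys \<kappa> p n"
  shows "(\<lambda>y. of_real ((y - p) $ i) * q y) \<in> weighted_polys \<kappa> p (Suc n)"
  using assms unfolding weighted_polys_def[of _ _ n]
proof (induction rule: cfun.span_induct_alt)
  case base
  show ?case using cfun.subspace_0[OF subspace_weighted_polys] by (simp add: zero_fun_def)
next
  case (step c x y)
  then obtain \<alpha> where \<alpha>: "x = weighted_monom \<kappa> p \<alpha>" "sum \<alpha> UNIV < n" by blast
  let ?\<beta> = "\<alpha>(i := Suc (\<alpha> i))"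
  have prod: "(\<Prod>j\<in>UNIV. ((z - p) $ j) ^ ?\<beta> j) = (z - p) $ i * (\<Prod>j\<in>UNIV. ((z - p) $ j) ^ \<alpha> j)" for z
    by (subst (1 2) prod.remove[of UNIV i]) auto
  have "sum ?\<beta> UNIV = Suc (sum \<alpha> UNIV)"
    by (subst (1 2) sum.remove[of UNIV i]) auto
  hence "weighted_monom \<kappa> p ?\<beta> \<in> weighted_polys \<kappa> p (Suc n)"
    using \<alpha> by (intro weighted_monom_in) simp
  hence "fscale c (weighted_monom \<kappa> p ?\<beta>) + (\<lambda>z. of_real ((z - p) $ i) * y z) \<in> weighted_polys \<kappa> p (Suc n)"
    using step by (intro cfun.subspace_add[OF subspace_weighted_polys] cfun.subspace_scale[OF subspace_weighted_polys])
  also have "fscale c (weighted_monom \<kappa> p ?\<beta>) + (\<lambda>z. of_real ((z - p) $ i) * y z) =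
      (\<lambda>z. of_real ((z - p) $ i) * (fscale c x + y) z)"
    unfolding \<alpha> weighted_monom_def prod by (simp add: fun_eq_iff algebra_simps)
  finally show ?case .
qed

lemma bipoly_in_weighted_polys:
  assumes "bipoly n Q"
  shows "(\<lambda>y. of_real (gauss_weight \<kappa> p y * Q 0 (y - p))) \<in> weighted_polys \<kappa> p n"
  using assms
proof induction
  case (zero n)
  show ?case using cfun.subspace_0[OF subspace_weighted_polys, of \<kappa> p n] by (simp add: zero_fun_def)
next
  case (const n a)
  have "fscale (of_real a) (weighted_monom \<kappa> p (\<lambda>_. 0)) \<in> weighted_polys \<kappa> p (Suc n)"
    by (intro cfun.subspace_scale[OF subspace_weighted_polys] weighted_monom_in) simp
  thus ?case by (simp add: fscale_def weighted_monom_def mult.commute)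
next
  case (left n Q i)
  show ?case using cfun.subspace_0[OF subspace_weighted_polys, of \<kappa> p n] by (simp add: zero_fun_def)
next
  case (right n Q i)
  show ?case using weighted_polys_mult_coord[OF right.IH, of i] by (simp add: mult_ac)
next
  case (scale n Q a)
  show ?case using cfun.subspace_scale[OF subspace_weighted_polys scale.IH, of "of_real a"]
    by (simp add: fscale_def mult_ac)
next
  case (add n Q R)
  show ?case using cfun.subspace_add[OF subspace_weighted_polys add.IH]
    by (simp add: plus_fun_def algebra_simps)
next
  case (Suc n Q)
  then show ?case using weighted_polys_mono[of n "Suc n"] by auto
qed

lemma prod_list_eq_prod_count:
  fixes f :: "'d::finite \<Rightarrow> 'a::comm_monoid_mult"
  shows "(\<Prod>i\<leftarrow>is. f i) = (\<Prod>i\<in>UNIV. f i ^ count_list is i)"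
proof (induction "is")
  case (Cons j "is")
  have "(\<Prod>i\<in>UNIV. f i ^ count_list (j # is) i) = (\<Prod>i\<in>UNIV. (if i = j then f j else 1) * f i ^ count_list is i)"
    by (intro prod.cong) auto
  thus ?case using Cons by (simp add: prod.distrib)
qed simp

text \<open>Ensures that the \<open>SOME\<close> in \<open>mixed_deriv\<close> picks a list with the
  prescribed multiplicities.\<close>

lemma ex_list_with_counts: "\<exists>is. \<forall>i::'d::finite. count_list is i = \<alpha> i"
proof -
  obtain "is" where "mset is = (\<Sum>i\<in>UNIV. replicate_mset (\<alpha> i) i)" using ex_mset by blast
  hence "count_list is i = count (\<Sum>i\<in>UNIV. replicate_mset (\<alpha> i) i) i" for i
    by (metis count_mset)
  thus ?thesis by (intro exI[of _ "is"]) (simp add: count_sum)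
qed

text \<open>At \<open>x = p\<close> the weight of \<open>x\<close> and the exponential are 1 and the
  first argument of the polynomial is 0, which leaves a monomial in \<open>y - p\<close> up to lower
  degree.\<close>

lemma mixed_deriv_kernel:
  fixes p :: "real ^ 'd::finite"
  shows "\<exists>q \<in> weighted_polys \<kappa> p (sum \<alpha> UNIV).
    (\<lambda>y. mixed_deriv \<alpha> (\<lambda>x. weighted_exp_kernel \<kappa> s p x y) p) =
    fscale (of_real ((1 / s) ^ sum \<alpha> UNIV)) (weighted_monom \<kappa> p \<alpha>) + q"
proof -
  define "is" where "is = (SOME is. \<forall>i. count_list is i = \<alpha> i)"
  have cnt: "count_list is i = \<alpha> i" for i
    unfolding is_def using someI_ex[OF ex_list_with_counts[of \<alpha>]] by blast
  have len: "length is = sum \<alpha> UNIV"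
    using sum_count_set[of "is" UNIV] by (simp add: cnt)
  obtain Q where Q: "bipoly (length is) Q" and eq: "\<And>x y.
    foldr partial_deriv is (\<lambda>x. weighted_exp_kernel \<kappa> s p x y) x =
    of_real (gauss_weight \<kappa> p x * gauss_weight \<kappa> p y * exp (inner (x - p) (y - p) / s) *
      ((\<Prod>i\<leftarrow>is. (y - p) $ i / s) + Q (x - p) (y - p)))"
    using iterated_partial_deriv_kernel[of "is" \<kappa> s p] by blast
  have "(\<lambda>y. mixed_deriv \<alpha> (\<lambda>x. weighted_exp_kernel \<kappa> s p x y) p) =
      fscale (of_real ((1 / s) ^ sum \<alpha> UNIV)) (weighted_monom \<kappa> p \<alpha>) +
      (\<lambda>y. of_real (gauss_weight \<kappa> p y * Q 0 (y - p)))"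
    unfolding mixed_deriv_def is_def[symmetric] eq prod_list_eq_prod_count cnt
    by (simp add: fun_eq_iff weighted_monom_def power_divide prod_dividef algebra_simps power_sum)
  thus ?thesis using bipoly_in_weighted_polys[OF Q, of \<kappa> p] unfolding len by blast
qed

lemma jet_space_upto_mono: "m \<le> n \<Longrightarrow> jet_space_upto k p m \<subseteq> jet_space_upto k p n"
  unfolding jet_space_upto_def by (rule cfun.span_mono) auto

text \<open>Jets and weighted monomials are related triangularly with nonzero diagonal entries
  \<open>(1 / s) ^ sum \<alpha> UNIV\<close>, so induction on the degree recovers the monomials from
  the jets.\<close>

lemma jet_space_upto_eq_weighted_polys:
  fixes p :: "real ^ 'd::finite"
  assumes s: "s > 0"
  shows "jet_space_upto (weighted_exp_kernel \<kappa> s p) p n = weighted_polys \<kappa> p (Suc n)"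
proof (rule subset_antisym)
  let ?V = "jet_space_upto (weighted_exp_kernel \<kappa> s p) p"
  show "?V n \<subseteq> weighted_polys \<kappa> p (Suc n)"
    unfolding jet_space_upto_def
  proof (rule cfun.span_minimal[OF _ subspace_weighted_polys], safe)
    fix \<alpha> :: "'d \<Rightarrow> nat" assume \<alpha>: "sum \<alpha> UNIV \<le> n"
    obtain q where q: "q \<in> weighted_polys \<kappa> p (sum \<alpha> UNIV)"
      "(\<lambda>y. mixed_deriv \<alpha> (\<lambda>x. weighted_exp_kernel \<kappa> s p x y) p) =
        fscale (of_real ((1 / s) ^ sum \<alpha> UNIV)) (weighted_monom \<kappa> p \<alpha>) + q"
      using mixed_deriv_kernel by blast
    show "(\<lambda>y. mixed_deriv \<alpha> (\<lambda>x. weighted_exp_kernel \<kappa> s p x y) p) \<in> weighted_polys \<kappa> p (Suc n)"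
      unfolding q(2) using \<alpha> q(1) weighted_polys_mono[of "sum \<alpha> UNIV" "Suc n" \<kappa> p]
      by (intro cfun.subspace_add[OF subspace_weighted_polys] cfun.subspace_scale[OF subspace_weighted_polys]
          weighted_monom_in) auto
  qed
  have sub: "cfun.subspace (?V n)" for n
    unfolding jet_space_upto_def by (rule cfun.subspace_span)
  show "weighted_polys \<kappa> p (Suc n) \<subseteq> ?V n"
  proof (induction n rule: less_induct)
    case (less n)
    show ?case
      unfolding weighted_polys_def
    proof (rule cfun.span_minimal[OF _ sub], safe)
      fix \<alpha> :: "'d \<Rightarrow> nat" assume \<alpha>: "sum \<alpha> UNIV < Suc n"
      let ?m = "sum \<alpha> UNIV"
      obtain q where q: "q \<in> weighted_polys \<kappa> p ?m"
        "(\<lambda>y. mixed_deriv \<alpha> (\<lambda>x. weighted_exp_kernel \<kappa> s p x y) p) =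
          fscale (of_real ((1 / s) ^ ?m)) (weighted_monom \<kappa> p \<alpha>) + q"
        using mixed_deriv_kernel by blast
      have "q \<in> ?V n"
      proof (cases ?m)
        case 0
        \<comment> \<open>No multi-index has sum below 0, so \<open>q\<close> lies in the span of
          the empty set.\<close>
        then have "q = 0" using q(1) unfolding weighted_polys_def by auto
        thus ?thesis using cfun.subspace_0[OF sub] by simp
      next
        case (Suc l)
        hence "q \<in> ?V l" using less[of l] q(1) \<alpha> by auto
        thus ?thesis using jet_space_upto_mono[of l n] Suc \<alpha> by auto
      qed
      moreover have "(\<lambda>y. mixed_deriv \<alpha> (\<lambda>x. weighted_exp_kernel \<kappa> s p x y) p) \<in> ?V n"
        unfolding jet_space_upto_def using \<alpha> by (intro cfun.span_base) auto
      ultimately have "fscale (of_real (s ^ ?m))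
          ((\<lambda>y. mixed_deriv \<alpha> (\<lambda>x. weighted_exp_kernel \<kappa> s p x y) p) - q) \<in> ?V n"
        by (intro cfun.subspace_scale[OF sub] cfun.subspace_diff[OF sub])
      also have "fscale (of_real (s ^ ?m)) ((\<lambda>y. mixed_deriv \<alpha> (\<lambda>x. weighted_exp_kernel \<kappa> s p x y) p) - q) =
          weighted_monom \<kappa> p \<alpha>"
        unfolding q(2) using s by (simp add: fun_eq_iff power_divide)
      finally show "weighted_monom \<kappa> p \<alpha> \<in> ?V n" .
    qed
  qed
qed

section \<open>Inner products with jets\<close>

definition exp_remainder :: "nat \<Rightarrow> real \<Rightarrow> real" where
  "exp_remainder L x = exp x - (\<Sum>l<L. x ^ l / fact l)"

lemma exp_remainder_le:
  assumes "x \<ge> 0"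
  shows "exp_remainder L x \<le> x ^ L / fact L * exp x"
proof -
  obtain t where t: "\<bar>t\<bar> \<le> \<bar>x\<bar>" "exp x = (\<Sum>m<L. x ^ m / fact m) + exp t / fact L * x ^ L"
    using Maclaurin_exp_le[of x L] by blast
  have "exp t \<le> exp x" using t(1) assms by simp
  hence "x ^ L / fact L * exp t \<le> x ^ L / fact L * exp x"
    using assms by (intro mult_left_mono) auto
  thus ?thesis using t(2) by (simp add: exp_remainder_def mult_ac)
qed

text \<open>In Lagrange form the difference is the term of order \<open>L\<close> times
  \<open>exp t - 1\<close>. The estimate quantifies how the scaled remainder tends to the next
  Taylor term as \<open>u\<close> tends to 0.\<close>

lemma exp_remainder_asymp:
  assumes "u \<noteq> 0"
  shows "\<bar>exp_remainder L (u * b) / u ^ L - b ^ L / fact L\<bar> \<le> \<bar>b\<bar> ^ L / fact L * (exp \<bar>u * b\<bar> - 1)"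
proof -
  let ?x = "u * b"
  obtain t where t: "\<bar>t\<bar> \<le> \<bar>?x\<bar>" "exp ?x = (\<Sum>m<L. ?x ^ m / fact m) + exp t / fact L * ?x ^ L"
    using Maclaurin_exp_le[of ?x L] by blast
  have "exp_remainder L ?x / u ^ L - b ^ L / fact L = b ^ L / fact L * (exp t - 1)"
    using t(2) assms by (simp add: exp_remainder_def power_mult_distrib field_simps)
  moreover have "\<bar>exp t - 1\<bar> \<le> exp \<bar>?x\<bar> - 1"
  proof (cases "t \<ge> 0")
    case True
    then show ?thesis using t(1) by simp
  next
    case False
    have "2 \<le> exp t + exp (- t)"
      using exp_ge_add_one_self[of t] exp_ge_add_one_self[of "- t"] by linarith
    moreover have "exp (- t) \<le> exp \<bar>?x\<bar>" using t(1) by simp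
    moreover have "exp t \<le> 1" using False by simp
    ultimately show ?thesis by linarith
  qed
  ultimately show ?thesis
    by (simp only: abs_mult) (intro mult_mono, auto simp: power_abs)
qed

lemma poly_taylor_split:
  fixes P :: "'a::comm_ring_1 poly"
  shows "\<exists>S. coeff S 0 = coeff P L \<and> (\<forall>x. poly P x = (\<Sum>l<L. coeff P l * x ^ l) + x ^ L * poly S x)"
proof -
  \<comment> \<open>All coefficients of \<open>S\<close> are recorded, so that the induction can
    split off one more.\<close>
  have "\<exists>S. (\<forall>i. coeff S i = coeff P (L + i)) \<and> (\<forall>x. poly P x = (\<Sum>l<L. coeff P l * x ^ l) + x ^ L * poly S x)"
  proof (induction L)
    case 0
    show ?case by (intro exI[of _ P]) auto
  next
    case (Suc L)
    then obtain S where S: "\<And>i. coeff S i = coeff P (L + i)"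
      "\<And>x. poly P x = (\<Sum>l<L. coeff P l * x ^ l) + x ^ L * poly S x" by blast
    obtain c S' where c: "S = pCons c S'" by (cases S) auto
    have "c = coeff P L" using S(1)[of 0] c by simp
    moreover have "coeff S' i = coeff P (Suc L + i)" for i using S(1)[of "Suc i"] c by simp
    ultimately show ?case using S(2) unfolding c
      by (intro exI[of _ S']) (simp add: algebra_simps)
  qed
  then obtain S where "\<And>i. coeff S i = coeff P (L + i)"
    "\<forall>x. poly P x = (\<Sum>l<L. coeff P l * x ^ l) + x ^ L * poly S x" by blast
  thus ?thesis by (intro exI[of _ S]) auto
qed

text \<open>One setting for both kernels. Membership of the jets in \<open>H\<close> is assumed here
  and later follows from their lying in the domain of C_f.\<close>

locale jet_rkhs = rkhs k H ip
  for k :: "real ^ 'd \<Rightarrow> real ^ 'd \<Rightarrow> complex" and H :: "(real ^ 'd \<Rightarrow> complex) set" and ip +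
  fixes p :: "real ^ 'd" and \<kappa> s :: real
  assumes s_pos: "0 < s"
    and kernel_eq: "k = weighted_exp_kernel \<kappa> s p"
    and jets_in_H: "jet_space k p \<subseteq> H"
begin

abbreviation g :: "real ^ 'd \<Rightarrow> real" where "g \<equiv> gauss_weight \<kappa> p"
abbreviation V :: "nat \<Rightarrow> (real ^ 'd \<Rightarrow> complex) set" where "V \<equiv> jet_space_upto k p"

text \<open>The kernel section at \<open>p + z\<close> without its own weight: it represents the
  evaluation of \<open>h / g\<close> at \<open>p + z\<close>.\<close>

definition K :: "real ^ 'd \<Rightarrow> real ^ 'd \<Rightarrow> complex" where
  "K z = fscale (of_real (1 / g (p + z))) (k (p + z))"

text \<open>The part of \<open>K z\<close> that is homogeneous of degree \<open>l\<close> in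
  \<open>z\<close>, a combination of jets at \<open>p\<close>. It will represent the Taylor
  coefficient of degree \<open>l\<close> of \<open>h / g\<close> along the ray in direction
  \<open>z\<close>.\<close>

definition T :: "real ^ 'd \<Rightarrow> nat \<Rightarrow> real ^ 'd \<Rightarrow> complex" where
  "T z l = (\<lambda>y. of_real (g y * ((inner z (y - p) / s) ^ l / fact l)))"

definition remainder :: "nat \<Rightarrow> real ^ 'd \<Rightarrow> real ^ 'd \<Rightarrow> complex" where
  "remainder L z = K z - (\<Sum>l<L. T z l)"

lemma V_eq: "V n = weighted_polys \<kappa> p (Suc n)"
  unfolding kernel_eq by (rule jet_space_upto_eq_weighted_polys[OF s_pos])

lemma subspace_V: "cfun.subspace (V n)"
  unfolding V_eq by (rule subspace_weighted_polys)

lemma V_in_H: "w \<in> V n \<Longrightarrow> w \<in> H"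
  using jets_in_H unfolding jet_space_def by blast

lemma K_apply: "K z y = of_real (g y * exp (inner z (y - p) / s))"
proof -
  have "k (p + z) y = of_real (g (p + z) * g y * exp (inner z (y - p) / s))"
    unfolding kernel_eq weighted_exp_kernel_def by simp
  thus ?thesis by (simp add: K_def)
qed

lemma K_in_H [simp]: "K z \<in> H"
  unfolding K_def by (intro H_scale kernel_section_in)

lemma T_in_V:
  assumes "l \<le> n"
  shows "T z l \<in> V n"
proof -
  have "(\<lambda>y. of_real (g y * inner z (y - p) ^ l)) \<in> weighted_polys \<kappa> p (Suc l)"
  proof (induction l)
    case 0
    have "weighted_monom \<kappa> p (\<lambda>_. 0) \<in> weighted_polys \<kappa> p (Suc 0)" by (rule weighted_monom_in) simp
    thus ?case by (simp add: weighted_monom_def[abs_def])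
  next
    case (Suc l)
    let ?q = "\<lambda>y. complex_of_real (g y * inner z (y - p) ^ l)"
    have "(\<Sum>i\<in>UNIV. fscale (of_real (z $ i)) (\<lambda>y. of_real ((y - p) $ i) * ?q y)) \<in> weighted_polys \<kappa> p (Suc (Suc l))"
      by (intro cfun.subspace_sum[OF subspace_weighted_polys] cfun.subspace_scale[OF subspace_weighted_polys]
          weighted_polys_mult_coord Suc)
    also have "(\<Sum>i\<in>UNIV. fscale (of_real (z $ i)) (\<lambda>y. of_real ((y - p) $ i) * ?q y)) =
        (\<lambda>y. of_real (g y * inner z (y - p) ^ Suc l))"
    proof
      fix y
      have "(\<Sum>i\<in>UNIV. fscale (of_real (z $ i)) (\<lambda>y. of_real ((y - p) $ i) * ?q y)) y =
          of_real (\<Sum>i\<in>UNIV. z $ i * (y - p) $ i) * ?q y"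
        by (simp add: sum_fun_apply sum_distrib_left sum_distrib_right mult_ac del: vector_minus_component of_real_diff)
      also have "(\<Sum>i\<in>UNIV. z $ i * (y - p) $ i) = inner z (y - p)"
        by (simp add: inner_vec_def)
      finally show "(\<Sum>i\<in>UNIV. fscale (of_real (z $ i)) (\<lambda>y. of_real ((y - p) $ i) * ?q y)) y =
          of_real (g y * inner z (y - p) ^ Suc l)" by (simp only: power_Suc of_real_mult mult_ac)
    qed
    finally show ?case .
  qed
  hence "fscale (of_real (1 / (s ^ l * fact l))) (\<lambda>y. of_real (g y * inner z (y - p) ^ l)) \<in> V n"
    using assms weighted_polys_mono[of "Suc l" "Suc n" \<kappa> p]
    by (intro cfun.subspace_scale[OF subspace_V]) (auto simp: V_eq)
  also have "fscale (of_real (1 / (s ^ l * fact l))) (\<lambda>y. of_real (g y * inner z (y - p) ^ l)) = T z l"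
    by (simp add: T_def fun_eq_iff power_divide)
  finally show ?thesis .
qed

lemma T_in_H [simp]: "T z l \<in> H"
  using V_in_H[OF T_in_V[OF order_refl]] .

lemma remainder_in_H [simp]: "remainder L z \<in> H"
  unfolding remainder_def by (intro H_diff H_sum) auto

text \<open>On a line every coordinate is an affine function of the parameter. This reduces
  questions about polynomials in several variables to one variable; lines through arbitrary points
  are allowed because uniqueness is later tested on balls away from \<open>p\<close>.\<close>

lemma V_on_lines:
  assumes "w \<in> V n"
  shows "\<exists>P. degree P \<le> n \<and> (\<forall>t::real. w (a + t *\<^sub>R z) / of_real (g (a + t *\<^sub>R z)) = poly P (of_real t))"
  using assms unfolding V_eq weighted_polys_def
proof (induction rule: cfun.span_induct_alt)
  case base
  show ?case by (intro exI[of _ 0]) auto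
next
  case (step c x y)
  then obtain \<alpha> where \<alpha>: "x = weighted_monom \<kappa> p \<alpha>" "sum \<alpha> UNIV \<le> n" by auto
  obtain P where P: "degree P \<le> n" "\<And>t::real. y (a + t *\<^sub>R z) / of_real (g (a + t *\<^sub>R z)) = poly P (of_real t)"
    using step by blast
  define L where "L i = [:complex_of_real ((a - p) $ i), of_real (z $ i):]" for i
  define Q where "Q = (\<Prod>i\<in>UNIV. L i ^ \<alpha> i)"
  have "degree Q \<le> (\<Sum>i\<in>UNIV. degree (L i ^ \<alpha> i))"
    unfolding Q_def using degree_prod_sum_le[of UNIV "\<lambda>i. L i ^ \<alpha> i"] by (simp add: o_def)
  also have "\<dots> \<le> (\<Sum>i\<in>UNIV. \<alpha> i)"
  proof (rule sum_mono)
    fix i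
    have "degree (L i ^ \<alpha> i) \<le> degree (L i) * \<alpha> i" by (rule degree_power_le)
    also have "\<dots> \<le> 1 * \<alpha> i" by (intro mult_right_mono) (auto simp: L_def)
    finally show "degree (L i ^ \<alpha> i) \<le> \<alpha> i" by simp
  qed
  finally have degQ: "degree Q \<le> n" using \<alpha> by simp
  have "(fscale c x + y) (a + t *\<^sub>R z) / of_real (g (a + t *\<^sub>R z)) = poly (Polynomial.smult c Q + P) (of_real t)" for t
  proof -
    have "x (a + t *\<^sub>R z) / of_real (g (a + t *\<^sub>R z)) = poly Q (of_real t)"
    by (simp add: \<alpha> weighted_monom_def Q_def L_def poly_prod algebra_simps)
    thus ?thesis using P(2)[of t] by (simp add: add_divide_distrib flip: times_divide_eq_right)
  qed
  thus ?case using degQ P(1)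
    by (intro exI[of _ "Polynomial.smult c Q + P"]) (auto intro!: degree_add_le order_trans[OF degree_smult_le])
qed

lemma ip_K: "h \<in> H \<Longrightarrow> ip h (K z) = h (p + z) / of_real (g (p + z))"
  unfolding K_def by (simp add: ip_scale_right kernel_section_in reproducing)

lemma ip_K_K: "ip (K z) (K z') = of_real (exp (inner z z' / s))"  by (simp add: ip_K K_apply)

lemma ip_T_K: "ip (T z l) (K z') = of_real ((inner z z' / s) ^ l / fact l)"
  unfolding ip_K[OF T_in_H] unfolding T_def by simp

lemma ip_K_T: "ip (K z) (T z' l) = of_real ((inner z z' / s) ^ l / fact l)"
  using ip_cnj[of "T z' l" "K z"] by (simp add: ip_T_K inner_commute)

lemma T_scale: "T (t *\<^sub>R z) l = fscale (of_real (t ^ l)) (T z l)"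
  by (simp add: T_def fun_eq_iff power_mult_distrib power_divide)

text \<open>The induction on \<open>L\<close> shows that the scaled remainders \<open>remainder L (t *\<^sub>R z) / t ^ L\<close>
  converge to \<open>T z L\<close> in \<open>H\<close> as \<open>t\<close> tends to \<open>0\<close>: their mutual inner products are known explicitly,
  hence they form a Cauchy sequence. This identifies the inner products of the jets with Taylor
  coefficients using only the reproducing property.\<close>

definition extracts_coeff :: "nat \<Rightarrow> bool" where
  "extracts_coeff L \<longleftrightarrow> (\<forall>z h P. h \<in> H \<longrightarrow>
    (\<forall>t::real. h (p + t *\<^sub>R z) / of_real (g (p + t *\<^sub>R z)) = poly P (of_real t)) \<longrightarrow> ip h (T z L) = coeff P L)"

text \<open>On a line through \<open>p\<close> the quotient of \<open>T z l\<close> by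
  \<open>g\<close> is a single power of degree \<open>l\<close>, so extracting another coefficient
  gives 0.\<close>

lemma ip_T_T_aux:
  assumes "extracts_coeff l'"
  shows "ip (T z l) (T z' l') = (if l = l' then of_real ((inner z z' / s) ^ l / fact l) else 0)"
proof -
  have "T z l (p + t *\<^sub>R z') / of_real (g (p + t *\<^sub>R z')) =
      poly (monom (of_real ((inner z z' / s) ^ l / fact l)) l) (of_real t)" for t  by (simp add: T_def poly_monom power_mult_distrib power_divide)
  hence "ip (T z l) (T z' l') = coeff (monom (of_real ((inner z z' / s) ^ l / fact l)) l) l'"
    using assms[unfolded extracts_coeff_def, rule_format, OF T_in_H] by blast
  thus ?thesis by simp
qed

text \<open>Both mixed products and the product of the two truncated sums equal the same partial sum
  of the exponential series; with signs, one copy is subtracted from the exponential.\<close>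

lemma ip_remainder_aux:
  assumes "\<And>l. l < L \<Longrightarrow> extracts_coeff l"
  shows "ip (remainder L z) (remainder L z') = of_real (exp_remainder L (inner z z' / s))"
proof -
  let ?S = "\<Sum>l<L. T z l" and ?S' = "\<Sum>l<L. T z' l" and ?x = "inner z z' / s"
  let ?E = "complex_of_real (\<Sum>l<L. ?x ^ l / fact l)"
  have S: "?S \<in> H" "?S' \<in> H" by (auto intro!: H_sum)
  have KS: "ip (K z) ?S' = ?E" by (subst ip_sum_right) (auto simp: ip_K_T)
  have SK: "ip ?S (K z') = ?E" by (subst ip_sum_left) (auto simp: ip_T_K)
  have SS: "ip ?S ?S' = ?E"
  proof -
    have "ip ?S ?S' = (\<Sum>l<L. \<Sum>l'<L. ip (T z l) (T z' l'))"
      using S by (subst ip_sum_left) (auto intro!: sum.cong ip_sum_right)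
    also have "\<dots> = (\<Sum>l<L. \<Sum>l'<L. if l = l' then of_real (?x ^ l / fact l) else 0)"
      by (intro sum.cong refl ip_T_T_aux assms) auto
    also have "\<dots> = ?E" by simp
    finally show ?thesis .
  qed
  have "ip (remainder L z) (remainder L z') = ip (K z) (K z') - ip ?S (K z') - (ip (K z) ?S' - ip ?S ?S')"
    unfolding remainder_def using S by (simp add: ip_diff_left ip_diff_right H_diff)
  thus ?thesis unfolding KS SK SS ip_K_K exp_remainder_def by simp
qed

lemma extracts_coeff_step:
  assumes IH: "\<And>l. l < L \<Longrightarrow> extracts_coeff l"
  shows "extracts_coeff L"
  unfolding extracts_coeff_def
proof (intro allI impI)
  fix z h P
  assume h: "h \<in> H" and P: "\<forall>t::real. h (p + t *\<^sub>R z) / of_real (g (p + t *\<^sub>R z)) = poly P (of_real t)"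
  define \<tau> where "\<tau> n = 1 / real (Suc n)" for n
  have \<tau>: "0 < \<tau> n" "\<tau> n \<le> 1" for n by (auto simp: \<tau>_def)
  have \<tau>_mono: "\<tau> i \<le> \<tau> N" if "N \<le> i" for i N
    using that by (auto simp: \<tau>_def frac_le)
  have \<tau>_lim: "\<tau> \<longlonglongrightarrow> 0" unfolding \<tau>_def using LIMSEQ_inverse_real_of_nat by (simp add: inverse_eq_divide)
  define F where "F n = fscale (of_real (1 / \<tau> n ^ L)) (remainder L (\<tau> n *\<^sub>R z))" for n
  have F: "F n \<in> H" for n unfolding F_def by (intro H_scale) simp
  define a where "a = inner z z / s"
  have a: "a \<ge> 0" using s_pos by (simp add: a_def)
  \<comment> \<open>The inner product of two scaled remainders depends only on the product of the
    two scaling parameters, and it tends to \<open>B\<close> as that product tends to 0.\<close>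
  define \<psi> where "\<psi> u = exp_remainder L (u * a) / u ^ L" for u
  define B where "B = a ^ L / fact L"
  have FF: "ip (F i) (F j) = of_real (\<psi> (\<tau> i * \<tau> j))" for i j
  proof -
    have "inner (\<tau> i *\<^sub>R z) (\<tau> j *\<^sub>R z) / s = \<tau> i * \<tau> j * a" by (simp add: a_def)
    thus ?thesis
      by (simp only: F_def ip_scale_left ip_scale_right H_scale remainder_in_H ip_remainder_aux[OF IH] \<psi>_def)
        (simp add: power_mult_distrib)
  qed
  define \<delta> where "\<delta> N = B * (exp (\<tau> N * a) - 1)" for N
  have \<delta>_lim: "\<delta> \<longlonglongrightarrow> 0"
    unfolding \<delta>_def by (rule tendsto_eq_intros refl \<tau>_lim | simp)+
  have \<psi>: "\<bar>\<psi> (\<tau> i * \<tau> j) - B\<bar> \<le> \<delta> N" if ij: "N \<le> i" "N \<le> j" for i j N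
  proof -
    have nz: "\<tau> i * \<tau> j \<noteq> 0" using \<tau>(1)[of i] \<tau>(1)[of j] by simp
    have "\<tau> i * \<tau> j \<le> \<tau> N * 1"
      using \<tau>_mono[OF ij(1)] \<tau>(2)[of j] \<tau>(1)[of j] \<tau>(1)[of N] by (intro mult_mono) (auto intro: less_imp_le)
    hence "\<bar>\<tau> i * \<tau> j * a\<bar> \<le> \<tau> N * a"
      using a \<tau>(1)[of i] \<tau>(1)[of j] by (simp add: abs_mult mult_right_mono)
    hence "B * (exp \<bar>\<tau> i * \<tau> j * a\<bar> - 1) \<le> \<delta> N"
      unfolding \<delta>_def B_def using a by (intro mult_left_mono) auto
    moreover have "\<bar>\<psi> (\<tau> i * \<tau> j) - B\<bar> \<le> B * (exp \<bar>\<tau> i * \<tau> j * a\<bar> - 1)"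
      using exp_remainder_asymp[OF nz, of L a] a by (simp add: \<psi>_def B_def)
    ultimately show ?thesis by linarith
  qed
  \<comment> \<open>The squared distance is an alternating sum of four values of \<psi>, each within
    \<open>\<delta> N\<close> of \<open>B\<close>; the copies of \<open>B\<close> cancel.\<close>
  have sq: "(hnorm ip (F i - F j))\<^sup>2 \<le> 4 * \<delta> N" if ij: "N \<le> i" "N \<le> j" for i j N
  proof -
    have d: "F i - F j \<in> H" using F by blast
    have "complex_of_real ((hnorm ip (F i - F j))\<^sup>2) =
        of_real (\<psi> (\<tau> i * \<tau> i) - \<psi> (\<tau> j * \<tau> i) - (\<psi> (\<tau> i * \<tau> j) - \<psi> (\<tau> j * \<tau> j)))"
      unfolding ip_self[OF d, symmetric] ip_diff_right[OF F F d] ip_diff_left[OF F F F] FF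
      by (simp only: of_real_diff)
    hence "(hnorm ip (F i - F j))\<^sup>2 = \<psi> (\<tau> i * \<tau> i) - \<psi> (\<tau> j * \<tau> i) - (\<psi> (\<tau> i * \<tau> j) - \<psi> (\<tau> j * \<tau> j))"
      by (simp only: of_real_eq_iff)
    thus ?thesis using \<psi>[OF ij(1) ij(1)] \<psi>[OF ij(1) ij(2)] \<psi>[OF ij(2) ij(1)] \<psi>[OF ij(2) ij(2)]
      by linarith
  qed
  have "\<exists>N. \<forall>i\<ge>N. \<forall>j\<ge>N. hnorm ip (F i - F j) < e" if e: "e > 0" for e
  proof -
    have "(\<lambda>N. 4 * \<delta> N) \<longlonglongrightarrow> 0" using tendsto_mult_left[OF \<delta>_lim, of 4] by simp
    hence "\<forall>\<^sub>F N in sequentially. 4 * \<delta> N < e\<^sup>2" using e by (intro order_tendstoD(2)[of _ 0 _ "e\<^sup>2"]) auto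
    then obtain N where N: "4 * \<delta> N < e\<^sup>2" by (auto simp: eventually_sequentially)
    show ?thesis
    proof (intro exI[of _ N] allI impI)
      fix i j assume ij: "N \<le> i" "N \<le> j"
      show "hnorm ip (F i - F j) < e"
        using le_less_trans[OF sq[OF ij] N] less_imp_le[OF e] by (rule power2_less_imp_less)
    qed
  qed
  then obtain q where q: "q \<in> H" "(\<lambda>n. hnorm ip (F n - q)) \<longlonglongrightarrow> 0"
    using complete[of F] F by blast
  \<comment> \<open>The limit supplied by completeness is identified pointwise.\<close>
  have "q y = T z L y" for y
  proof (rule LIMSEQ_unique)
    show "(\<lambda>n. F n y) \<longlonglongrightarrow> q y" by (rule tendsto_pointwise[OF F q])
    define b where "b = inner z (y - p) / s"
    have Fy: "F n y = of_real (g y * (exp_remainder L (\<tau> n * b) / \<tau> n ^ L))" for n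
      by (simp add: F_def remainder_def K_apply T_def sum_fun_apply exp_remainder_def b_def
          right_diff_distrib sum_distrib_left diff_divide_distrib sum_divide_distrib mult_ac)
    have "(\<lambda>n. exp_remainder L (\<tau> n * b) / \<tau> n ^ L - b ^ L / fact L) \<longlonglongrightarrow> 0"
    proof (rule Lim_null_comparison)
      show "\<forall>\<^sub>F n in sequentially. norm (exp_remainder L (\<tau> n * b) / \<tau> n ^ L - b ^ L / fact L)
          \<le> \<bar>b\<bar> ^ L / fact L * (exp \<bar>\<tau> n * b\<bar> - 1)"
        using exp_remainder_asymp[of "\<tau> _" L b] \<tau>(1) by (auto simp: less_imp_neq[symmetric])
      show "(\<lambda>n. \<bar>b\<bar> ^ L / fact L * (exp \<bar>\<tau> n * b\<bar> - 1)) \<longlonglongrightarrow> 0"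
        by (rule tendsto_eq_intros refl \<tau>_lim | simp)+
    qed
    hence "(\<lambda>n. exp_remainder L (\<tau> n * b) / \<tau> n ^ L) \<longlonglongrightarrow> b ^ L / fact L" by (rule LIM_zero_cancel)
    thus "(\<lambda>n. F n y) \<longlonglongrightarrow> T z L y"
      unfolding Fy T_def b_def[symmetric] by (intro tendsto_of_real tendsto_mult tendsto_const)
  qed
  hence qT: "q = T z L" by blast
  \<comment> \<open>By the induction hypothesis, pairing with the scaled remainder removes the lower
    terms of \<open>P\<close> and divides by the power, leaving the value of \<open>S\<close> near
    0.\<close>
  obtain S where S: "coeff S 0 = coeff P L"
    "\<And>x. poly P x = (\<Sum>l<L. coeff P l * x ^ l) + x ^ L * poly S x"
    using poly_taylor_split[of P L] by blast
  have "ip h (F n) = poly S (of_real (\<tau> n))" for n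
  proof -
    have "ip h (T (\<tau> n *\<^sub>R z) l) = coeff P l * of_real (\<tau> n) ^ l" if "l < L" for l
    proof -
      have "ip h (T z l) = coeff P l"
        using IH[OF that] h P unfolding extracts_coeff_def by blast
      thus ?thesis using h by (simp add: T_scale ip_scale_right)
    qed
    hence "ip h (remainder L (\<tau> n *\<^sub>R z)) = poly P (of_real (\<tau> n)) - (\<Sum>l<L. coeff P l * of_real (\<tau> n) ^ l)"
      unfolding remainder_def using h P
      by (simp add: ip_diff_right H_sum ip_sum_right ip_K)
    also have "\<dots> = of_real (\<tau> n) ^ L * poly S (of_real (\<tau> n))" by (simp add: S(2))
    finally show ?thesis using h \<tau>(1)[of n] by (simp add: F_def ip_scale_right)
  qed
  moreover have "(\<lambda>n. poly S (of_real (\<tau> n))) \<longlonglongrightarrow> poly S (of_real 0)"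
    by (intro tendsto_intros \<tau>_lim)
  ultimately have "(\<lambda>n. ip h (F n)) \<longlonglongrightarrow> coeff P L"
    using S(1) by (simp add: poly_0_coeff_0)
  moreover have "(\<lambda>n. ip h (F n)) \<longlonglongrightarrow> ip h q"
    using tendsto_cnj[OF tendsto_ip_left[OF F q h]] ip_cnj[OF F h] ip_cnj[OF q(1) h] by simp
  ultimately show "ip h (T z L) = coeff P L"
    unfolding qT by (rule LIMSEQ_unique[symmetric])
qed

lemma extracts_coeff: "extracts_coeff L"
  by (induction L rule: less_induct) (rule extracts_coeff_step)

lemma ip_T_eq_coeff:
  assumes "h \<in> H" "\<And>t::real. h (p + t *\<^sub>R z) / of_real (g (p + t *\<^sub>R z)) = poly P (of_real t)"
  shows "ip h (T z l) = coeff P l"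
  using extracts_coeff[of l] assms unfolding extracts_coeff_def by blast

text \<open>Along the ray the quotient has degree at most n, so its value at 1 is the sum of its
  first n + 1 coefficients: \<open>K z\<close> and its truncation act alike on
  \<open>V n\<close>.\<close>

lemma ip_V_remainder:
  assumes "w \<in> V n"
  shows "ip w (remainder (Suc n) z) = 0"
proof -
  obtain P where P: "degree P \<le> n" "\<And>t::real. w (p + t *\<^sub>R z) / of_real (g (p + t *\<^sub>R z)) = poly P (of_real t)"
    using V_on_lines[OF assms] by blast
  have w: "w \<in> H" using V_in_H[OF assms] .
  have "ip w (K z) = poly P 1" using P(2)[of 1] w by (simp add: ip_K)
  also have "\<dots> = (\<Sum>l\<le>n. coeff P l)"
  proof -
    have "(\<Sum>l\<le>n. coeff P l) = (\<Sum>l\<le>degree P. coeff P l)"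
      using P(1) by (intro sum.mono_neutral_right) (auto simp: coeff_eq_0)
    thus ?thesis by (simp add: poly_altdef)
  qed
  also have "\<dots> = ip w (\<Sum>l<Suc n. T z l)"
    using w by (subst ip_sum_right) (auto simp: ip_T_eq_coeff[OF w P(2)] lessThan_Suc_atMost)
  finally show ?thesis
    unfolding remainder_def using w by (simp add: ip_diff_right H_sum del: sum.lessThan_Suc)
qed

lemma hnorm_remainder: "(hnorm ip (remainder L z))\<^sup>2 = exp_remainder L ((norm z)\<^sup>2 / s)"
proof -
  have "complex_of_real ((hnorm ip (remainder L z))\<^sup>2) = of_real (exp_remainder L ((norm z)\<^sup>2 / s))"
    unfolding ip_self[OF remainder_in_H, symmetric]
    by (simp add: ip_remainder_aux[OF extracts_coeff] power2_norm_eq_inner)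
  thus ?thesis by (simp only: of_real_eq_iff)
qed

text \<open>The truncated sum lies in \<open>V n\<close> and pairs to 0, so \<open>K z\<close> may
  be replaced by its remainder, which is much smaller in norm.\<close>

lemma ortho_eq_ip_remainder:
  assumes h: "h \<in> H" and ortho: "\<And>w. w \<in> V n \<Longrightarrow> ip h w = 0"
  shows "h (p + z) = of_real (g (p + z)) * ip h (remainder (Suc n) z)"
proof -
  have "ip h (\<Sum>l<Suc n. T z l) = 0"
    by (rule ortho, rule cfun.subspace_sum[OF subspace_V]) (auto intro: T_in_V)
  hence "ip h (remainder (Suc n) z) = h (p + z) / of_real (g (p + z))"
    unfolding remainder_def using h by (simp only: ip_diff_right H_sum T_in_H K_in_H ip_K) simp
  thus ?thesis by (simp add:)
qed

text \<open>Cauchy-Schwarz with the explicit norm of the remainder. The square root of the factorial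
  in the final rate originates here.\<close>

lemma ortho_bound:
  assumes h: "h \<in> H" and ortho: "\<And>w. w \<in> V n \<Longrightarrow> ip h w = 0"
  shows "cmod (h (p + z)) \<le> g (p + z) * (hnorm ip h *
    sqrt (((norm z)\<^sup>2 / s) ^ Suc n / fact (Suc n) * exp ((norm z)\<^sup>2 / s)))"
proof -
  have eq: "h (p + z) = of_real (g (p + z)) * ip h (remainder (Suc n) z)"
    by (rule ortho_eq_ip_remainder[OF h ortho])
  have "hnorm ip (remainder (Suc n) z) = sqrt (exp_remainder (Suc n) ((norm z)\<^sup>2 / s))"
    unfolding hnorm_remainder[symmetric] by simp
  also have "\<dots> \<le> sqrt (((norm z)\<^sup>2 / s) ^ Suc n / fact (Suc n) * exp ((norm z)\<^sup>2 / s))"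
    using s_pos by (intro real_sqrt_le_mono exp_remainder_le) simp
  finally have rem: "hnorm ip h * hnorm ip (remainder (Suc n) z) \<le> hnorm ip h *
      sqrt (((norm z)\<^sup>2 / s) ^ Suc n / fact (Suc n) * exp ((norm z)\<^sup>2 / s))"
    using h by (intro mult_left_mono) auto
  have "cmod (ip h (remainder (Suc n) z)) \<le> hnorm ip h * hnorm ip (remainder (Suc n) z)"
    by (rule cauchy_schwarz[OF h]) simp
  hence "g (p + z) * cmod (ip h (remainder (Suc n) z)) \<le> g (p + z) * (hnorm ip h *
      sqrt (((norm z)\<^sup>2 / s) ^ Suc n / fact (Suc n) * exp ((norm z)\<^sup>2 / s)))"
    using rem by (intro mult_left_mono) (auto intro: less_imp_le)
  moreover have "cmod (h (p + z)) = g (p + z) * cmod (ip h (remainder (Suc n) z))"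
    using arg_cong[of _ _ cmod, OF eq] by (simp add: norm_mult abs_of_pos)
  ultimately show ?thesis by simp
qed

text \<open>At a fixed point the bound for functions orthogonal to \<open>V n\<close> holds for
  every n and tends to 0.\<close>

lemma V_dense:
  assumes h: "h \<in> H" and ortho: "\<And>n w. w \<in> V n \<Longrightarrow> ip h w = 0"
  shows "h = 0"
proof
  fix x
  define z where "z = x - p"
  let ?a = "(norm z)\<^sup>2 / s"
  have "(\<lambda>n. ?a ^ n / fact n) \<longlonglongrightarrow> 0"
    using summable_LIMSEQ_zero[OF summable_exp[of ?a]] by (simp add: divide_inverse mult.commute)
  hence "(\<lambda>n. ?a ^ Suc n / fact (Suc n)) \<longlonglongrightarrow> 0" by (rule LIMSEQ_Suc)
  hence lim: "(\<lambda>n. g (p + z) * (hnorm ip h * sqrt (?a ^ Suc n / fact (Suc n) * exp ?a))) \<longlonglongrightarrow>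
      g (p + z) * (hnorm ip h * sqrt (0 * exp ?a))"
    by (intro tendsto_intros)
  have "cmod (h (p + z)) \<le> g (p + z) * (hnorm ip h * sqrt (0 * exp ?a))"
    by (rule LIMSEQ_le_const[OF lim]) (intro exI[of _ 0] allI impI ortho_bound[OF h ortho])
  thus "h x = 0 x" by (simp add: z_def)
qed

end

section \<open>Composition and its adjoint\<close>

text \<open>If all lower coefficients vanish, division by t^l bounds the cofactor by a multiple of
  t, so its value at 0, the next coefficient, vanishes too. With \<open>C\<close> equal to 0 this is
  the identity theorem on an interval.\<close>

lemma poly_eq_0_if_vanishing_order:
  fixes P :: "complex poly"
  assumes deg: "degree P \<le> m" and \<delta>: "\<delta> > 0"
    and small: "\<And>t. 0 < t \<Longrightarrow> t < \<delta> \<Longrightarrow> cmod (poly P (of_real t)) \<le> C * t ^ Suc m"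
  shows "P = 0"
proof -
  \<comment> \<open>A null sequence inside (0, \<delta>); staying at most 1 allows exponents to be
    lowered.\<close>
  define \<tau> where "\<tau> n = min 1 (\<delta> / 2) * inverse (real (Suc n))" for n
  have lim: "\<tau> \<longlonglongrightarrow> 0"
    unfolding \<tau>_def using tendsto_mult_left[OF LIMSEQ_inverse_real_of_nat, of "min 1 (\<delta> / 2)"] by simp
  have \<tau>: "0 < \<tau> n" "\<tau> n \<le> 1" "\<tau> n < \<delta>" for n
  proof -
    show "0 < \<tau> n" using \<delta> by (simp add: \<tau>_def)
    have "\<tau> n \<le> min 1 (\<delta> / 2) * 1" unfolding \<tau>_def using \<delta>
      by (intro mult_left_mono) (auto simp: field_simps)
    thus "\<tau> n \<le> 1" "\<tau> n < \<delta>" using \<delta> by auto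
  qed
  have "coeff P l = 0" if "l \<le> m" for l
    using that
  proof (induction l rule: less_induct)
    case (less l)
    obtain S where S: "coeff S 0 = coeff P l"
      "\<And>x. poly P x = (\<Sum>i<l. coeff P i * x ^ i) + x ^ l * poly S x"
      using poly_taylor_split[of P l] by blast
    have PS: "poly P x = x ^ l * poly S x" for x
      using S(2)[of x] less by simp
    have "cmod (poly S (of_real (\<tau> n))) \<le> \<bar>C\<bar> * \<tau> n" for n
    proof -
      have "\<tau> n ^ l * cmod (poly S (of_real (\<tau> n))) \<le> C * \<tau> n ^ Suc m"
        using small[OF \<tau>(1) \<tau>(3), of n] \<tau>(1)[of n] by (simp add: PS norm_mult norm_power)
      also have "C * \<tau> n ^ Suc m \<le> \<bar>C\<bar> * \<tau> n ^ Suc l"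
        using \<tau>[of n] less.prems by (intro mult_mono power_decreasing) auto
      also have "\<dots> = \<tau> n ^ l * (\<bar>C\<bar> * \<tau> n)" by simp
      finally show ?thesis using \<tau>(1)[of n] by (simp only: mult_le_cancel_left_pos zero_less_power)
    qed
    note bound = this
    have "(\<lambda>n. \<bar>C\<bar> * \<tau> n) \<longlonglongrightarrow> 0"
      using tendsto_mult_left[OF lim, of "\<bar>C\<bar>"] by simp
    hence 1: "(\<lambda>n. poly S (of_real (\<tau> n))) \<longlonglongrightarrow> 0"
      by (rule Lim_null_comparison[rotated]) (simp add: bound)
    have 2: "(\<lambda>n. poly S (of_real (\<tau> n))) \<longlonglongrightarrow> poly S (of_real 0)"
      by (intro tendsto_intros lim)
    have "poly S (of_real 0) = 0" using 2 1 by (rule LIMSEQ_unique)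
    thus ?case using S(1) by (simp add: poly_0_coeff_0)
  qed
  moreover have "coeff P l = 0" if "\<not> l \<le> m" for l
    using that deg by (intro coeff_eq_0) simp
  ultimately show ?thesis by (intro poly_eqI) (metis coeff_0)
qed

section \<open>Orthonormal coordinates, residuals and vanishing order\<close>

locale jet_rkhs_onb = jet_rkhs k H ip p \<kappa> s
  for k :: "real ^ 'd \<Rightarrow> real ^ 'd \<Rightarrow> complex" and H :: "(real ^ 'd \<Rightarrow> complex) set" and ip p \<kappa> s +
  fixes v :: "nat \<Rightarrow> real ^ 'd \<Rightarrow> complex"
  assumes \<kappa>_nonneg: "0 \<le> \<kappa>"
    and onb: "adapted_onb k ip p v"
begin

definition r :: "nat \<Rightarrow> nat" where "r n = jet_dim k p n"

lemma g_le_1: "g x \<le> 1"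
  using \<kappa>_nonneg by (simp add: gauss_weight_def)

lemma v_ortho: "ip (v i) (v j) = (if i = j then 1 else 0)"
  and V_eq_span: "V n = cfun.span (v ` {..<r n})"
  using onb unfolding adapted_onb_def r_def by blast+

lemma v_in_H [simp]: "v i \<in> H"
proof -
  have "v i \<in> cfun.span (range v)" by (intro cfun.span_base) auto
  thus ?thesis using onb jets_in_H unfolding adapted_onb_def by auto
qed

lemma v_in_V: "i < r n \<Longrightarrow> v i \<in> V n"
  unfolding V_eq_span by (intro cfun.span_base) auto

lemma v_sum_in_H [simp]: "(\<Sum>i\<in>I. fscale (c i) (v i)) \<in> H"
  by (intro H_sum H_scale) simp

lemma v_sum_in_V: "r m \<le> r n \<Longrightarrow> (\<Sum>i<r m. fscale (c i) (v i)) \<in> V n"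
  by (intro cfun.subspace_sum[OF subspace_V] cfun.subspace_scale[OF subspace_V] v_in_V) auto

lemma ip_v_sum: "finite I \<Longrightarrow> j \<in> I \<Longrightarrow> ip (\<Sum>i\<in>I. fscale (c i) (v i)) (v j) = c j"
  by (rule orthonormal_sum[OF v_in_H v_ortho])

lemma V_expansion:
  assumes "w \<in> V n"
  shows "w = (\<Sum>j<r n. fscale (ip w (v j)) (v j))"
proof -
  have "\<exists>c. w = (\<Sum>j<r n. fscale (c j) (v j))"
    using assms unfolding V_eq_span
  proof (induction rule: cfun.span_induct_alt)
    case base
    show ?case by (intro exI[of _ "\<lambda>_. 0"]) (auto simp: fun_eq_iff sum_fun_apply)
  next
    case (step c x y)
    then obtain i d where i: "x = v i" "i < r n" "y = (\<Sum>j<r n. fscale (d j) (v j))" by blast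
    have "fscale c x + y = (\<Sum>j<r n. fscale (d j + (if j = i then c else 0)) (v j))"
      using i(2) unfolding i(1,3)
      by (auto simp: fun_eq_iff sum_fun_apply ring_distribs sum.distrib if_distrib[of "\<lambda>a. a * _"] cong: if_cong)
    thus ?case by (intro exI[of _ "\<lambda>j. d j + (if j = i then c else 0)"])
  qed
  then obtain c where c: "w = (\<Sum>j<r n. fscale (c j) (v j))" by blast
  have "ip w (v j) = c j" if "j < r n" for j unfolding c using that by (intro ip_v_sum) auto
  thus ?thesis using c by simp
qed

lemma v_sum_eq_0D:
  assumes "(\<Sum>j<n. fscale (c j) (v j)) = 0" "j < n"
  shows "c j = 0"
  using ip_v_sum[of "{..<n}" j c] assms by simp

text \<open>Otherwise the unit vector \<open>v (r n)\<close> would lie in \<open>V n\<close> while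
  being orthogonal to the basis of \<open>V n\<close>.\<close>

lemma r_mono:
  assumes "m \<le> n"
  shows "r m \<le> r n"
proof (rule ccontr)
  assume "\<not> r m \<le> r n"
  hence "v (r n) \<in> V n" using v_in_V[of "r n" m] jet_space_upto_mono[OF assms, of k p] by auto
  hence "v (r n) = (\<Sum>j<r n. fscale (ip (v (r n)) (v j)) (v j))" by (rule V_expansion)
  also have "\<dots> = 0" by (intro sum.neutral) (auto simp: v_ortho fun_eq_iff)
  finally have "v (r n) = 0" .
  thus False using v_ortho[of "r n" "r n"] by simp
qed

lemma ortho_V:
  assumes h: "h \<in> H" and ortho: "\<And>j. j < r n \<Longrightarrow> ip h (v j) = 0" and w: "w \<in> V n"
  shows "ip h w = 0"
proof -
  have "ip h w = ip h (\<Sum>j<r n. fscale (ip w (v j)) (v j))" using V_expansion[OF w] by simp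
  also have "\<dots> = 0" using h ortho by (subst ip_sum_right) (auto simp: ip_scale_right)
  finally show ?thesis .
qed

definition residual :: "nat \<Rightarrow> (real ^ 'd \<Rightarrow> complex) \<Rightarrow> real ^ 'd \<Rightarrow> complex" where
  "residual n h = h - (\<Sum>j<r n. fscale (ip h (v j)) (v j))"

lemma residual_in_H: "h \<in> H \<Longrightarrow> residual n h \<in> H"
  unfolding residual_def by (intro H_diff) auto

lemma residual_ortho:
  assumes "h \<in> H" "w \<in> V n"
  shows "ip (residual n h) w = 0"
  using residual_in_H[OF assms(1)] _ assms(2)
proof (rule ortho_V)
  fix j assume "j < r n"
  thus "ip (residual n h) (v j) = 0"
    unfolding residual_def using assms(1) by (simp add: ip_diff_left ip_v_sum)
qed

lemma hnorm_residual: "h \<in> H \<Longrightarrow> hnorm ip (residual n h) \<le> hnorm ip h"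
  unfolding residual_def by (rule hnorm_residual_le[OF v_in_H v_ortho]) auto

text \<open>Under the square root of \<open>ortho_bound\<close> stands a multiple of the power of
  exponent 2 (n + 1) of \<open>norm z\<close>; the other factors are bounded on the unit
  ball.\<close>

lemma ortho_vanishing_order:
  assumes h: "h \<in> H" and ortho: "\<And>w. w \<in> V n \<Longrightarrow> ip h w = 0"
  obtains C where "C \<ge> 0" "\<And>z. norm z \<le> 1 \<Longrightarrow> cmod (h (p + z)) \<le> C * norm z ^ Suc n"
proof
  let ?C = "hnorm ip h * sqrt ((1 / s) ^ Suc n * exp (1 / s))"
  show "?C \<ge> 0" using h s_pos by simp
  fix z :: "real ^ 'd" assume z: "norm z \<le> 1"
  let ?x = "(norm z)\<^sup>2 / s"
  have x: "0 \<le> ?x" "?x \<le> 1 / s"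
    using z s_pos by (auto intro!: divide_right_mono power_le_one)
  have pow: "0 \<le> ?x ^ Suc n" using x(1) by (rule zero_le_power)
  have "?x ^ Suc n / fact (Suc n) \<le> ?x ^ Suc n / 1"
    by (intro divide_left_mono fact_ge_1 pow) auto
  hence "?x ^ Suc n / fact (Suc n) * exp ?x \<le> ?x ^ Suc n / 1 * exp (1 / s)"
    using x(2) pow by (intro mult_mono) (simp_all only: exp_le_cancel_iff exp_ge_zero div_by_1)
  also have "\<dots> = (norm z ^ Suc n)\<^sup>2 * ((1 / s) ^ Suc n * exp (1 / s))"
    by (simp add: power_divide power_mult_distrib power2_eq_square)
  finally have "sqrt (?x ^ Suc n / fact (Suc n) * exp ?x) \<le> sqrt ((norm z ^ Suc n)\<^sup>2 * ((1 / s) ^ Suc n * exp (1 / s)))"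
    by (rule real_sqrt_le_mono)
  also have "\<dots> = norm z ^ Suc n * sqrt ((1 / s) ^ Suc n * exp (1 / s))"
    unfolding real_sqrt_mult[of "(norm z ^ Suc n)\<^sup>2"] by simp
  finally have "hnorm ip h * sqrt (?x ^ Suc n / fact (Suc n) * exp ?x) \<le>
      hnorm ip h * (norm z ^ Suc n * sqrt ((1 / s) ^ Suc n * exp (1 / s)))"
    using hnorm_nonneg[OF h] by (rule mult_left_mono)
  hence "hnorm ip h * sqrt (?x ^ Suc n / fact (Suc n) * exp ?x) \<le> ?C * norm z ^ Suc n"
    by (simp only: mult_ac)
  moreover have "cmod (h (p + z)) \<le> g (p + z) * (hnorm ip h * sqrt (?x ^ Suc n / fact (Suc n) * exp ?x))"
    by (rule ortho_bound[OF h ortho])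
  moreover have "g (p + z) * (hnorm ip h * sqrt (?x ^ Suc n / fact (Suc n) * exp ?x)) \<le>
      1 * (hnorm ip h * sqrt (?x ^ Suc n / fact (Suc n) * exp ?x))"
    by (intro mult_right_mono g_le_1 mult_nonneg_nonneg hnorm_nonneg[OF h] real_sqrt_ge_zero
        divide_nonneg_pos pow) auto
  ultimately show "cmod (h (p + z)) \<le> ?C * norm z ^ Suc n" by linarith
qed

end

locale jet_composition = jet_rkhs_onb k H ip p \<kappa> s v
  for k :: "real ^ 'd \<Rightarrow> real ^ 'd \<Rightarrow> complex" and H :: "(real ^ 'd \<Rightarrow> complex) set" and ip p \<kappa> s v +
  fixes f :: "real ^ 'd \<Rightarrow> real ^ 'd"
  assumes f_fixed: "f p = p"
    and f_diff: "f differentiable (at p)"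
    and V_in_dom: "jet_space k p \<subseteq> comp_op_dom H f"
begin

lemma V_comp_in_H: "w \<in> V n \<Longrightarrow> w \<circ> f \<in> H"
  using V_in_dom unfolding jet_space_def comp_op_dom_def by blast

lemma f_linear_growth:
  obtains C \<delta> where "C > 0" "\<delta> > 0" "\<And>z. norm z < \<delta> \<Longrightarrow> norm (f (p + z) - p) \<le> C * norm z"
proof -
  obtain f' where f': "(f has_derivative f') (at p)" using f_diff unfolding differentiable_def by blast
  then obtain B where B: "B > 0" "\<And>z. norm (f' z) \<le> B * norm z"
    using bounded_linear.pos_bounded[OF has_derivative_bounded_linear[OF f']] by (metis mult.commute)
  have "\<exists>d>0. \<forall>y. norm (y - p) < d \<longrightarrow> norm (f y - f p - f' (y - p)) \<le> 1 * norm (y - p)"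
    using f' unfolding has_derivative_at_alt by (elim conjE allE[of _ 1]) simp
  then obtain \<delta> where \<delta>: "\<delta> > 0" "\<And>y. norm (y - p) < \<delta> \<Longrightarrow> norm (f y - f p - f' (y - p)) \<le> 1 * norm (y - p)"
    by blast
  show ?thesis
  proof
    show "B + 1 > 0" "\<delta> > 0" using B \<delta> by auto
    fix z :: "real ^ 'd" assume "norm z < \<delta>"
    hence "norm (f (p + z) - p - f' z) \<le> norm z" using \<delta>(2)[of "p + z"] by (simp add: f_fixed)
    moreover have "norm (f (p + z) - p) \<le> norm (f (p + z) - p - f' z) + norm (f' z)"
      using norm_triangle_ineq[of "f (p + z) - p - f' z" "f' z"] by simp
    ultimately show "norm (f (p + z) - p) \<le> (B + 1) * norm z"
      using B(2)[of z] by (simp add: algebra_simps)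
  qed
qed

text \<open>Since \<open>f\<close> fixes \<open>p\<close>, composition preserves vanishing of order \<open>m\<close> at \<open>p\<close>, and for elements
  of \<open>H\<close> this vanishing is the same as orthogonality to \<open>V m\<close>.\<close>

lemma comp_ortho:
  assumes h: "h \<in> H" and hf: "h \<circ> f \<in> H" and ortho: "\<And>w. w \<in> V m \<Longrightarrow> ip h w = 0"
    and j: "j < r m"
  shows "ip (h \<circ> f) (v j) = 0"
proof -
  \<comment> \<open>The component of \<open>h \<circ> f\<close> in \<open>V m\<close>. Both
    \<open>h \<circ> f\<close> and its residual vanish to order m + 1 at \<open>p\<close>, hence so
    does \<open>w\<close>; but \<open>w / g\<close> has degree at most m on rays, which forces
    \<open>w\<close> to be 0.\<close>
  define w where "w = (\<Sum>j<r m. fscale (ip (h \<circ> f) (v j)) (v j))"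
  have w: "w \<in> V m" unfolding w_def by (rule v_sum_in_V) simp
  obtain C1 where C1: "C1 \<ge> 0" "\<And>z. norm z \<le> 1 \<Longrightarrow> cmod (h (p + z)) \<le> C1 * norm z ^ Suc m"
    using ortho_vanishing_order[OF h ortho] by blast
  obtain C2 where C2: "C2 \<ge> 0" "\<And>z. norm z \<le> 1 \<Longrightarrow> cmod (residual m (h \<circ> f) (p + z)) \<le> C2 * norm z ^ Suc m"
    using ortho_vanishing_order[OF residual_in_H[OF hf] residual_ortho[OF hf]] by blast
  obtain C \<delta> where C: "C > 0" "\<delta> > 0" "\<And>z. norm z < \<delta> \<Longrightarrow> norm (f (p + z) - p) \<le> C * norm z"
    using f_linear_growth by blast
  have "w (p + z) = 0" for z
  proof (cases "z = 0")
    case True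
    have "h p = 0" using C1(2)[of 0] by simp
    moreover have "residual m (h \<circ> f) p = 0" using C2(2)[of 0] by simp
    ultimately show ?thesis using True by (simp add: residual_def w_def f_fixed)
  next
    case False
    obtain P where P: "degree P \<le> m" "\<And>t::real. w (p + t *\<^sub>R z) / of_real (g (p + t *\<^sub>R z)) = poly P (of_real t)"
      using V_on_lines[OF w] by blast
    \<comment> \<open>The three bounds keep the point in the unit ball around \<open>p\<close>,
      inside the region of linear growth of \<open>f\<close>, and its image in the unit ball,
      respectively.\<close>
    define \<delta>' where "\<delta>' = min 1 (min \<delta> (1 / C)) / norm z"
    have \<delta>': "\<delta>' > 0" using C False by (simp add: \<delta>'_def)
    define D where "D = (C1 * (C * norm z) ^ Suc m + C2 * norm z ^ Suc m) * exp (\<kappa> * (1::real))"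
    have "P = 0"
    proof (rule poly_eq_0_if_vanishing_order[OF P(1) \<delta>'])
      fix t assume t: "0 < t" "t < \<delta>'"
      let ?y = "p + t *\<^sub>R z"
      have nz: "norm (t *\<^sub>R z) = t * norm z" using t by simp
      have tz: "t * norm z < min 1 (min \<delta> (1 / C))"
        using t(2) False by (simp add: \<delta>'_def pos_less_divide_eq)
      have f1: "norm (f ?y - p) \<le> C * (t * norm z)" using C(3)[of "t *\<^sub>R z"] tz unfolding nz by simp
      also have "C * (t * norm z) \<le> 1" using tz C(1) by (simp add: pos_less_divide_eq mult.commute)
      finally have f2: "norm (f ?y - p) \<le> 1" .
      have "cmod ((h \<circ> f) ?y) \<le> C1 * norm (f ?y - p) ^ Suc m" using C1(2)[OF f2] by simp
      also have "\<dots> \<le> C1 * (C * (t * norm z)) ^ Suc m"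
        using C1(1) f1 by (intro mult_left_mono power_mono) auto
      finally have 1: "cmod ((h \<circ> f) ?y) \<le> C1 * (C * (t * norm z)) ^ Suc m" .
      have 2: "cmod (residual m (h \<circ> f) ?y) \<le> C2 * (t * norm z) ^ Suc m"
        using C2(2)[of "t *\<^sub>R z"] tz unfolding nz by simp
      have "w ?y = (h \<circ> f) ?y - residual m (h \<circ> f) ?y" by (simp add: residual_def w_def)
      hence "cmod (w ?y) \<le> cmod ((h \<circ> f) ?y) + cmod (residual m (h \<circ> f) ?y)"
        by (simp only: norm_triangle_ineq4)
      hence wb: "cmod (w ?y) \<le> C1 * (C * (t * norm z)) ^ Suc m + C2 * (t * norm z) ^ Suc m"
        using 1 2 by linarith
      have "(t * norm z)\<^sup>2 \<le> 1" using tz t by (intro power_le_one) auto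
      hence "\<kappa> * (t * norm z)\<^sup>2 \<le> \<kappa> * 1" using \<kappa>_nonneg by (rule mult_left_mono)
      hence "1 / g ?y \<le> exp (\<kappa> * (1::real))"
        using t by (simp add: gauss_weight_def exp_minus power_mult_distrib divide_inverse)
      hence "cmod (w ?y) * (1 / g ?y) \<le> (C1 * (C * (t * norm z)) ^ Suc m + C2 * (t * norm z) ^ Suc m) * exp (\<kappa> * (1::real))"
        using wb by (intro mult_mono) (auto intro: less_imp_le order_trans[OF norm_ge_zero])
      also have "\<dots> = D * t ^ Suc m" by (simp add: D_def power_mult_distrib algebra_simps)
      also have "cmod (w ?y) * (1 / g ?y) = cmod (poly P (of_real t))"
        unfolding P(2)[symmetric] by (simp add: norm_divide abs_of_pos)
      finally show "cmod (poly P (of_real t)) \<le> D * t ^ Suc m" .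
    qed
    thus ?thesis using P(2)[of 1] by simp
  qed
  hence "w x = 0" for x by (metis add_diff_cancel_left' diff_add_cancel add.commute)
  hence "w = 0" by (simp add: fun_eq_iff)
  thus ?thesis unfolding w_def using j by (rule v_sum_eq_0D)
qed

text \<open>Only the \<open>V m\<close>-part of \<open>h\<close> contributes to the inner product of
  \<open>h \<circ> f\<close> with \<open>v j\<close>, which displays the adjoint as a finite sum;
  the conjugates come from conjugate linearity in the second argument. Uniqueness holds because all
  jets belong to the domain and only 0 is orthogonal to them.\<close>

lemma adjoint_v:
  assumes j: "j < r m"
  shows "adjoint_op H ip (comp_op_dom H f) (comp_op f) (v j) =
    (\<Sum>i<r m. fscale (cnj (ip (v i \<circ> f) (v j))) (v i))" (is "_ = ?u")
  unfolding adjoint_op_def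
proof (rule the_equality)
  have u: "?u \<in> H" by simp
  have adj: "ip (comp_op f h) (v j) = ip h ?u" if "h \<in> comp_op_dom H f" for h
  proof -
    have h: "h \<in> H" "h \<circ> f \<in> H" using that unfolding comp_op_dom_def by auto
    let ?Ph = "\<Sum>i<r m. fscale (ip h (v i)) (v i)"
    have vf: "v i \<circ> f \<in> H" if "i < r m" for i using V_comp_in_H[OF v_in_V[OF that]] .
    have Phf: "?Ph \<circ> f = (\<Sum>i<r m. fscale (ip h (v i)) (v i \<circ> f))"
      by (simp add: fun_eq_iff sum_fun_apply)
    have PhfH: "(\<Sum>i<r m. fscale (ip h (v i)) (v i \<circ> f)) \<in> H" using vf by (intro H_sum H_scale) auto
    have res: "residual m h \<circ> f = (h \<circ> f) - (\<Sum>i<r m. fscale (ip h (v i)) (v i \<circ> f))"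
      unfolding Phf[symmetric] by (simp add: residual_def fun_eq_iff)
    \<comment> \<open>The composed residual is in \<open>H\<close>, although C_f need not be defined
      everywhere, because both \<open>h\<close> and its projection belong to the domain.\<close>
    have "ip (residual m h \<circ> f) (v j) = 0"
      using residual_in_H[OF h(1)] _ residual_ortho[OF h(1)] j
      by (rule comp_ortho) (use res h(2) PhfH in \<open>simp add: H_diff\<close>)
    hence "ip (h \<circ> f) (v j) = ip (\<Sum>i<r m. fscale (ip h (v i)) (v i \<circ> f)) (v j)"
      unfolding res using h(2) PhfH by (simp add: ip_diff_left)
    also have "\<dots> = (\<Sum>i<r m. ip h (v i) * ip (v i \<circ> f) (v j))"
      using vf by (subst ip_sum_left) (auto simp: ip_scale_left)
    also have "\<dots> = ip h ?u"
      using h(1) by (subst ip_sum_right) (auto simp: ip_scale_right mult.commute)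
    finally show ?thesis by (simp add: comp_op_def)
  qed
  show "?u \<in> H \<and> (\<forall>h\<in>comp_op_dom H f. ip (comp_op f h) (v j) = ip h ?u)"
    using u adj by blast
  fix u' assume u': "u' \<in> H \<and> (\<forall>h\<in>comp_op_dom H f. ip (comp_op f h) (v j) = ip h u')"
  have "u' - ?u = 0"
  proof (rule V_dense)
    show d: "u' - ?u \<in> H" using u u' by blast
    fix n w assume "w \<in> V n"
    hence w: "w \<in> comp_op_dom H f" "w \<in> H"
      using V_in_dom V_in_H unfolding jet_space_def by blast+
    have "ip w u' = ip w ?u"
      using u'[THEN conjunct2, rule_format, OF w(1)] adj[OF w(1)] by (rule trans[OF sym])
    hence "ip w (u' - ?u) = 0" using ip_diff_right[OF conjunct1[OF u'] u w(2)] by (simp only: diff_self)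
    thus "ip (u' - ?u) w = 0" using ip_cnj[OF w(2) d] by simp
  qed
  thus "u' = ?u" by (rule eq_iff_diff_eq_0[THEN iffD2])
qed

lemma C_star_eq: "C_star k H ip f p v m = Matrix.mat (r m) (r m) (\<lambda>(i, j). cnj (ip (v i \<circ> f) (v j)))"
  (is "_ = ?A")
  unfolding C_star_def matrix_wrt_def r_def[symmetric]
proof (rule the_equality)
  show "?A \<in> carrier_mat (r m) (r m) \<and> (\<forall>j<r m. adjoint_op H ip (comp_op_dom H f) (comp_op f) (v j) =
      (\<Sum>i<r m. fscale (?A $$ (i, j)) (v i)))"
    by (auto simp: adjoint_v intro!: sum.cong)
  fix B assume B: "B \<in> carrier_mat (r m) (r m) \<and> (\<forall>j<r m. adjoint_op H ip (comp_op_dom H f) (comp_op f) (v j) =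
      (\<Sum>i<r m. fscale (B $$ (i, j)) (v i)))"
  show "B = ?A"
  proof (rule eq_matI)
    fix i j assume ij: "i < dim_row ?A" "j < dim_col ?A"
    hence "(\<Sum>i<r m. fscale (B $$ (i, j)) (v i)) = (\<Sum>i<r m. fscale (cnj (ip (v i \<circ> f) (v j))) (v i))"
      using B adjoint_v[of j m] by auto
    hence "ip (\<Sum>i<r m. fscale (B $$ (i, j)) (v i)) (v i) = ip (\<Sum>i<r m. fscale (cnj (ip (v i \<circ> f) (v j))) (v i)) (v i)"
      by simp
    thus "B $$ (i, j) = ?A $$ (i, j)" using ij by (simp add: ip_v_sum)
  qed (use B in auto)
qed

text \<open>A real supremum is an upper bound only for a set known to be bounded above; expansion in
  the finite basis of \<open>V m\<close> supplies such a bound.\<close>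

lemma hnorm_comp_le_op_norm:
  assumes i: "i < r m"
  shows "hnorm ip (v i \<circ> f) \<le> op_norm_on ip (V m) (comp_op f)"
proof -
  have vf: "v i \<circ> f \<in> H" if "i < r m" for i using V_comp_in_H[OF v_in_V[OF that]] .
  have "hnorm ip (comp_op f h) \<le> (\<Sum>j<r m. hnorm ip (v j \<circ> f))" if h: "h \<in> V m" "hnorm ip h \<le> 1" for h
  proof -
    have hH: "h \<in> H" using V_in_H[OF h(1)] .
    have "comp_op f h = (\<Sum>j<r m. fscale (ip h (v j)) (v j)) \<circ> f"
      unfolding comp_op_def by (rule arg_cong[of _ _ "\<lambda>w. w \<circ> f", OF V_expansion[OF h(1)]])
    also have "\<dots> = (\<Sum>j<r m. fscale (ip h (v j)) (v j \<circ> f))" by (simp add: fun_eq_iff sum_fun_apply)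
    finally have "hnorm ip (comp_op f h) \<le> (\<Sum>j<r m. hnorm ip (fscale (ip h (v j)) (v j \<circ> f)))"
      using vf hnorm_sum_le[of "{..<r m}" "\<lambda>j. fscale (ip h (v j)) (v j \<circ> f)"] by auto
    also have "\<dots> \<le> (\<Sum>j<r m. 1 * hnorm ip (v j \<circ> f))"
    proof (rule sum_mono)
      fix j assume j: "j \<in> {..<r m}"
      have "hnorm ip (v j) = 1" by (simp add: hnorm_def v_ortho)
      hence "cmod (ip h (v j)) \<le> 1" using cauchy_schwarz[OF hH v_in_H, of j] h(2) by simp
      hence "cmod (ip h (v j)) * hnorm ip (v j \<circ> f) \<le> 1 * hnorm ip (v j \<circ> f)"
        using vf j by (intro mult_right_mono) auto
      thus "hnorm ip (fscale (ip h (v j)) (v j \<circ> f)) \<le> 1 * hnorm ip (v j \<circ> f)"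
        using vf j by (simp add: hnorm_scale)
    qed
    finally show ?thesis by simp
  qed
  hence "bdd_above ((\<lambda>h. hnorm ip (comp_op f h)) ` {h \<in> V m. hnorm ip h \<le> 1})"
    by (intro bdd_aboveI2) auto
  moreover have "v i \<in> {h \<in> V m. hnorm ip h \<le> 1}"
    using v_in_V[OF i] by (simp add: hnorm_def v_ortho)
  ultimately show ?thesis
    unfolding op_norm_on_def using cSUP_upper[of "v i" _ "\<lambda>h. hnorm ip (comp_op f h)"]
    by (simp add: comp_op_def)
qed

end

section \<open>Coefficients of least squares projections\<close>

text \<open>By continuity a nonzero value persists on a small ball, which has positive Lebesgue
  measure.\<close>

lemma AE_lborel_eq_0_on_ball:
  fixes h :: "'a::euclidean_space \<Rightarrow> complex"
  assumes cont: "continuous_on UNIV h" and AE: "AE x in lborel. x \<in> ball a e \<longrightarrow> h x = 0" and x: "x \<in> ball a e"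
  shows "h x = 0"
proof (rule ccontr)
  assume "h x \<noteq> 0"
  have "open (ball a e \<inter> h -` (- {0}))"
    by (intro open_Int open_ball open_vimage cont) auto
  then obtain d where d: "d > 0" "ball x d \<subseteq> ball a e \<inter> h -` (- {0})"
    using x \<open>h x \<noteq> 0\<close> unfolding open_contains_ball by (metis IntI ComplI singletonD vimageI)
  have "AE y in lborel. \<not> y \<in> ball x d" using AE by eventually_elim (use d(2) in auto)
  hence "emeasure lborel {y \<in> space lborel. y \<in> ball x d} = 0" by (rule emeasure_eq_0_AE)
  also have "{y \<in> space lborel. y \<in> ball x d} = ball x d" by auto
  finally have "emeasure lborel (ball x d) = 0" .
  hence "measure lborel (ball x d) = 0" by (simp add: measure_def)
  thus False using content_ball_pos[OF d(1), of x] by simp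
qed

text \<open>The Jacobian of the change of variables is at least 1 for \<open>t \<ge> 1\<close>;
  dropping it gives an estimate uniform in \<open>t\<close>.\<close>

lemma nn_integral_dilation_le:
  fixes p :: "'a::euclidean_space" and F :: "'a \<Rightarrow> ennreal"
  assumes t: "t \<ge> 1" and F [measurable]: "F \<in> borel_measurable borel"
  shows "(\<integral>\<^sup>+x. F (p + t *\<^sub>R (x - p)) \<partial>lborel) \<le> (\<integral>\<^sup>+x. F x \<partial>lborel)"
proof -
  have "(\<integral>\<^sup>+x. F x \<partial>lborel) = (\<integral>\<^sup>+x. F x \<partial>density (distr lborel borel (\<lambda>x. (p - t *\<^sub>R p) + t *\<^sub>R x)) (\<lambda>_. ennreal (\<bar>t\<bar> ^ DIM('a))))"
    using t by (subst lborel_affine[of t "p - t *\<^sub>R p"]) auto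
  also have "\<dots> = (\<integral>\<^sup>+x. ennreal (\<bar>t\<bar> ^ DIM('a)) * F ((p - t *\<^sub>R p) + t *\<^sub>R x) \<partial>lborel)"
    by (subst nn_integral_density) (auto simp: nn_integral_distr)
  finally have eq: "(\<integral>\<^sup>+x. F x \<partial>lborel) = (\<integral>\<^sup>+x. ennreal (\<bar>t\<bar> ^ DIM('a)) * F ((p - t *\<^sub>R p) + t *\<^sub>R x) \<partial>lborel)" .
  have "(\<integral>\<^sup>+x. F (p + t *\<^sub>R (x - p)) \<partial>lborel) = (\<integral>\<^sup>+x. 1 * F ((p - t *\<^sub>R p) + t *\<^sub>R x) \<partial>lborel)"
    by (simp add: algebra_simps)
  also have "\<dots> \<le> (\<integral>\<^sup>+x. ennreal (\<bar>t\<bar> ^ DIM('a)) * F ((p - t *\<^sub>R p) + t *\<^sub>R x) \<partial>lborel)"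
    using t by (intro nn_integral_mono mult_right_mono) (auto simp: one_le_power)
  finally show ?thesis unfolding eq .
qed

text \<open>The variance is nonnegative.\<close>

lemma square_integral_le:
  assumes "prob_space D" "integrable D (\<lambda>x. X x :: real)" "integrable D (\<lambda>x. (X x)\<^sup>2)"
  shows "(LINT x|D. X x)\<^sup>2 \<le> (LINT x|D. (X x)\<^sup>2)"
proof -
  interpret prob_space D by fact
  have "0 \<le> variance X" by simp
  thus ?thesis using variance_eq[OF assms(2,3)] by simp
qed

text \<open>The lower bound on the density enters only as \<open>domination\<close>: Lebesgue
  measure on one ball is at most a multiple of the sampling distribution \<open>D\<close>. The
  centre of the ball is unrelated to \<open>p\<close>.\<close>

locale jet_sampling = jet_composition k H ip p \<kappa> s v f
  for k :: "real ^ 'd \<Rightarrow> real ^ 'd \<Rightarrow> complex" and H :: "(real ^ 'd \<Rightarrow> complex) set" and ip p \<kappa> s v f +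
  fixes D :: "(real ^ 'd) measure" and Z :: "(real ^ 'd) set" and x\<^sub>0 :: "real ^ 'd" and \<delta> c\<^sub>0 :: real
  assumes prob: "prob_space D" and sets_D: "sets D = sets borel"
    and f_cont: "continuous_on UNIV f"
    and Z: "compact Z" "AE x in D. x \<in> Z"
    and \<delta>: "\<delta> > 0" and c\<^sub>0: "c\<^sub>0 \<ge> 0"
    and domination: "\<And>h. h \<in> borel_measurable borel \<Longrightarrow>
      (\<integral>\<^sup>+x. indicator (ball x\<^sub>0 \<delta>) x * h x \<partial>lborel) \<le> ennreal c\<^sub>0 * (\<integral>\<^sup>+x. h x \<partial>D)"
begin

lemma g_cont: "continuous_on A g"
  unfolding gauss_weight_def[abs_def] by (intro continuous_intros)

lemma V_cont:
  assumes "w \<in> V n"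
  shows "continuous_on UNIV w"
  using assms unfolding V_eq weighted_polys_def
proof (induction rule: cfun.span_induct_alt)
  case base
  show ?case by (simp add: zero_fun_def)
next
  case (step c x y)
  then obtain \<alpha> where "x = weighted_monom \<kappa> p \<alpha>" by blast
  hence "continuous_on UNIV x"
    unfolding weighted_monom_def[abs_def] by (simp only:) (intro continuous_intros g_cont)
  thus ?case using step by (simp add: plus_fun_def fscale_def) (intro continuous_intros)
qed

lemma v_cont: "continuous_on UNIV (v i)"
proof -
  have "v i \<in> cfun.span (range v)" by (intro cfun.span_base) auto
  then obtain n where "v i \<in> V n" using onb unfolding adapted_onb_def jet_space_def by blast
  thus ?thesis by (rule V_cont)
qed

lemma vf_cont: "continuous_on UNIV (\<lambda>x. v i (f x))"
  by (rule continuous_on_compose2[OF v_cont f_cont]) auto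

lemma cont_bounded:
  fixes h :: "real ^ 'd \<Rightarrow> complex"
  assumes "continuous_on UNIV h"
  shows "\<exists>b. AE x in D. norm (h x) \<le> b"
proof -
  have "compact (h ` Z)" by (intro compact_continuous_image Z continuous_on_subset[OF assms]) auto
  then obtain b where "\<And>x. x \<in> Z \<Longrightarrow> norm (h x) \<le> b"
    by (meson bounded_iff compact_imp_bounded imageI)
  thus ?thesis using Z(2) by (intro exI[of _ b]) (auto elim!: eventually_mono)
qed

lemma cont_measurable: "continuous_on UNIV h \<Longrightarrow> h \<in> borel_measurable D"
  using measurable_cong_sets[OF sets_D refl] by (auto intro: borel_measurable_continuous_onI)

lemma cont_integrable:
  fixes h :: "real ^ 'd \<Rightarrow> complex"
  assumes "continuous_on UNIV h"
  shows "integrable D h"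
proof -
  interpret prob_space D by (rule prob)
  show ?thesis using cont_bounded[OF assms] cont_measurable[OF assms] integrable_const_bound by blast
qed

text \<open>On every line through the centre of the ball, \<open>w / g\<close> is a polynomial that
  vanishes on a segment.\<close>

lemma V_eq_0_if_vanishing_on_ball:
  assumes w: "w \<in> V n" and e: "e > 0" and vanish: "\<And>x. x \<in> ball a e \<Longrightarrow> w x = 0"
  shows "w = 0"
proof
  fix y
  define z where "z = y - a"
  obtain P where P: "degree P \<le> n" "\<And>t::real. w (a + t *\<^sub>R z) / of_real (g (a + t *\<^sub>R z)) = poly P (of_real t)"
    using V_on_lines[OF w] by blast
  have "P = 0"
  proof (rule poly_eq_0_if_vanishing_order[OF P(1)])
    \<comment> \<open>The added 1 covers the direction \<open>z = 0\<close>.\<close>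
    show "e / (norm z + 1) > 0" using e by (simp add: add_nonneg_pos)
    fix t assume t: "0 < t" "t < e / (norm z + 1)"
    have "t * norm z \<le> t * (norm z + 1)" using t by (intro mult_left_mono) auto
    also have "\<dots> < e" using t(2) by (simp add: pos_less_divide_eq add_nonneg_pos)
    finally have "a + t *\<^sub>R z \<in> ball a e" using t(1) by (simp add: dist_norm)
    thus "cmod (poly P (of_real t)) \<le> 0 * t ^ Suc n" using vanish P(2)[of t] by simp
  qed
  thus "w y = 0 y" using P(2)[of 1] by (simp add: z_def)
qed

lemma v_measurable [measurable]: "v i \<in> borel_measurable borel"
  by (rule borel_measurable_continuous_onI[OF v_cont])

lemma ball_sets: "ball a e \<in> sets borel"
  by (rule borel_open[OF open_ball])

lemma indicator_ball_measurable [measurable]: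
  "(indicator (ball a e) :: 'a::metric_space \<Rightarrow> ennreal) \<in> borel_measurable borel"
  by (rule borel_measurable_indicator[OF ball_sets])

lemma v_sum_vanishing_on_ball:
  assumes e: "e > 0" and AE: "AE x in lborel. x \<in> ball a e \<longrightarrow> (\<Sum>j<r n. c j * v j x) = 0"
  shows "\<forall>j<r n. c j = 0"
proof -
  let ?w = "\<Sum>j<r n. fscale (c j) (v j)"
  have w: "?w \<in> V n" by (rule v_sum_in_V) simp
  have "?w x = 0" if "x \<in> ball a e" for x
    by (rule AE_lborel_eq_0_on_ball[OF V_cont[OF w] _ that]) (use AE in \<open>simp add: sum_fun_apply\<close>)
  hence "?w = 0" by (rule V_eq_0_if_vanishing_on_ball[OF w e])
  thus ?thesis using v_sum_eq_0D[of c "r n"] by blast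
qed

definition Gram :: "nat \<Rightarrow> complex mat" where
  "Gram n = Matrix.mat (r n) (r n) (\<lambda>(i, j). LINT x|D. cnj (v i x) * v j x)"

text \<open>A combination vanishing almost everywhere for \<open>D\<close> vanishes Lebesgue-almost
  everywhere on the dominated ball, hence identically.\<close>

lemma det_Gram: "Determinant.det (Gram n) \<noteq> 0"
  unfolding Gram_def
proof (rule gram_det_nonzero)
  show "integrable D (\<lambda>x. cnj (v i x) * v j x)" for i j
    by (intro cont_integrable continuous_intros v_cont)
  fix c assume AE: "AE x in D. (\<Sum>j<r n. c j * v j x) = 0"
  let ?q = "\<lambda>x. \<Sum>j<r n. c j * v j x"
  have q: "continuous_on UNIV ?q" by (intro continuous_intros v_cont)
  have "(\<integral>\<^sup>+x. indicator (ball x\<^sub>0 \<delta>) x * ennreal (norm (?q x)) \<partial>lborel) \<le>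
      ennreal c\<^sub>0 * (\<integral>\<^sup>+x. ennreal (norm (?q x)) \<partial>D)"
    by (rule domination) measurable
  also have "(\<integral>\<^sup>+x. ennreal (norm (?q x)) \<partial>D) = (\<integral>\<^sup>+x. 0 \<partial>D)"
    using AE by (intro nn_integral_cong_AE) (auto elim!: eventually_mono)
  finally have "(\<integral>\<^sup>+x. indicator (ball x\<^sub>0 \<delta>) x * ennreal (norm (?q x)) \<partial>lborel) = 0" by simp
  hence "AE x in lborel. indicator (ball x\<^sub>0 \<delta>) x * ennreal (norm (?q x)) = 0"
    by (subst (asm) nn_integral_0_iff_AE[OF borel_measurable_times_ennreal]) measurable
  hence "AE x in lborel. x \<in> ball x\<^sub>0 \<delta> \<longrightarrow> ?q x = 0"
    by eventually_elim (auto simp: indicator_def)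
  thus "\<forall>j<r n. c j = 0" by (rule v_sum_vanishing_on_ball[OF \<delta>])
qed

text \<open>Taylor truncation at order \<open>m\<close> is evaluated through dilations about \<open>p\<close>, because along
  the ray through \<open>p\<close> and \<open>x\<close> the quotient \<open>w / g\<close> is a polynomial of degree at most \<open>n\<close>.\<close>

lemma truncation_eq_dilations:
  fixes c :: "nat \<Rightarrow> complex"
  assumes mn: "m \<le> n"
    and weights: "\<And>P. degree P \<le> n \<Longrightarrow>
      (\<Sum>l\<le>m. coeff P l) = (\<Sum>i\<le>n. \<omega> i * poly P (of_real (t i)))"
  shows "(\<Sum>j<r m. c j * (v j x / of_real (g x))) =
    (\<Sum>i\<le>n. \<omega> i * ((\<Sum>j<r n. c j * v j (p + t i *\<^sub>R (x - p))) / of_real (g (p + t i *\<^sub>R (x - p)))))"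
proof -
  define z where "z = x - p"
  let ?q = "\<Sum>j<r n. fscale (c j) (v j)" and ?qm = "\<Sum>j<r m. fscale (c j) (v j)"
  have q: "?q \<in> V n" and qm: "?qm \<in> V m" by (simp_all add: v_sum_in_V)
  obtain P where P: "degree P \<le> n" "\<And>t::real. ?q (p + t *\<^sub>R z) / of_real (g (p + t *\<^sub>R z)) = poly P (of_real t)"
    using V_on_lines[OF q] by blast
  have rmn: "r m \<le> r n" using r_mono[OF mn] .
  \<comment> \<open>The coordinates from \<open>r m\<close> on are orthogonal to \<open>V m\<close>,
    so dropping them does not change inner products with jets of order at most
    \<open>m\<close>.\<close>
  have diff: "ip (?q - ?qm) w = 0" if "w \<in> V m" for w
  proof (rule ortho_V[OF _ _ that])
    show "?q - ?qm \<in> H" by (intro H_diff) simp_all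
    fix j assume "j < r m"
    thus "ip (?q - ?qm) (v j) = 0" using rmn by (simp add: ip_diff_left ip_v_sum)
  qed
  have trunc: "ip ?q w = ip ?qm w" if "w \<in> V m" for w
    using diff[OF that] V_in_H[OF that] by (simp add: ip_diff_left)
  have "(\<Sum>j<r m. c j * (v j x / of_real (g x))) = ?qm (p + z) / of_real (g (p + z))"
    by (simp add: z_def sum_fun_apply sum_divide_distrib)
  also have "\<dots> = ip ?qm (K z)" by (simp add: ip_K)
  \<comment> \<open>The remainder is invisible to \<open>V m\<close>; what is left are Taylor
    coefficients up to order \<open>m\<close>, which \<open>?q\<close> and \<open>?qm\<close>
    share.\<close>
  also have "K z = remainder (Suc m) z + (\<Sum>l<Suc m. T z l)" by (simp add: remainder_def del: sum.lessThan_Suc)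
  also have "ip ?qm \<dots> = ip ?qm (\<Sum>l<Suc m. T z l)"
    using ip_V_remainder[OF qm] by (subst ip_add_right) (auto simp del: sum.lessThan_Suc)
  also have "\<dots> = (\<Sum>l<Suc m. ip ?qm (T z l))" by (rule ip_sum_right) auto
  also have "\<dots> = (\<Sum>l<Suc m. ip ?q (T z l))"
    by (intro sum.cong refl trunc[symmetric] T_in_V) auto
  also have "\<dots> = (\<Sum>l\<le>m. coeff P l)"
    unfolding lessThan_Suc_atMost by (intro sum.cong refl ip_T_eq_coeff P(2)) simp
  also have "\<dots> = (\<Sum>i\<le>n. \<omega> i * poly P (of_real (t i)))" by (rule weights[OF P(1)])
  finally show ?thesis unfolding P(2)[symmetric] z_def by (simp only: sum_fun_apply fscale_apply)
qed

text \<open>\<open>b\<close> and \<open>R\<close> are independent of n: the dual functions are built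
  for the fixed order \<open>m\<close> on a smaller ball and are bounded there, so n enters only
  through the interpolation weights.\<close>

lemma coefficient_bound:
  obtains b R where "b \<ge> 0" "R > 0"
    "\<And>n j c. m \<le> n \<Longrightarrow> j < r m \<Longrightarrow> cmod (c j) \<le> b * R ^ n * (LINT x|D. cmod (\<Sum>j<r n. c j * v j x))"
proof -
  define e where "e = \<delta> / 2"
  define M where "M = norm (x\<^sub>0 - p) + \<delta>"
  have e: "e > 0" and M: "M > 0" using \<delta> by (auto simp: e_def M_def add_nonneg_pos)
  \<comment> \<open>\<open>M\<close> bounds the distance to \<open>p\<close> on the large ball, so a
    dilation by at most 1 + \<epsilon> moves a point by at most \<open>e\<close> and maps the ball
    of half the radius into the large one.\<close>
  define \<epsilon> where "\<epsilon> = min 1 (e / M)"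
  have \<epsilon>: "0 < \<epsilon>" "\<epsilon> \<le> 1" "\<epsilon> * M \<le> e" using e M by (auto simp: \<epsilon>_def min_def field_simps)
  let ?B = "ball x\<^sub>0 \<delta>" and ?B' = "ball x\<^sub>0 e"
  \<comment> \<open>The quotients by \<open>g\<close> are the functions that are polynomial along
    rays from \<open>p\<close>.\<close>
  define u where "u j x = v j x / of_real (g x)" for j x
  define \<mu> where "\<mu> = density lborel (indicator ?B' :: real ^ 'd \<Rightarrow> ennreal)"
  have u_cont: "continuous_on UNIV (u j)" for j
    unfolding u_def by (intro continuous_intros v_cont g_cont) simp
  have mu_sets: "sets \<mu> = sets borel" by (simp add: \<mu>_def)
  have fin: "finite_measure \<mu>"
  proof (rule finite_measureI)
    have "emeasure \<mu> (space \<mu>) = emeasure lborel ?B'"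
      unfolding \<mu>_def
      by (subst emeasure_density) (use borel_measurable_indicator[OF ball_sets] in auto)
    thus "emeasure \<mu> (space \<mu>) \<noteq> \<infinity>" using emeasure_lborel_ball_finite[of x\<^sub>0 e] by simp
  qed
  have AE_mu: "(AE x in \<mu>. Q x) \<longleftrightarrow> (AE x in lborel. x \<in> ?B' \<longrightarrow> Q x)" for Q
    unfolding \<mu>_def by (subst AE_density) (auto simp: indicator_def)
  have int: "integrable \<mu> (\<lambda>x. cnj (u i x) * u j x)" for i j
  proof -
    have c: "continuous_on UNIV (\<lambda>x. cnj (u i x) * u j x)" by (intro continuous_intros u_cont)
    have "compact ((\<lambda>x. cnj (u i x) * u j x) ` cball x\<^sub>0 e)"
      by (intro compact_continuous_image continuous_on_subset[OF c]) auto
    then obtain b where b: "\<And>x. x \<in> cball x\<^sub>0 e \<Longrightarrow> norm (cnj (u i x) * u j x) \<le> b"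
      by (meson bounded_iff compact_imp_bounded imageI)
    interpret finite_measure \<mu> by (rule fin)
    have "(\<lambda>x. cnj (u i x) * u j x) \<in> borel_measurable \<mu>"
      using borel_measurable_continuous_onI[OF c] measurable_cong_sets[OF mu_sets refl] by blast
    thus ?thesis
      by (intro integrable_const_bound[of _ b]) (auto simp: AE_mu intro!: AE_I2 b)
  qed
  have indep: "\<forall>j<r m. c j = 0" if "AE x in \<mu>. (\<Sum>j<r m. c j * u j x) = 0" for c
  proof (rule v_sum_vanishing_on_ball[OF e])
    have "(\<Sum>j<r m. c j * u j x) = (\<Sum>j<r m. c j * v j x) / of_real (g x)" for x
      by (simp add: u_def sum_divide_distrib)
    thus "AE x in lborel. x \<in> ?B' \<longrightarrow> (\<Sum>j<r m. c j * v j x) = 0"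
      using that unfolding AE_mu by simp
  qed
  obtain E where E: "\<And>c j. j < r m \<Longrightarrow>
      (LINT x|\<mu>. (\<Sum>i<r m. E j i * cnj (u i x)) * (\<Sum>l<r m. c l * u l x)) = c j"
    using dual_functions[of "r m" \<mu> u, OF int indep] by blast
  define \<phi> where "\<phi> j x = (\<Sum>i<r m. E j i * cnj (u i x))" for j x
  have \<phi>_cont: "continuous_on UNIV (\<phi> j)" for j
    unfolding \<phi>_def by (intro continuous_intros u_cont)
  have "\<exists>b\<ge>0. \<forall>x\<in>?B'. cmod (\<phi> j x) \<le> b" for j
  proof -
    have "compact (\<phi> j ` cball x\<^sub>0 e)" by (intro compact_continuous_image continuous_on_subset[OF \<phi>_cont]) auto
    then obtain b where b: "\<And>x. x \<in> cball x\<^sub>0 e \<Longrightarrow> cmod (\<phi> j x) \<le> b"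
      by (meson bounded_iff compact_imp_bounded imageI)
    have "0 \<le> b" using b[of x\<^sub>0] e norm_ge_zero order_trans by (metis centre_in_cball less_imp_le)
    thus ?thesis using b by (intro exI[of _ b]) auto
  qed
  then obtain b where b: "\<And>j. 0 \<le> b j" "\<And>j x. x \<in> ?B' \<Longrightarrow> cmod (\<phi> j x) \<le> b j" by metis
  define \<Phi> where "\<Phi> = (\<Sum>j<r m. b j)"
  have \<Phi>: "0 \<le> \<Phi>" "\<And>j x. j < r m \<Longrightarrow> x \<in> ?B' \<Longrightarrow> cmod (\<phi> j x) \<le> \<Phi>"
  proof -
    show "0 \<le> \<Phi>" unfolding \<Phi>_def by (intro sum_nonneg b)
    fix j x assume "j < r m" "x \<in> ?B'"
    thus "cmod (\<phi> j x) \<le> \<Phi>"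
      using b(2)[of x j] member_le_sum[of j "{..<r m}" b] b(1) unfolding \<Phi>_def by force
  qed
  \<comment> \<open>Bounds \<open>1 / g\<close> on the large ball, to return from quotients to the
    functions themselves.\<close>
  define \<gamma> where "\<gamma> = exp (\<kappa> * M\<^sup>2)"
  have \<gamma>: "1 / g x \<le> \<gamma>" if "x \<in> ?B" for x
  proof -
    have "norm (x - p) \<le> norm (x\<^sub>0 - p) + norm (x - x\<^sub>0)"
      using norm_triangle_ineq[of "x\<^sub>0 - p" "x - x\<^sub>0"] by simp
    hence "norm (x - p) \<le> M" using that by (simp add: M_def dist_norm norm_minus_commute)
    hence "\<kappa> * (norm (x - p))\<^sup>2 \<le> \<kappa> * M\<^sup>2"
      using \<kappa>_nonneg by (intro mult_left_mono power_mono) auto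
    thus ?thesis by (simp add: gauss_weight_def exp_minus divide_inverse \<gamma>_def)
  qed
  define R where "R = 6 * exp 1 / \<epsilon>"
  define b' where "b' = \<Phi> * ((real m + 1) * exp 1) * (\<gamma> * c\<^sub>0)"
  show ?thesis
  proof (rule that[of b' R])
    show "b' \<ge> 0" "R > 0" using \<Phi>(1) c\<^sub>0 \<epsilon> by (auto simp: b'_def R_def \<gamma>_def)
    fix n j and c :: "nat \<Rightarrow> complex" assume mn: "m \<le> n" and j: "j < r m"
    obtain \<omega> where \<omega>: "\<And>P :: complex poly. degree P \<le> n \<Longrightarrow>
        (\<Sum>l\<le>m. coeff P l) = (\<Sum>i\<le>n. \<omega> i * poly P (of_real (1 + \<epsilon> * real i / (real n + 1))))"
      "(\<Sum>i\<le>n. norm (\<omega> i)) \<le> (real m + 1) * exp 1 * (6 * exp 1 / \<epsilon>) ^ n"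
      using coeff_sum_eq_weighted_values[OF \<epsilon>(1,2), of n m] by blast
    define t where "t i = 1 + \<epsilon> * real i / (real n + 1)" for i
    have t: "1 \<le> t i" "t i \<le> 1 + \<epsilon>" if "i \<le> n" for i
    proof -
      have "\<epsilon> * (real i / (real n + 1)) \<le> \<epsilon> * 1" using that \<epsilon> by (intro mult_left_mono) auto
      thus "1 \<le> t i" "t i \<le> 1 + \<epsilon>" using \<epsilon> by (auto simp: t_def)
    qed
    define q where "q x = (\<Sum>j<r n. c j * v j x)" for x
    define Q where "Q x = q x / of_real (g x)" for x
    have q_cont: "continuous_on UNIV q" unfolding q_def by (intro continuous_intros v_cont)
    have Q_cont: "continuous_on UNIV Q" unfolding Q_def by (intro continuous_intros q_cont g_cont) simp
    have [measurable]: "q \<in> borel_measurable borel" "Q \<in> borel_measurable borel"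
      by (rule borel_measurable_continuous_onI q_cont Q_cont)+
    \<comment> \<open>Truncated to the large ball, so that a dilation estimate over the whole space
      can be followed by the comparison with \<open>D\<close>.\<close>
    define F where "F x = indicator ?B x * ennreal (norm (Q x))" for x
    have [measurable]: "F \<in> borel_measurable borel" unfolding F_def by measurable
    have S: "(\<Sum>l<r m. c l * u l x) = (\<Sum>i\<le>n. \<omega> i * Q (p + t i *\<^sub>R (x - p)))" for x
      unfolding u_def Q_def q_def by (rule truncation_eq_dilations[OF mn \<omega>(1)[folded t_def]])
    have in_ball: "p + t i *\<^sub>R (x - p) \<in> ?B" if "i \<le> n" "x \<in> ?B'" for i x
    proof -
      have "norm (x - p) \<le> norm (x\<^sub>0 - p) + norm (x - x\<^sub>0)"
        using norm_triangle_ineq[of "x\<^sub>0 - p" "x - x\<^sub>0"] by simp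
      moreover have dx: "norm (x - x\<^sub>0) < e" using that(2) by (simp add: dist_norm norm_minus_commute)
      ultimately have "norm (x - p) \<le> M" using \<delta> by (simp add: M_def e_def)
      hence "(t i - 1) * norm (x - p) \<le> \<epsilon> * M" using t[OF that(1)] \<epsilon> by (intro mult_mono) auto
      hence "(t i - 1) * norm (x - p) \<le> e" using \<epsilon>(3) by linarith
      moreover have "norm (p + t i *\<^sub>R (x - p) - x\<^sub>0) \<le> norm (x - x\<^sub>0) + (t i - 1) * norm (x - p)"
      proof -
        have "p + t i *\<^sub>R (x - p) - x\<^sub>0 = (x - x\<^sub>0) + (t i - 1) *\<^sub>R (x - p)" by (simp add: algebra_simps)
        hence "norm (p + t i *\<^sub>R (x - p) - x\<^sub>0) \<le> norm (x - x\<^sub>0) + norm ((t i - 1) *\<^sub>R (x - p))"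
          by (simp only: norm_triangle_ineq)
        thus ?thesis using t[OF that(1)] by simp
      qed
      ultimately have "norm (p + t i *\<^sub>R (x - p) - x\<^sub>0) < \<delta>" using dx by (simp add: e_def)
      thus ?thesis by (simp add: dist_norm norm_minus_commute)
    qed
    have \<gamma>0: "0 \<le> \<gamma>" by (simp add: \<gamma>_def)
    have L0: "0 \<le> (LINT x|D. cmod (q x))" by simp
    have int_q: "integrable D (\<lambda>x. cmod (q x))" by (rule integrable_norm[OF cont_integrable[OF q_cont]])
    have "(\<integral>\<^sup>+x. F x \<partial>lborel) \<le> (\<integral>\<^sup>+x. indicator ?B x * (ennreal \<gamma> * ennreal (cmod (q x))) \<partial>lborel)"
    proof (rule nn_integral_mono)
      fix x
      have "cmod (Q x) \<le> \<gamma> * cmod (q x)" if "x \<in> ?B"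
        using mult_right_mono[OF \<gamma>[OF that], of "cmod (q x)"] by (simp add: Q_def norm_divide abs_of_pos)
      thus "F x \<le> indicator ?B x * (ennreal \<gamma> * ennreal (cmod (q x)))"
        by (auto simp: F_def indicator_def \<gamma>_def ennreal_mult[symmetric] intro!: ennreal_leI)
    qed
    also have "\<dots> \<le> ennreal c\<^sub>0 * (\<integral>\<^sup>+x. ennreal \<gamma> * ennreal (cmod (q x)) \<partial>D)"
      by (rule domination) measurable
    also have "(\<integral>\<^sup>+x. ennreal \<gamma> * ennreal (cmod (q x)) \<partial>D) = ennreal \<gamma> * (\<integral>\<^sup>+x. ennreal (cmod (q x)) \<partial>D)"
      by (rule nn_integral_cmult) (use cont_measurable[OF q_cont] in measurable)
    also have "(\<integral>\<^sup>+x. ennreal (cmod (q x)) \<partial>D) = ennreal (LINT x|D. cmod (q x))"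
      by (rule nn_integral_eq_integral[OF int_q]) simp
    also have "ennreal c\<^sub>0 * (ennreal \<gamma> * ennreal (LINT x|D. cmod (q x))) = ennreal (\<gamma> * c\<^sub>0 * (LINT x|D. cmod (q x)))"
      by (simp only: ennreal_mult[OF \<gamma>0 mult_nonneg_nonneg[OF c\<^sub>0 L0]] ennreal_mult[OF c\<^sub>0 L0] mult_ac)
    finally have F_le: "(\<integral>\<^sup>+x. F x \<partial>lborel) \<le> ennreal (\<gamma> * c\<^sub>0 * (LINT x|D. cmod (q x)))" .
    have meas_int: "(\<lambda>x. \<phi> j x * (\<Sum>l<r m. c l * u l x)) \<in> borel_measurable \<mu>"
    proof -
      have "continuous_on UNIV (\<lambda>x. \<phi> j x * (\<Sum>l<r m. c l * u l x))" by (intro continuous_intros \<phi>_cont u_cont)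
      from borel_measurable_continuous_onI[OF this] show ?thesis
        using measurable_cong_sets[OF mu_sets refl] by blast
    qed
    have "ennreal (cmod (c j)) = ennreal (norm (LINT x|\<mu>. \<phi> j x * (\<Sum>l<r m. c l * u l x)))"
      unfolding \<phi>_def E[OF j] ..
    \<comment> \<open>In the nonintegrable case the Bochner integral is 0 by convention.\<close>
    also have "\<dots> \<le> (\<integral>\<^sup>+x. norm (\<phi> j x * (\<Sum>l<r m. c l * u l x)) \<partial>\<mu>)"
      by (cases "integrable \<mu> (\<lambda>x. \<phi> j x * (\<Sum>l<r m. c l * u l x))")
        (auto simp: integral_norm_bound_ennreal not_integrable_integral_eq)
    also have "\<dots> = (\<integral>\<^sup>+x. indicator ?B' x * ennreal (norm (\<phi> j x * (\<Sum>l<r m. c l * u l x))) \<partial>lborel)"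
      using meas_int unfolding \<mu>_def by (subst nn_integral_density) auto
    also have "\<dots> \<le> (\<integral>\<^sup>+x. (\<Sum>i\<le>n. ennreal (\<Phi> * norm (\<omega> i)) * F (p + t i *\<^sub>R (x - p))) \<partial>lborel)"
    proof (rule nn_integral_mono)
      fix x
      show "indicator ?B' x * ennreal (norm (\<phi> j x * (\<Sum>l<r m. c l * u l x))) \<le>
          (\<Sum>i\<le>n. ennreal (\<Phi> * norm (\<omega> i)) * F (p + t i *\<^sub>R (x - p)))"
      proof (cases "x \<in> ?B'")
        case True
        have "norm (\<phi> j x * (\<Sum>l<r m. c l * u l x)) \<le> \<Phi> * (\<Sum>i\<le>n. norm (\<omega> i) * norm (Q (p + t i *\<^sub>R (x - p))))"
          unfolding S norm_mult
          by (intro mult_mono \<Phi> j True order_trans[OF norm_sum] sum_mono) (auto simp: norm_mult sum_nonneg)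
        also have "\<dots> = (\<Sum>i\<le>n. \<Phi> * norm (\<omega> i) * norm (Q (p + t i *\<^sub>R (x - p))))"
          by (simp add: sum_distrib_left mult_ac)
        finally have "ennreal (norm (\<phi> j x * (\<Sum>l<r m. c l * u l x))) \<le>
            ennreal (\<Sum>i\<le>n. \<Phi> * norm (\<omega> i) * norm (Q (p + t i *\<^sub>R (x - p))))" by (rule ennreal_leI)
        also have "\<dots> = (\<Sum>i\<le>n. ennreal (\<Phi> * norm (\<omega> i) * norm (Q (p + t i *\<^sub>R (x - p)))))"
          using \<Phi>(1) by (intro sum_ennreal[symmetric]) auto
        also have "\<dots> = (\<Sum>i\<le>n. ennreal (\<Phi> * norm (\<omega> i)) * F (p + t i *\<^sub>R (x - p)))"
          using in_ball[OF _ True] \<Phi>(1) by (intro sum.cong refl) (simp add: F_def ennreal_mult)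
        finally show ?thesis using True by simp
      qed simp
    qed
    also have "\<dots> = (\<Sum>i\<le>n. ennreal (\<Phi> * norm (\<omega> i)) * (\<integral>\<^sup>+x. F (p + t i *\<^sub>R (x - p)) \<partial>lborel))"
      by (subst nn_integral_sum) (auto simp: nn_integral_cmult)
    also have "\<dots> \<le> (\<Sum>i\<le>n. ennreal (\<Phi> * norm (\<omega> i)) * ennreal (\<gamma> * c\<^sub>0 * (LINT x|D. cmod (q x))))"
      using t by (intro sum_mono mult_left_mono order_trans[OF nn_integral_dilation_le F_le]) auto
    also have "\<dots> = (\<Sum>i\<le>n. ennreal (\<Phi> * norm (\<omega> i) * (\<gamma> * c\<^sub>0 * (LINT x|D. cmod (q x)))))"
      by (intro sum.cong refl ennreal_mult[symmetric] mult_nonneg_nonneg \<gamma>0 c\<^sub>0 L0 \<Phi>(1) norm_ge_zero)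
    also have "\<dots> = ennreal (\<Sum>i\<le>n. \<Phi> * norm (\<omega> i) * (\<gamma> * c\<^sub>0 * (LINT x|D. cmod (q x))))"
      by (intro sum_ennreal mult_nonneg_nonneg \<gamma>0 c\<^sub>0 L0 \<Phi>(1) norm_ge_zero)
    finally have "cmod (c j) \<le> (\<Sum>i\<le>n. \<Phi> * norm (\<omega> i) * (\<gamma> * c\<^sub>0 * (LINT x|D. cmod (q x))))"
      by (subst (asm) ennreal_le_iff)
        (intro sum_nonneg mult_nonneg_nonneg \<gamma>0 c\<^sub>0 L0 \<Phi>(1) norm_ge_zero)
    also have "\<dots> = \<Phi> * (\<gamma> * c\<^sub>0 * (LINT x|D. cmod (q x))) * (\<Sum>i\<le>n. norm (\<omega> i))"
      by (simp add: sum_distrib_left mult_ac)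
    also have "\<dots> \<le> \<Phi> * (\<gamma> * c\<^sub>0 * (LINT x|D. cmod (q x))) * ((real m + 1) * exp 1 * (6 * exp 1 / \<epsilon>) ^ n)"
      by (intro mult_left_mono \<omega>(2) mult_nonneg_nonneg \<gamma>0 c\<^sub>0 L0 \<Phi>(1))
    finally show "cmod (c j) \<le> b' * R ^ n * (LINT x|D. cmod (\<Sum>j<r n. c j * v j x))"
      unfolding b'_def R_def q_def by (simp only: mult_ac)
  qed
qed

end

section \<open>The limit of the empirical matrices\<close>

text \<open>In an initial segment exactly \<open>i\<close> elements lie below \<open>i\<close>, so
  the selection does not renumber indices.\<close>

lemma submatrix_leading_index:
  assumes "A \<in> carrier_mat n n" "m \<le> n" "i < m" "j < m"
  shows "submatrix A {..<m} {..<m} $$ (i, j) = A $$ (i, j)"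
proof -
  have c: "card {a \<in> {..<m}. a < i} = i" if "i < m" for i
  proof -
    have "{a \<in> {..<m}. a < i} = {..<i}" using that by auto
    thus ?thesis by simp
  qed
  show ?thesis
    using submatrix_index_card[of i A j "{..<m}" "{..<m}"] assms c[OF assms(3)] c[OF assms(4)] by auto
qed

lemma feature_mat_carrier: "feature_mat v r N x \<in> carrier_mat r N"
  by (simp add: feature_mat_def)

lemma feature_mat_gram:
  assumes "i < r" "j < r"
  shows "(feature_mat v r N y * mat_adjoint (feature_mat v r N x)) $$ (i, j) =
    (\<Sum>l<N. cnj (v i (y l)) * v j (x l))"
proof -
  have "row (feature_mat v r N y) i \<bullet> col (mat_adjoint (feature_mat v r N x)) j =
      (\<Sum>l\<in>{0..<N}. feature_mat v r N y $$ (i, l) * mat_adjoint (feature_mat v r N x) $$ (l, j))"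
    using assms feature_mat_carrier[of v r N x] feature_mat_carrier[of v r N y]
    by (auto simp: scalar_prod_def intro!: sum.cong)
  also have "\<dots> = (\<Sum>l<N. cnj (v i (y l)) * v j (x l))"
    using assms feature_mat_carrier[of v r N x]
    by (auto simp: atLeast0LessThan feature_mat_def intro!: sum.cong)
  finally show ?thesis
    using assms feature_mat_carrier[of v r N x] feature_mat_carrier[of v r N y] by simp
qed

lemma sqrt_double_sum_le:
  assumes "\<And>i j. i < r \<Longrightarrow> j < r \<Longrightarrow> \<bar>a i j\<bar> \<le> B" "0 \<le> B"
  shows "sqrt (\<Sum>i<r. \<Sum>j<r. (a i j)\<^sup>2) \<le> real r * B"
proof -
  have "(\<Sum>i<r. \<Sum>j<r. (a i j)\<^sup>2) \<le> (\<Sum>i<r. \<Sum>j<r. B\<^sup>2)"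
    using assms by (intro sum_mono abs_le_square_iff[THEN iffD1]) auto
  also have "\<dots> = (real r * B)\<^sup>2" by (simp add: power2_eq_square)
  finally show ?thesis using assms(2) by (simp add: real_le_lsqrt)
qed

context jet_sampling
begin

definition Cross :: "nat \<Rightarrow> complex mat" where
  "Cross n = Matrix.mat (r n) (r n) (\<lambda>(i, j). LINT x|D. cnj (v i (f x)) * v j x)"

lemma residual_cont: "continuous_on UNIV (residual n (v i \<circ> f))"
  unfolding residual_def fun_diff_def comp_def sum_fun_apply fscale_apply
  by (intro continuous_intros v_cont vf_cont)

text \<open>The rows of the limiting matrix are least squares coefficients, so \<open>q\<close> below is the
  \<open>L\<^sup>2\<close>-projection of the residual onto \<open>V n\<close>.\<close>

lemma least_squares_error:
  assumes A: "A \<in> carrier_mat (r n) (r n)" and AG: "A * Gram n = Cross n"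
    and i: "i < r n" and vf: "v i \<circ> f \<in> H"
    and bound: "AE x in D. cmod (residual n (v i \<circ> f) x) \<le> \<beta>" and \<beta>: "0 \<le> \<beta>"
  shows "(LINT x|D. cmod (\<Sum>j<r n. (cnj (A $$ (i, j)) - ip (v i \<circ> f) (v j)) * v j x)) \<le> \<beta>"
proof -
  interpret prob_space D by (rule prob)
  \<comment> \<open>The feature vectors are conjugated, so row i of \<open>A\<close> holds the
    conjugates of the least squares coefficients of \<open>v i \<circ> f\<close>.\<close>
  define d where "d j = cnj (A $$ (i, j)) - ip (v i \<circ> f) (v j)" for j
  define q where "q x = (\<Sum>j<r n. d j * v j x)" for x
  define R where "R = residual n (v i \<circ> f)"
  have q_cont: "continuous_on UNIV q" unfolding q_def by (intro continuous_intros v_cont)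
  have R_cont: "continuous_on UNIV R" unfolding R_def by (rule residual_cont)
  note int = cont_integrable
  have diff: "cnj (R x - q x) = cnj (v i (f x)) - (\<Sum>j<r n. A $$ (i, j) * cnj (v j x))" for x
  proof -
    have "R x - q x = v i (f x) - (\<Sum>j<r n. cnj (A $$ (i, j)) * v j x)"
      by (simp add: R_def residual_def q_def d_def sum_fun_apply left_diff_distrib sum_subtractf)
    thus ?thesis by simp
  qed
  \<comment> \<open>The normal equations: \<open>R - q\<close> is \<open>v i \<circ> f\<close> minus
    its least squares fit.\<close>
  have ortho: "(LINT x|D. cnj (R x - q x) * v l x) = 0" if l: "l < r n" for l
  proof -
    have "(LINT x|D. cnj (R x - q x) * v l x) =
        (LINT x|D. cnj (v i (f x)) * v l x - (\<Sum>j<r n. A $$ (i, j) * (cnj (v j x) * v l x)))"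
      unfolding diff by (simp add: left_diff_distrib sum_distrib_right mult.assoc)
    also have "\<dots> = (LINT x|D. cnj (v i (f x)) * v l x) - (LINT x|D. (\<Sum>j<r n. A $$ (i, j) * (cnj (v j x) * v l x)))"
      by (intro Bochner_Integration.integral_diff int continuous_intros v_cont vf_cont)
    also have "(LINT x|D. (\<Sum>j<r n. A $$ (i, j) * (cnj (v j x) * v l x))) =
        (\<Sum>j<r n. LINT x|D. A $$ (i, j) * (cnj (v j x) * v l x))"
      by (intro Bochner_Integration.integral_sum int continuous_intros v_cont)
    also have "\<dots> = (\<Sum>j<r n. A $$ (i, j) * Gram n $$ (j, l))"
      using l by (intro sum.cong refl) (simp add: Gram_def)
    also have "\<dots> = (A * Gram n) $$ (i, l)"
      using A i l by (auto simp: scalar_prod_def Gram_def atLeast0LessThan)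
    also have "\<dots> = (LINT x|D. cnj (v i (f x)) * v l x)"
      unfolding AG Cross_def using i l by simp
    finally show ?thesis by simp
  qed
  have "(LINT x|D. cnj (R x - q x) * q x) = (LINT x|D. (\<Sum>l<r n. d l * (cnj (R x - q x) * v l x)))"
    by (intro Bochner_Integration.integral_cong refl, subst (2) q_def) (simp only: sum_distrib_left mult_ac)
  also have "\<dots> = (\<Sum>l<r n. LINT x|D. d l * (cnj (R x - q x) * v l x))"
    by (intro Bochner_Integration.integral_sum int continuous_intros v_cont R_cont q_cont)
  also have "\<dots> = 0"
    by (intro sum.neutral ballI) (simp only: lessThan_iff integral_mult_right_zero ortho mult_zero_right)
  finally have "(LINT x|D. cnj (R x) * q x - cnj (q x) * q x) = 0" by (simp add: left_diff_distrib)
  hence "(LINT x|D. cnj (R x) * q x) - (LINT x|D. cnj (q x) * q x) = 0"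
    by (subst (asm) Bochner_Integration.integral_diff) (intro int continuous_intros R_cont q_cont)+
  moreover have "(LINT x|D. cnj (q x) * q x) = complex_of_real (LINT x|D. (cmod (q x))\<^sup>2)"
    unfolding integral_complex_of_real[symmetric] complex_norm_square by (simp only: mult.commute)
  ultimately have eq: "complex_of_real (LINT x|D. (cmod (q x))\<^sup>2) = (LINT x|D. cnj (R x) * q x)" by simp
  \<comment> \<open>The aim is E^2 \<le> \<beta> E: the left side is at most the squared L2-norm of
    \<open>q\<close>, which by orthogonality is the integral of
    \<open>cnj (R x) * q x\<close>.\<close>
  let ?E = "LINT x|D. cmod (q x)"
  have intq: "integrable D (\<lambda>x. cmod (q x))" by (intro integrable_norm int q_cont)
  have intq2: "integrable D (\<lambda>x. (cmod (q x))\<^sup>2)"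
  proof -
    have "integrable D (\<lambda>x. cmod (cnj (q x) * q x))" by (intro integrable_norm int continuous_intros q_cont)
    thus ?thesis by (simp add: norm_mult power2_eq_square)
  qed
  have "?E\<^sup>2 \<le> (LINT x|D. (cmod (q x))\<^sup>2)" by (rule square_integral_le[OF prob intq intq2])
  also have "\<dots> \<le> cmod (LINT x|D. cnj (R x) * q x)"
    unfolding eq[symmetric] norm_of_real by simp
  also have "\<dots> \<le> (LINT x|D. cmod (cnj (R x) * q x))" by (rule integral_norm_bound)
  also have "\<dots> \<le> (LINT x|D. \<beta> * cmod (q x))"
  proof (rule integral_mono_AE)
    show "integrable D (\<lambda>x. cmod (cnj (R x) * q x))" by (intro integrable_norm int continuous_intros R_cont q_cont)
    show "integrable D (\<lambda>x. \<beta> * cmod (q x))" by (intro integrable_mult_right intq)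
    show "AE x in D. cmod (cnj (R x) * q x) \<le> \<beta> * cmod (q x)"
      using bound by eventually_elim (simp add: norm_mult R_def mult_right_mono)
  qed
  finally have "?E * ?E \<le> \<beta> * ?E" by (simp add: power2_eq_square)
  moreover have "0 \<le> ?E" by simp
  ultimately have "?E \<le> \<beta>" using \<beta> by (cases "?E = 0") (auto simp: mult_le_cancel_right)
  thus ?thesis unfolding q_def d_def .
qed

text \<open>Nonnegativity of the supremum needs an element to compare with; \<open>V m\<close> is
  nonzero because \<open>T 0 0\<close> takes the value 1 at \<open>p\<close>.\<close>

lemma op_norm_nonneg: "0 \<le> op_norm_on ip (V m) (comp_op f)"
proof -
  have "0 < r m"
  proof (rule ccontr)
    assume "\<not> 0 < r m"
    hence "T 0 0 = 0" using V_expansion[OF T_in_V[of 0 m 0]] by simp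
    hence "T 0 0 p = 0" by simp
    thus False by (simp add: T_def)
  qed
  hence "0 \<le> hnorm ip (v 0 \<circ> f)" "hnorm ip (v 0 \<circ> f) \<le> op_norm_on ip (V m) (comp_op f)"
    using V_comp_in_H[OF v_in_V] hnorm_comp_le_op_norm by auto
  thus ?thesis by linarith
qed

text \<open>The residual is orthogonal to \<open>V n\<close> and no larger in norm than
  \<open>v i \<circ> f\<close>. The constant \<open>a\<close> is the squared radius of the support
  about \<open>p\<close>, divided by \<open>s\<close>.\<close>

lemma residual_bound:
  obtains a where "a > 0"
    "\<And>m n i. i < r m \<Longrightarrow> AE x in D. cmod (residual n (v i \<circ> f) x) \<le>
      op_norm_on ip (V m) (comp_op f) * (sqrt (a * exp a) * (sqrt a ^ n / sqrt (fact n)))"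
proof -
  have "bounded ((\<lambda>x. x - p) ` Z)"
    by (intro compact_imp_bounded compact_continuous_image continuous_intros Z)
  then obtain B where B: "B > 0" "\<And>x. x \<in> Z \<Longrightarrow> norm (x - p) \<le> B" unfolding bounded_pos by auto
  define a where "a = B\<^sup>2 / s"
  show ?thesis
  proof (rule that[of a])
    show a: "a > 0" using B s_pos by (simp add: a_def)
    fix m n i assume i: "i < r m"
    let ?O = "op_norm_on ip (V m) (comp_op f)"
    have vf: "v i \<circ> f \<in> H" by (rule V_comp_in_H[OF v_in_V[OF i]])
    have "cmod (residual n (v i \<circ> f) x) \<le> ?O * (sqrt (a * exp a) * (sqrt a ^ n / sqrt (fact n)))" if x: "x \<in> Z" for x
    proof -
      let ?y = "(norm (x - p))\<^sup>2 / s"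
      have "(norm (x - p))\<^sup>2 \<le> B\<^sup>2" using B(2)[OF x] by (rule power_mono) simp
      hence y: "0 \<le> ?y" "?y \<le> a"
        using less_imp_le[OF s_pos] by (simp_all only: a_def divide_right_mono divide_nonneg_nonneg zero_le_power2)
      \<comment> \<open>Replacing \<open>fact (Suc n)\<close> by \<open>fact n\<close> puts the
        bound into the shape of the final rate; the spare factor \<open>a\<close> goes into the
        constant.\<close>
      have "?y ^ Suc n / fact (Suc n) \<le> a ^ Suc n / fact n"
        using y by (intro frac_le power_mono fact_mono) auto
      hence "?y ^ Suc n / fact (Suc n) * exp ?y \<le> a ^ Suc n / fact n * exp a"
        using y a by (intro mult_mono) auto
      hence "sqrt (?y ^ Suc n / fact (Suc n) * exp ?y) \<le> sqrt (a ^ Suc n / fact n * exp a)"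
        by (rule real_sqrt_le_mono)
      also have "\<dots> = sqrt (a * exp a) * (sqrt a ^ n / sqrt (fact n))"
        by (simp add: real_sqrt_mult real_sqrt_divide real_sqrt_power)
      finally have s1: "sqrt (?y ^ Suc n / fact (Suc n) * exp ?y) \<le> sqrt (a * exp a) * (sqrt a ^ n / sqrt (fact n))" .
      have hn: "hnorm ip (residual n (v i \<circ> f)) \<le> ?O"
        using hnorm_residual[OF vf] hnorm_comp_le_op_norm[OF i] by (rule order_trans)
      have nn: "0 \<le> sqrt (?y ^ Suc n / fact (Suc n) * exp ?y)"
        using y(1) by (intro real_sqrt_ge_zero mult_nonneg_nonneg divide_nonneg_pos zero_le_power s_pos) auto
      have "cmod (residual n (v i \<circ> f) (p + (x - p))) \<le>
          g (p + (x - p)) * (hnorm ip (residual n (v i \<circ> f)) * sqrt (?y ^ Suc n / fact (Suc n) * exp ?y))"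
        by (rule ortho_bound[OF residual_in_H[OF vf] residual_ortho[OF vf]])
      also have "\<dots> \<le> 1 * (hnorm ip (residual n (v i \<circ> f)) * sqrt (?y ^ Suc n / fact (Suc n) * exp ?y))"
        by (intro mult_right_mono g_le_1 mult_nonneg_nonneg nn hnorm_nonneg residual_in_H vf)
      also have "\<dots> \<le> ?O * (sqrt (a * exp a) * (sqrt a ^ n / sqrt (fact n)))"
        unfolding mult_1 by (intro mult_mono hn s1 nn op_norm_nonneg)
      finally show ?thesis by simp
    qed
    thus "AE x in D. cmod (residual n (v i \<circ> f) x) \<le> ?O * (sqrt (a * exp a) * (sqrt a ^ n / sqrt (fact n)))"
      using Z(2) by (auto elim!: eventually_mono)
  qed
qed

text \<open>The exponential loss from extracting coefficients multiplies the factorial gain from the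
  residual, so the two bases merge into one \<open>R\<close>.\<close>

lemma limit_error:
  obtains b R where "b > 0" "R > 0"
    "\<And>n A i j. m \<le> n \<Longrightarrow> A \<in> carrier_mat (r n) (r n) \<Longrightarrow> A * Gram n = Cross n \<Longrightarrow> i < r m \<Longrightarrow> j < r m \<Longrightarrow>
      cmod (A $$ (i, j) - C_star k H ip f p v m $$ (i, j)) \<le>
        op_norm_on ip (V m) (comp_op f) * b * (R ^ n / sqrt (fact n))"
proof -
  obtain b1 R1 where b1: "b1 \<ge> 0" "R1 > 0"
    "\<And>n j c. m \<le> n \<Longrightarrow> j < r m \<Longrightarrow> cmod (c j) \<le> b1 * R1 ^ n * (LINT x|D. cmod (\<Sum>j<r n. c j * v j x))"
    using coefficient_bound by blast
  obtain a where a: "a > 0"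
    "\<And>m n i. i < r m \<Longrightarrow> AE x in D. cmod (residual n (v i \<circ> f) x) \<le>
      op_norm_on ip (V m) (comp_op f) * (sqrt (a * exp a) * (sqrt a ^ n / sqrt (fact n)))"
    using residual_bound by blast
  let ?O = "op_norm_on ip (V m) (comp_op f)"
  \<comment> \<open>The summand 1 makes \<open>b\<close> positive, since \<open>b1\<close> may be
    0.\<close>
  define b where "b = b1 * sqrt (a * exp a) + 1"
  define R where "R = R1 * sqrt a"
  show ?thesis
  proof (rule that[of b R])
    show "b > 0" "R > 0" using a b1 by (auto simp: b_def R_def add_nonneg_pos)
    fix n A i j
    assume mn: "m \<le> n" and A: "A \<in> carrier_mat (r n) (r n)" "A * Gram n = Cross n" and ij: "i < r m" "j < r m"
    have i: "i < r n" using ij(1) r_mono[OF mn] by simp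
    let ?\<beta> = "?O * (sqrt (a * exp a) * (sqrt a ^ n / sqrt (fact n)))"
    have \<beta>: "0 \<le> ?\<beta>" using a(1) by (intro mult_nonneg_nonneg op_norm_nonneg) auto
    have "cmod (A $$ (i, j) - C_star k H ip f p v m $$ (i, j)) = cmod (cnj (A $$ (i, j) - C_star k H ip f p v m $$ (i, j)))"
      by (simp only: complex_mod_cnj)
    also have "cnj (A $$ (i, j) - C_star k H ip f p v m $$ (i, j)) = cnj (A $$ (i, j)) - ip (v i \<circ> f) (v j)"
      using ij by (simp add: C_star_eq)
    also have "cmod (cnj (A $$ (i, j)) - ip (v i \<circ> f) (v j)) \<le> b1 * R1 ^ n *
        (LINT x|D. cmod (\<Sum>j<r n. (cnj (A $$ (i, j)) - ip (v i \<circ> f) (v j)) * v j x))"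
      by (rule b1(3)[OF mn ij(2), of "\<lambda>j. cnj (A $$ (i, j)) - ip (v i \<circ> f) (v j)"])
    also have "\<dots> \<le> b1 * R1 ^ n * ?\<beta>"
      using b1(1,2) by (intro mult_left_mono least_squares_error[OF A i V_comp_in_H[OF v_in_V[OF ij(1)]] a(2)[OF ij(1)] \<beta>]) auto
    also have "\<dots> = ?O * (b1 * sqrt (a * exp a)) * (R ^ n / sqrt (fact n))"
      by (simp add: R_def power_mult_distrib)
    also have "\<dots> \<le> ?O * b * (R ^ n / sqrt (fact n))"
      using a(1) b1(2) by (intro mult_right_mono mult_left_mono op_norm_nonneg) (auto simp: b_def R_def)
    finally show "cmod (A $$ (i, j) - C_star k H ip f p v m $$ (i, j)) \<le> ?O * b * (R ^ n / sqrt (fact n))" .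
  qed
qed

text \<open>Countably many averages occur, so one null set suffices. The matrix \<open>A\<close> is
  quantified inside the almost sure statement, yet its equation determines it because
  \<open>Gram n\<close> is invertible.\<close>

lemma empirical_limit:
  fixes P :: "'w measure" and X :: "nat \<Rightarrow> 'w \<Rightarrow> real ^ 'd"
  assumes P: "prob_space P" and indep: "prob_space.indep_vars P (\<lambda>_. borel) X UNIV"
    and distr: "\<And>i. distr P borel (X i) = D"
    and mn: "m \<le> n"
  shows "AE \<omega> in P. \<exists>A. A \<in> carrier_mat (r n) (r n) \<and> A * Gram n = Cross n \<and>
    (\<lambda>N. frob_norm (C_hat k p v m n N (\<lambda>i. X i \<omega>) (\<lambda>i. f (X i \<omega>)) - C_star k H ip f p v m)) \<longlonglongrightarrow>
      sqrt (\<Sum>i<r m. \<Sum>j<r m. (cmod (A $$ (i, j) - C_star k H ip f p v m $$ (i, j)))\<^sup>2)"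
proof -
  interpret P: prob_space P by (rule P)
  have slln: "AE \<omega> in P. (\<lambda>N. (\<Sum>l<N. h (X l \<omega>)) / of_nat N) \<longlonglongrightarrow> (LINT x|D. h x)"
    if h: "continuous_on UNIV h" for h :: "real ^ 'd \<Rightarrow> complex"
  proof -
    obtain b where "AE x in D. norm (h x) \<le> b" using cont_bounded[OF h] by blast
    thus ?thesis
      by (intro P.slln_bounded_complex[OF indep distr borel_measurable_continuous_onI[OF h]])
  qed
  have "AE \<omega> in P. \<forall>i j. (\<lambda>N. (\<Sum>l<N. cnj (v i (X l \<omega>)) * v j (X l \<omega>)) / of_nat N) \<longlonglongrightarrow>
      (LINT x|D. cnj (v i x) * v j x)"
    unfolding AE_all_countable by (intro allI slln continuous_intros v_cont)
  moreover have "AE \<omega> in P. \<forall>i j. (\<lambda>N. (\<Sum>l<N. cnj (v i (f (X l \<omega>))) * v j (X l \<omega>)) / of_nat N) \<longlonglongrightarrow>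
      (LINT x|D. cnj (v i (f x)) * v j x)"
    unfolding AE_all_countable by (intro allI slln continuous_intros v_cont vf_cont)
  ultimately show ?thesis
  proof eventually_elim
    case (elim \<omega>)
    define F where "F N = feature_mat v (r n) N (\<lambda>i. X i \<omega>)" for N
    define Y where "Y N = feature_mat v (r n) N (\<lambda>i. f (X i \<omega>))" for N
    have Gram_c: "Gram n \<in> carrier_mat (r n) (r n)" and Cross_c: "Cross n \<in> carrier_mat (r n) (r n)"
      by (simp_all add: Gram_def Cross_def)
    have limG: "(\<lambda>N. (F N * mat_adjoint (F N)) $$ (i, j) / of_nat N) \<longlonglongrightarrow> Gram n $$ (i, j)"
      if "i < r n" "j < r n" for i j
      using elim(1) that unfolding F_def feature_mat_gram[OF that] by (simp add: Gram_def)
    have limM: "(\<lambda>N. (Y N * mat_adjoint (F N)) $$ (i, j) / of_nat N) \<longlonglongrightarrow> Cross n $$ (i, j)"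
      if "i < r n" "j < r n" for i j
      using elim(2) that unfolding F_def Y_def feature_mat_gram[OF that] by (simp add: Cross_def)
    obtain A where A: "A \<in> carrier_mat (r n) (r n)" "A * Gram n = Cross n"
      "\<And>i j. i < r n \<Longrightarrow> j < r n \<Longrightarrow> (\<lambda>N. (Y N * pseudo_inverse (F N)) $$ (i, j)) \<longlonglongrightarrow> A $$ (i, j)"
      "\<forall>\<^sub>F N in sequentially. Y N * pseudo_inverse (F N) \<in> carrier_mat (r n) (r n)"
      using tendsto_pseudo_inverse_regression[of F "r n" Y "Gram n" "Cross n", OF _ _ Gram_c Cross_c det_Gram limG limM]
      unfolding F_def Y_def using feature_mat_carrier by blast
    let ?S = "C_star k H ip f p v m"
    have "(\<lambda>N. sqrt (\<Sum>i<r m. \<Sum>j<r m. (cmod ((Y N * pseudo_inverse (F N)) $$ (i, j) - ?S $$ (i, j)))\<^sup>2)) \<longlonglongrightarrow>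
        sqrt (\<Sum>i<r m. \<Sum>j<r m. (cmod (A $$ (i, j) - ?S $$ (i, j)))\<^sup>2)"
      using r_mono[OF mn] by (intro tendsto_intros A(3)) auto
    moreover have "\<forall>\<^sub>F N in sequentially.
        sqrt (\<Sum>i<r m. \<Sum>j<r m. (cmod ((Y N * pseudo_inverse (F N)) $$ (i, j) - ?S $$ (i, j)))\<^sup>2) =
        frob_norm (C_hat k p v m n N (\<lambda>i. X i \<omega>) (\<lambda>i. f (X i \<omega>)) - ?S)"
      using A(4)
    proof eventually_elim
      case (elim N)
      have S: "dim_row ?S = r m" "dim_col ?S = r m" by (simp_all add: C_star_eq)
      have "C_hat k p v m n N (\<lambda>i. X i \<omega>) (\<lambda>i. f (X i \<omega>)) $$ (i, j) = (Y N * pseudo_inverse (F N)) $$ (i, j)"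
        if "i < r m" "j < r m" for i j
        unfolding C_hat_def r_def[symmetric] F_def[symmetric] Y_def[symmetric]
        by (rule submatrix_leading_index[OF elim r_mono[OF mn] that])
      thus ?case unfolding frob_norm_def by (simp add: S)
    qed
    ultimately have "(\<lambda>N. frob_norm (C_hat k p v m n N (\<lambda>i. X i \<omega>) (\<lambda>i. f (X i \<omega>)) - ?S)) \<longlonglongrightarrow>
        sqrt (\<Sum>i<r m. \<Sum>j<r m. (cmod (A $$ (i, j) - ?S $$ (i, j)))\<^sup>2)"
      by (rule Lim_transform_eventually)
    thus ?case using A(1,2) by blast
  qed
qed

lemma empirical_limit_bound:
  fixes P :: "'w measure" and X :: "nat \<Rightarrow> 'w \<Rightarrow> real ^ 'd"
  assumes P: "prob_space P" and indep: "prob_space.indep_vars P (\<lambda>_. borel) X UNIV"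
    and distr: "\<And>i. distr P borel (X i) = D"
  obtains b R where "b > 0" "R > 0"
    "\<forall>n\<ge>m. AE \<omega> in P. \<exists>L. 0 \<le> L \<and> L \<le> op_norm_on ip (V m) (comp_op f) * b * (R ^ n / sqrt (fact n)) \<and>
      (\<lambda>N. frob_norm (C_hat k p v m n N (\<lambda>i. X i \<omega>) (\<lambda>i. f (X i \<omega>)) - C_star k H ip f p v m)) \<longlonglongrightarrow> L"
proof -
  let ?O = "op_norm_on ip (V m) (comp_op f)" and ?S = "C_star k H ip f p v m"
  obtain b R where b: "b > 0" "R > 0"
    "\<And>n A i j. m \<le> n \<Longrightarrow> A \<in> carrier_mat (r n) (r n) \<Longrightarrow> A * Gram n = Cross n \<Longrightarrow> i < r m \<Longrightarrow> j < r m \<Longrightarrow>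
      cmod (A $$ (i, j) - ?S $$ (i, j)) \<le> ?O * b * (R ^ n / sqrt (fact n))"
    using limit_error by blast
  show ?thesis
  \<comment> \<open>Passing from entries to the Frobenius norm of a square matrix of order
    \<open>r m\<close> costs the factor \<open>r m\<close>.\<close>
  proof (rule that[of "(real (r m) + 1) * b" R])
    show "(real (r m) + 1) * b > 0" "R > 0" using b by auto
    have "AE \<omega> in P. \<exists>L. 0 \<le> L \<and> L \<le> ?O * ((real (r m) + 1) * b) * (R ^ n / sqrt (fact n)) \<and>
      (\<lambda>N. frob_norm (C_hat k p v m n N (\<lambda>i. X i \<omega>) (\<lambda>i. f (X i \<omega>)) - ?S)) \<longlonglongrightarrow> L"
      if mn: "m \<le> n" for n
      using empirical_limit[OF P indep distr mn]
    proof eventually_elim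
      case (elim \<omega>)
      then obtain A where A: "A \<in> carrier_mat (r n) (r n)" "A * Gram n = Cross n"
        "(\<lambda>N. frob_norm (C_hat k p v m n N (\<lambda>i. X i \<omega>) (\<lambda>i. f (X i \<omega>)) - ?S)) \<longlonglongrightarrow>
          sqrt (\<Sum>i<r m. \<Sum>j<r m. (cmod (A $$ (i, j) - ?S $$ (i, j)))\<^sup>2)" by blast
      let ?B = "?O * b * (R ^ n / sqrt (fact n))"
      have B: "0 \<le> ?B" using b by (intro mult_nonneg_nonneg op_norm_nonneg) auto
      have "sqrt (\<Sum>i<r m. \<Sum>j<r m. (cmod (A $$ (i, j) - ?S $$ (i, j)))\<^sup>2) \<le> real (r m) * ?B"
        using b(3)[OF mn A(1,2)] B by (intro sqrt_double_sum_le) auto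
      also have "\<dots> \<le> (real (r m) + 1) * ?B" using B by (intro mult_right_mono) auto
      also have "\<dots> = ?O * ((real (r m) + 1) * b) * (R ^ n / sqrt (fact n))" by (simp only: mult_ac)
      finally show ?case using A(3)
        by (intro exI[of _ "sqrt (\<Sum>i<r m. \<Sum>j<r m. (cmod (A $$ (i, j) - ?S $$ (i, j)))\<^sup>2)"])
          (auto intro!: sum_nonneg)
    qed
    thus "\<forall>n\<ge>m. AE \<omega> in P. \<exists>L. 0 \<le> L \<and> L \<le> ?O * ((real (r m) + 1) * b) * (R ^ n / sqrt (fact n)) \<and>
      (\<lambda>N. frob_norm (C_hat k p v m n N (\<lambda>i. X i \<omega>) (\<lambda>i. f (X i \<omega>)) - ?S)) \<longlonglongrightarrow> L" by blast
  qed
qed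

end

section \<open>Decay of the rate and reduction of the concrete kernels and density to the common
  setting\<close>

lemma power_over_sqrt_fact_tendsto_0:
  assumes "R \<ge> 0"
  shows "(\<lambda>n. R ^ n / sqrt (fact n)) \<longlonglongrightarrow> 0"
proof -
  have "(\<lambda>n. (R\<^sup>2) ^ n / fact n) \<longlonglongrightarrow> 0"
    using summable_LIMSEQ_zero[OF summable_exp[of "R\<^sup>2"]] by (simp add: divide_inverse mult.commute)
  hence "(\<lambda>n. sqrt ((R\<^sup>2) ^ n / fact n)) \<longlonglongrightarrow> sqrt 0" by (rule tendsto_real_sqrt)
  thus ?thesis using assms by (simp add: real_sqrt_divide real_sqrt_power)
qed

lemma smooth_map_continuous: "smooth_map f \<Longrightarrow> continuous_on UNIV f"
  unfolding smooth_map_def by (metis Ck_map.simps(1))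

lemma smooth_map_differentiable: "smooth_map f \<Longrightarrow> f differentiable (at x)"
  unfolding smooth_map_def by (metis Ck_map.simps(2))

lemma density_lower_bound_on_ball:
  fixes \<rho> :: "'a::euclidean_space \<Rightarrow> real"
  assumes \<rho>: "\<rho> \<in> borel_measurable borel" and U: "open U" "U \<noteq> {}"
    and pos: "0 < essinf (restrict_space lborel U) (\<lambda>x. ereal (\<rho> x))"
  obtains x\<^sub>0 \<delta> c where "\<delta> > 0" "c \<ge> 0"
    "\<forall>h\<in>borel_measurable borel. (\<integral>\<^sup>+x. indicator (ball x\<^sub>0 \<delta>) x * h x \<partial>lborel) \<le>
      ennreal c * (\<integral>\<^sup>+x. h x \<partial>density lborel (\<lambda>x. ennreal (\<rho> x)))"
proof -
  let ?M = "restrict_space lborel U"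
  obtain x\<^sub>0 where x\<^sub>0: "x\<^sub>0 \<in> U" using U(2) by blast
  obtain \<delta> where \<delta>: "\<delta> > 0" "ball x\<^sub>0 \<delta> \<subseteq> U" using U(1) x\<^sub>0 open_contains_ball by blast
  have "esssup ?M (\<lambda>x. - ereal (\<rho> x)) < 0" using pos by (simp add: essinf_def ereal_less_uminus_reorder)
  \<comment> \<open>The essential infimum is an extended real; \<open>- z\<close> is a real number
    strictly between 0 and it, and its inverse becomes the constant.\<close>
  then obtain z where z: "esssup ?M (\<lambda>x. - ereal (\<rho> x)) < ereal z" "ereal z < 0" using ereal_dense2 by blast
  have z0: "z < 0" using z(2) by simp
  have "AE x in ?M. - ereal (\<rho> x) \<le> esssup ?M (\<lambda>x. - ereal (\<rho> x))" by (rule esssup_AE)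
  hence "AE x in ?M. - z \<le> \<rho> x"
  proof eventually_elim
    case (elim x)
    hence "- ereal (\<rho> x) < ereal z" using z(1) by (rule le_less_trans)
    thus ?case by simp
  qed
  hence "AE x in lborel. x \<in> U \<longrightarrow> - z \<le> \<rho> x"
    using U(1) by (subst (asm) AE_restrict_space_iff) auto
  hence AE: "AE x in lborel. x \<in> ball x\<^sub>0 \<delta> \<longrightarrow> 1 \<le> (1 / - z) * \<rho> x"
    by eventually_elim (use \<delta>(2) z0 in \<open>auto simp: field_simps\<close>)
  show ?thesis
  proof (rule that[of \<delta> "1 / - z" x\<^sub>0])
    show "\<delta> > 0" by (rule \<delta>)
    show c: "1 / - z \<ge> 0" using z0 by simp
    show "\<forall>h\<in>borel_measurable borel. (\<integral>\<^sup>+x. indicator (ball x\<^sub>0 \<delta>) x * h x \<partial>lborel) \<le>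
      ennreal (1 / - z) * (\<integral>\<^sup>+x. h x \<partial>density lborel (\<lambda>x. ennreal (\<rho> x)))"
    proof
      fix h :: "'a \<Rightarrow> ennreal" assume h [measurable]: "h \<in> borel_measurable borel"
      note [measurable] = \<rho>
      have "(\<integral>\<^sup>+x. indicator (ball x\<^sub>0 \<delta>) x * h x \<partial>lborel) \<le> (\<integral>\<^sup>+x. ennreal (1 / - z) * (ennreal (\<rho> x) * h x) \<partial>lborel)"
      proof (rule nn_integral_mono_AE)
        show "AE x in lborel. indicator (ball x\<^sub>0 \<delta>) x * h x \<le> ennreal (1 / - z) * (ennreal (\<rho> x) * h x)"
          using AE
        proof eventually_elim
          case (elim x)
          show ?case
          proof (cases "x \<in> ball x\<^sub>0 \<delta>")
            case True
            hence "ennreal 1 \<le> ennreal ((1 / - z) * \<rho> x)" using elim by (intro ennreal_leI) blast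
            also have "\<dots> = ennreal (1 / - z) * ennreal (\<rho> x)" by (rule ennreal_mult'[OF c])
            finally have "1 * h x \<le> ennreal (1 / - z) * ennreal (\<rho> x) * h x"
              by (intro mult_right_mono) auto
            thus ?thesis using True by (simp add: mult.assoc)
          qed simp
        qed
      qed
      also have "\<dots> = ennreal (1 / - z) * (\<integral>\<^sup>+x. ennreal (\<rho> x) * h x \<partial>lborel)"
        by (rule nn_integral_cmult) measurable
      also have "(\<integral>\<^sup>+x. ennreal (\<rho> x) * h x \<partial>lborel) = (\<integral>\<^sup>+x. h x \<partial>density lborel (\<lambda>x. ennreal (\<rho> x)))"
        by (rule nn_integral_density[symmetric]) measurable
      finally show "(\<integral>\<^sup>+x. indicator (ball x\<^sub>0 \<delta>) x * h x \<partial>lborel) \<le>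
          ennreal (1 / - z) * (\<integral>\<^sup>+x. h x \<partial>density lborel (\<lambda>x. ennreal (\<rho> x)))" .
    qed
  qed
qed

theorem theorem1p4:
  fixes p :: "real ^ 'd"
    and k :: "real ^ 'd \<Rightarrow> real ^ 'd \<Rightarrow> complex"
    and H :: "(real ^ 'd \<Rightarrow> complex) set"
    and ip :: "(real ^ 'd \<Rightarrow> complex) \<Rightarrow> (real ^ 'd \<Rightarrow> complex) \<Rightarrow> complex"
    and f :: "real ^ 'd \<Rightarrow> real ^ 'd"
    and v :: "nat \<Rightarrow> real ^ 'd \<Rightarrow> complex"
    and P :: "'w measure"
    and X :: "nat \<Rightarrow> 'w \<Rightarrow> real ^ 'd"
    and \<rho> :: "real ^ 'd \<Rightarrow> real"
    and U :: "(real ^ 'd) set"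
  assumes kernel: "k = exp_kernel p \<or> (\<exists>\<sigma>>0. k = gauss_kernel \<sigma>)"
    and rkhs: "rkhs k H ip"
    and f_smooth: "smooth_map f"
    and f_fixed: "f p = p"
    and jets_in_domain: "jet_space k p \<subseteq> comp_op_dom H f"
    and basis: "adapted_onb k ip p v"
    and prob: "prob_space P"
    and indep: "prob_space.indep_vars P (\<lambda>_. borel) X UNIV"
    and density_nonneg: "\<And>x. 0 \<le> \<rho> x"
    and density: "\<And>i. distributed P lborel (X i) (\<lambda>x. ennreal (\<rho> x))"
    and density_support: "compact (closure {x. \<rho> x \<noteq> 0})"
    and U: "open U" "U \<noteq> {}"
    and density_pos: "0 < essinf (restrict_space lborel U) (\<lambda>x. ereal (\<rho> x))"
  shows "\<forall>m::nat.
    (\<exists>b>0. \<exists>R>0. \<forall>n\<ge>m. AE \<omega> in P.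
       convergent (\<lambda>N. frob_norm
         (C_hat k p v m n N (\<lambda>i. X i \<omega>) (\<lambda>i. f (X i \<omega>)) - C_star k H ip f p v m)) \<and>
       lim (\<lambda>N. frob_norm
         (C_hat k p v m n N (\<lambda>i. X i \<omega>) (\<lambda>i. f (X i \<omega>)) - C_star k H ip f p v m))
       \<le> op_norm_on ip (jet_space_upto k p m) (comp_op f)
           * (b * real n ^ m) * (R ^ n / sqrt (fact n))) \<and>
    (AE \<omega> in P.
       (\<lambda>n. lim (\<lambda>N. frob_norm
         (C_hat k p v m n N (\<lambda>i. X i \<omega>) (\<lambda>i. f (X i \<omega>)) - C_star k H ip f p v m)))
       \<longlonglongrightarrow> 0)"
proof -
  obtain \<kappa> s where \<kappa>s: "0 \<le> \<kappa>" "0 < s" "k = weighted_exp_kernel \<kappa> s p"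
  proof (cases "k = exp_kernel p")
    case True
    then show ?thesis by (intro that[of 0 1]) (simp_all add: exp_kernel_eq[of p])
  next
    case False
    then obtain \<sigma> where \<sigma>: "\<sigma> > 0" "k = gauss_kernel \<sigma>" using kernel by blast
    then show ?thesis
      by (intro that[of "1 / (2 * \<sigma>\<^sup>2)" "\<sigma>\<^sup>2"]) (simp_all add: gauss_kernel_eq[OF \<sigma>(1), of p])
  qed
  have \<rho>: "\<rho> \<in> borel_measurable borel"
    using distributed_real_measurable[OF _ density[of 0]] density_nonneg by simp
  obtain x\<^sub>0 \<delta> c where dom: "\<delta> > 0" "c \<ge> 0"
    "\<forall>h\<in>borel_measurable borel. (\<integral>\<^sup>+x. indicator (ball x\<^sub>0 \<delta>) x * h x \<partial>lborel) \<le>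
      ennreal c * (\<integral>\<^sup>+x. h x \<partial>density lborel (\<lambda>x. ennreal (\<rho> x)))"
    by (rule density_lower_bound_on_ball[OF \<rho> U density_pos]) (rule that)
  define D where "D = density lborel (\<lambda>x. ennreal (\<rho> x))"
  have distr: "distr P borel (X i) = D" for i
  proof -
    have "distr P borel (X i) = distr P lborel (X i)" by (rule distr_cong) auto
    thus ?thesis using density[of i] by (simp add: distributed_def D_def)
  qed
  have X0: "X 0 \<in> measurable P borel" using density[of 0] by (simp add: distributed_def)
  note prob_P = prob
  interpret rkhs k H ip by (rule rkhs)
  interpret D: prob_space D using prob_space.prob_space_distr[OF prob X0] unfolding distr .
  \<comment> \<open>The compact set carrying \<open>D\<close> is the closure of the set where the
    density is nonzero.\<close>
  interpret jet_sampling k H ip p \<kappa> s v f D "closure {x. \<rho> x \<noteq> 0}" x\<^sub>0 \<delta> c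
  proof unfold_locales
    show "jet_space k p \<subseteq> H" using jets_in_domain unfolding comp_op_dom_def by blast
    show "sets D = sets borel" by (simp add: D_def)
    show "continuous_on UNIV f" "f differentiable (at p)"
      by (rule smooth_map_continuous[OF f_smooth] smooth_map_differentiable[OF f_smooth])+
    show "AE x in D. x \<in> closure {x. \<rho> x \<noteq> 0}"
      unfolding D_def using \<rho> by (subst AE_density) (auto intro!: AE_I2 closure_subset[THEN subsetD])
  qed (use \<kappa>s f_fixed jets_in_domain basis density_support dom in \<open>simp_all add: D_def\<close>)
  show ?thesis
  proof (intro allI)
    fix m
    let ?O = "op_norm_on ip (V m) (comp_op f)"
    let ?err = "\<lambda>n \<omega> N. frob_norm (C_hat k p v m n N (\<lambda>i. X i \<omega>) (\<lambda>i. f (X i \<omega>)) - C_star k H ip f p v m)"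
    obtain b R where bR: "b > 0" "R > 0"
      "\<forall>n\<ge>m. AE \<omega> in P. \<exists>L. 0 \<le> L \<and> L \<le> ?O * b * (R ^ n / sqrt (fact n)) \<and> ?err n \<omega> \<longlonglongrightarrow> L"
      by (rule empirical_limit_bound[OF prob_P indep distr, of m]) (rule that)
    have "AE \<omega> in P. convergent (?err n \<omega>) \<and> lim (?err n \<omega>) \<le> ?O * (b * real n ^ m) * (R ^ n / sqrt (fact n))"
      if mn: "m \<le> n" for n
      using bR(3)[rule_format, OF mn]
    proof eventually_elim
      case (elim \<omega>)
      then obtain L where L: "L \<le> ?O * b * (R ^ n / sqrt (fact n))" "?err n \<omega> \<longlonglongrightarrow> L" by blast
      \<comment> \<open>For \<open>m = 0\<close> the power is 1 even at \<open>n = 0\<close>;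
        otherwise \<open>n \<ge> m \<ge> 1\<close>.\<close>
      have "1 \<le> real n ^ m" using mn by (cases "m = 0") (auto intro: one_le_power)
      hence "?O * b * (R ^ n / sqrt (fact n)) * 1 \<le> ?O * b * (R ^ n / sqrt (fact n)) * real n ^ m"
        using bR(1,2) op_norm_nonneg[of m] by (intro mult_left_mono) auto
      hence "L \<le> ?O * (b * real n ^ m) * (R ^ n / sqrt (fact n))" using L(1) by (simp add: mult_ac)
      thus ?case using L(2) by (auto simp: limI convergentI)
    qed
    hence 1: "\<exists>b>0. \<exists>R>0. \<forall>n\<ge>m. AE \<omega> in P. convergent (?err n \<omega>) \<and>
        lim (?err n \<omega>) \<le> ?O * (b * real n ^ m) * (R ^ n / sqrt (fact n))"
      using bR(1,2) by blast
    \<comment> \<open>The exceptional null sets for the individual n are merged before n tends to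
      infinity; the lower bound 0 on each limit then allows a comparison with the rate.\<close>
    have "AE \<omega> in P. \<forall>n. m \<le> n \<longrightarrow> (\<exists>L. 0 \<le> L \<and> L \<le> ?O * b * (R ^ n / sqrt (fact n)) \<and> ?err n \<omega> \<longlonglongrightarrow> L)"
      unfolding AE_all_countable using bR(3) by (auto simp: AE_conj_iff)
    hence 2: "AE \<omega> in P. (\<lambda>n. lim (?err n \<omega>)) \<longlonglongrightarrow> 0"
    proof eventually_elim
      case (elim \<omega>)
      have lim: "0 \<le> lim (?err n \<omega>)" "lim (?err n \<omega>) \<le> ?O * b * (R ^ n / sqrt (fact n))" if "m \<le> n" for n
        using elim that limI by metis+
      have "(\<lambda>n. ?O * b * (R ^ n / sqrt (fact n))) \<longlonglongrightarrow> 0"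
        using tendsto_mult_left[OF power_over_sqrt_fact_tendsto_0[of R], of "?O * b"] bR(2) by simp
      moreover have "\<forall>\<^sub>F n in sequentially. norm (lim (?err n \<omega>)) \<le> ?O * b * (R ^ n / sqrt (fact n))"
        using eventually_ge_at_top[of m] by eventually_elim (use lim in auto)
      ultimately show ?case by (rule Lim_null_comparison[rotated])
    qed
    show "(\<exists>b>0. \<exists>R>0. \<forall>n\<ge>m. AE \<omega> in P. convergent (?err n \<omega>) \<and>
        lim (?err n \<omega>) \<le> ?O * (b * real n ^ m) * (R ^ n / sqrt (fact n))) \<and>
        (AE \<omega> in P. (\<lambda>n. lim (?err n \<omega>)) \<longlonglongrightarrow> 0)"
      using 1 2 by blast
  qed
qed

end
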